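(* Let $q=p^r$ be a power of a prime $p$ with $r\ge 1$, let $n\ge 1$, let $V=\mathbb F_q^n$ be the natural $GL_n(q)$-module, and let $I=(n_1,\dots,n_\ell)$ be a composition of $n$ with associated standard parabolic subgroup $P_I$. Put $m_0=0$ and $m_i=n_1+\cdots+n_i$ for $1\le i\le\ell$. With $M_{m;b_1,\dots,b_j}$ and $\theta_i$ as defined in the context: (1) $(S^\bullet(V)\otimes\wedge^\bullet(V))^{P_I}$ is a free $S^\bullet(V)^{P_I}$-module of rank $2^n$, with a basis consisting of $1$ and the elements $$M_{m_i;b_1,\dots,b_j}\,\theta_1^{q-2}\cdots\theta_i^{q-2}$$ for $1\le i\le\ell$, $1\le j\le m_i$ and $0\le b_1<b_2<\cdots<b_j\le m_i-1$ with $b_j\ge m_{i-1}$. (2) For every integer $k$ with $1\le k\le q-2$, $(S^\bullet(V)\otimes\wedge^\bullet(V)\otimes\mathrm{Det}^k)^{P_I}$ is a free $S^\bullet(V)^{P_I}$-module of rank $2^n$, with a basis consisting of $(\theta_1\cdots\theta_\ell)^{q-1-k}$ and the elements $$M_{m_i;b_1,\dots,b_j}\,\theta_1^{q-2-k}\cdots\theta_i^{q-2-k}\,\theta_{i+1}^{q-1-k}\cdots\theta_\ell^{q-1-k}$$ for $1\le i\le\ell$, $1\le j\le m_i$ and $0\le b_1<b_2<\cdots<b_j\le m_i-1$ with $b_j\ge m_{i-1}$.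
   Context: Identify $S^\bullet(V)=\mathbb F_q[x_1,\dots,x_n]$ and $\wedge^\bullet(V)=E[y_1,\dots,y_n]$ (exterior algebra), where $x_1,\dots,x_n$ and $y_1,\dots,y_n$ are both copies of the standard basis of $V$; $GL_n(q)$ acts by algebra automorphisms with $g\cdot x_j=\sum_k g_{kj}x_k$, $g\cdot y_j=\sum_k g_{kj}y_k$. The module $S^\bullet(V)\otimes\wedge^\bullet(V)\otimes\mathrm{Det}^k$ is identified with $S^\bullet(V)\otimes\wedge^\bullet(V)$ endowed with the twisted action $g\cdot_k f=\det(g)^k\,(g\cdot f)$. A composition is a sequence of positive integers with sum $n$; $P_I$ is the subgroup of $GL_n(q)$ of block upper triangular matrices with invertible diagonal blocks of sizes $n_1,\dots,n_\ell$. For $1\le j\le m\le n$ and $0\le b_1<\cdots<b_j\le m-1$, $M_{m;b_1,\dots,b_j}\in\mathbb F_q[x_1,\dots,x_n]\otimes E[y_1,\dots,y_n]$ is $\frac1{j!}$ times the row determinant $|A|=\sum_{\sigma\in S_m}\mathrm{sgn}(\sigma)a_{1\sigma(1)}\cdots a_{m\sigma(m)}$ of the $m\times m$ matrix whose first $j$ rows are all equal to $(y_1,\dots,y_m)$ and whose remaining $m-j$ rows are $(x_1^{q^e},\dots,x_m^{q^e})$ for $e\in\{0,1,\dots,m-1\}\setminus\{b_1,\dots,b_j\}$ in increasing order of $e$. The factor $\frac1{j!}$ is understood formally (the determinant over $\mathbb Z$ is divisible by $j!$), so explicitly $$M_{m;b_1,\dots,b_j}=\sum_{1\le a_1<\cdots<a_j\le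 m}(-1)^{a_1+\cdots+a_j-\frac{j(j+1)}2}\,y_{a_1}\cdots y_{a_j}\,\det\big(x_c^{q^e}\big)_{e\notin\{b_1,\dots,b_j\},\,c\notin\{a_1,\dots,a_j\}},$$ with $e\in\{0,\dots,m-1\}$ indexing rows and $c\in\{1,\dots,m\}$ indexing columns, both increasing (an empty determinant is $1$). For $m\ge1$, $L_m(z_1,\dots,z_m)=\det\big(z_c^{q^{e}}\big)_{0\le e\le m-1,\,1\le c\le m}$. For $1\le i\le\ell$, $1\le j\le n_i$ put $$v_{i,j}=\prod_{c_1,\dots,c_{m_{i-1}}\in\mathbb F_q}(c_1x_1+\cdots+c_{m_{i-1}}x_{m_{i-1}}+x_{m_{i-1}+j}),$$ and $\theta_i=L_{n_i}(v_{i,1},\dots,v_{i,n_i})$. *)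

theory Defs
  imports
    "HOL-Library.Poly_Mapping"
    "HOL-Library.FuncSet"
    "HOL-Library.Cardinality"
    "HOL-Computational_Algebra.Primes"
    "HOL-Algebra.Module"
    "Jordan_Normal_Form.Determinant"
    "Jordan_Normal_Form.DL_Submatrix"
begin

text \<open>
  Basis vectors, variables and the blocks of a composition are counted from 0: the variables are
  \<open>x\<^sub>0, \<dots>, x\<^sub>n\<^sub>-\<^sub>1\<close> and \<open>y\<^sub>0, \<dots>, y\<^sub>n\<^sub>-\<^sub>1\<close>. The exponents \<open>b\<close> in \<open>M\<^sub>m\<^sub>;\<^sub>b\<close> range over
  \<open>0, \<dots>, m - 1\<close> and are not shifted.
\<close>

type_synonym 'a mpoly = "(nat \<Rightarrow>\<^sub>0 nat) \<Rightarrow>\<^sub>0 'a"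

definition const :: "'a::zero \<Rightarrow> 'a mpoly" where
  "const a = Poly_Mapping.single 0 a"

definition X :: "nat \<Rightarrow> 'a::zero_neq_one mpoly" where
  "X i = Poly_Mapping.single (Poly_Mapping.single i 1) 1"

definition sym_alg :: "nat \<Rightarrow> 'a::zero mpoly set" where
  "sym_alg n = {f. \<forall>e \<in> Poly_Mapping.keys f. Poly_Mapping.keys e \<subseteq> {..<n}}"

definition poly_subst :: "(nat \<Rightarrow> 'a mpoly) \<Rightarrow> 'a::comm_ring_1 mpoly \<Rightarrow> 'a mpoly" where
  "poly_subst s f = (\<Sum>e \<in> Poly_Mapping.keys f.
     const (Poly_Mapping.lookup f e) * (\<Prod>i \<in> Poly_Mapping.keys e. s i ^ Poly_Mapping.lookup e i))"

text \<open>
  The coefficient of an element at \<open>A = {a\<^sub>1 < \<dots> < a\<^sub>j}\<close> is its coefficient at \<open>y\<^sub>a\<^sub>1 \<cdots> y\<^sub>a\<^sub>j\<close>, so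
  that \<open>A = {}\<close> belongs to the unit.
\<close>

type_synonym 'a sym_ext = "nat set \<Rightarrow>\<^sub>0 'a mpoly"

definition sym_ext_alg :: "nat \<Rightarrow> 'a::zero sym_ext set" where
  "sym_ext_alg n = {f. \<forall>A \<in> Poly_Mapping.keys f. A \<subseteq> {..<n} \<and> Poly_Mapping.lookup f A \<in> sym_alg n}"

definition ext_one :: "'a::comm_ring_1 sym_ext" where
  "ext_one = Poly_Mapping.single {} 1"

definition ext_smult :: "'a::comm_ring_1 mpoly \<Rightarrow> 'a sym_ext \<Rightarrow> 'a sym_ext" where
  "ext_smult p f = Poly_Mapping.map ((*) p) f"

text \<open>Sorting the factors of \<open>y\<^sub>A y\<^sub>B\<close> produces the sign \<open>(-1)\<close> to the number of inversions.\<close>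

definition inversions :: "nat set \<Rightarrow> nat set \<Rightarrow> nat" where
  "inversions A B = card {(a, b) \<in> A \<times> B. b < a}"

definition ext_mult :: "'a::comm_ring_1 sym_ext \<Rightarrow> 'a sym_ext \<Rightarrow> 'a sym_ext" where
  "ext_mult f g = (\<Sum>A \<in> Poly_Mapping.keys f. \<Sum>B \<in> Poly_Mapping.keys g.
     if A \<inter> B = {}
     then Poly_Mapping.single (A \<union> B)
            ((-1) ^ inversions A B * Poly_Mapping.lookup f A * Poly_Mapping.lookup g B)
     else 0)"

definition act_x :: "'a::comm_ring_1 mat \<Rightarrow> nat \<Rightarrow> 'a mpoly" where
  "act_x g j = (\<Sum>k < dim_row g. const (g $$ (k, j)) * X k)"

definition act_y :: "'a::comm_ring_1 mat \<Rightarrow> nat \<Rightarrow> 'a sym_ext" where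
  "act_y g j = (\<Sum>k < dim_row g. Poly_Mapping.single {k} (const (g $$ (k, j))))"

definition sym_act :: "'a::comm_ring_1 mat \<Rightarrow> 'a mpoly \<Rightarrow> 'a mpoly" where
  "sym_act g = poly_subst (act_x g)"

definition sym_ext_act :: "'a::comm_ring_1 mat \<Rightarrow> 'a sym_ext \<Rightarrow> 'a sym_ext" where
  "sym_ext_act g f = (\<Sum>A \<in> Poly_Mapping.keys f.
     ext_smult (sym_act g (Poly_Mapping.lookup f A))
       (foldr (\<lambda>a. ext_mult (act_y g a)) (sorted_list_of_set A) ext_one))"

definition twisted_act :: "nat \<Rightarrow> 'a::comm_ring_1 mat \<Rightarrow> 'a sym_ext \<Rightarrow> 'a sym_ext" where
  "twisted_act k g f = ext_smult (const (det g ^ k)) (sym_ext_act g f)"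

definition GL :: "nat \<Rightarrow> 'a::field mat set" where
  "GL n = {g \<in> carrier_mat n n. invertible_mat g}"

definition is_composition :: "nat list \<Rightarrow> nat \<Rightarrow> bool" where
  "is_composition I n \<longleftrightarrow> (\<forall>a \<in> set I. 0 < a) \<and> sum_list I = n"

text \<open>
  \<open>psum I i\<close> is \<open>m\<^sub>i = n\<^sub>1 + \<dots> + n\<^sub>i\<close>. With blocks counted from 0, block \<open>i\<close> thus occupies the
  positions from \<open>psum I i\<close> up to, but not including, \<open>psum I (Suc i)\<close>.
\<close>

definition psum :: "nat list \<Rightarrow> nat \<Rightarrow> nat" where
  "psum I i = sum_list (take i I)"

definition diag_block :: "nat list \<Rightarrow> nat \<Rightarrow> 'a mat \<Rightarrow> 'a mat" where
  "diag_block I i g = mat (I ! i) (I ! i) (\<lambda>(r, c). g $$ (psum I i + r, psum I i + c))"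

text \<open>
  An entry lies strictly below the block diagonal iff some block boundary \<open>m\<^sub>i\<close> separates its
  column from its row.
\<close>

definition parabolic :: "nat list \<Rightarrow> 'a::field mat set" where
  "parabolic I = {g \<in> GL (sum_list I).
     (\<forall>r < sum_list I. \<forall>c < sum_list I. \<forall>i < length I.
        c < psum I i \<and> psum I i \<le> r \<longrightarrow> g $$ (r, c) = 0) \<and>
     (\<forall>i < length I. invertible_mat (diag_block I i g))}"

definition inv_ring :: "nat \<Rightarrow> 'a::field mat set \<Rightarrow> 'a mpoly ring" where
  "inv_ring n G = \<lparr>
     carrier = {f \<in> sym_alg n. \<forall>g \<in> G. sym_act g f = f},
     mult = (*), one = 1, zero = 0, add = (+)\<rparr>"

text \<open>The fields \<open>mult\<close> and \<open>one\<close> of the module record play no role in a module.\<close>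

definition inv_module :: "nat \<Rightarrow> 'a::field mat set \<Rightarrow> nat \<Rightarrow> ('a mpoly, 'a sym_ext) module" where
  "inv_module n G k = \<lparr>
     carrier = {f \<in> sym_ext_alg n. \<forall>g \<in> G. twisted_act k g f = f},
     mult = undefined, one = undefined, zero = 0, add = (+), module.smult = ext_smult\<rparr>"

definition free_with_basis ::
  "('r, 'c) ring_scheme \<Rightarrow> ('r, 'm, 'd) module_scheme \<Rightarrow> nat \<Rightarrow> 'm set \<Rightarrow> bool" where
  "free_with_basis R M d B \<longleftrightarrow>
     Module.module R M \<and> finite B \<and> card B = d \<and> B \<subseteq> carrier M \<and>
     (\<forall>f \<in> carrier M. \<exists>!c. c \<in> B \<rightarrow>\<^sub>E carrier R \<and> f = (\<Oplus>\<^bsub>M\<^esub>b\<in>B. c b \<odot>\<^bsub>M\<^esub> b))"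

definition moore_mat :: "nat \<Rightarrow> nat \<Rightarrow> (nat \<Rightarrow> 'a::comm_ring_1 mpoly) \<Rightarrow> 'a mpoly mat" where
  "moore_mat q m z = mat m m (\<lambda>(e, c). z c ^ (q ^ e))"

definition Lpoly :: "nat \<Rightarrow> nat \<Rightarrow> (nat \<Rightarrow> 'a::comm_ring_1 mpoly) \<Rightarrow> 'a mpoly" where
  "Lpoly q m z = det (moore_mat q m z)"

text \<open>
  \<open>Mui q m {b\<^sub>1, \<dots>, b\<^sub>j}\<close> is \<open>M\<^sub>m\<^sub>;\<^sub>b\<^sub>1\<^sub>,\<^sub>\<dots>\<^sub>,\<^sub>b\<^sub>j\<close>. Counting the \<open>a\<close>'s from 0 turns the sign exponent
  \<open>a\<^sub>1 + \<dots> + a\<^sub>j - j (j + 1) / 2\<close> into \<open>a\<^sub>1 + \<dots> + a\<^sub>j - j (j - 1) / 2\<close>; this is nonnegative, so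
  the subtraction is not truncated.
\<close>

definition Mui :: "nat \<Rightarrow> nat \<Rightarrow> nat set \<Rightarrow> 'a::comm_ring_1 sym_ext" where
  "Mui q m B = (\<Sum>A \<in> {A. A \<subseteq> {..<m} \<and> card A = card B}.
     Poly_Mapping.single A
       ((-1) ^ (\<Sum>A - card A * (card A - 1) div 2) *
        det (submatrix (moore_mat q m X) ({..<m} - B) ({..<m} - A))))"

definition vpoly :: "nat list \<Rightarrow> nat \<Rightarrow> nat \<Rightarrow> 'a::{finite,field} mpoly" where
  "vpoly I i j = (\<Prod>c \<in> {..<psum I i} \<rightarrow>\<^sub>E (UNIV :: 'a set).
     (\<Sum>t < psum I i. const (c t) * X t) + X (psum I i + j))"

definition theta :: "nat \<Rightarrow> nat list \<Rightarrow> nat \<Rightarrow> 'a::{finite,field} mpoly" where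
  "theta q I i = Lpoly q (I ! i) (vpoly I i)"

end

theory Submission
  imports Defs
begin

text \<open>
  Over the fraction field the vectors \<open>\<eta>\<^sub>b\<close> defined by \<open>y\<^sub>a = \<Sum>\<^sub>b x\<^sub>a^(q^b) \<eta>\<^sub>b\<close> are invariant, and
  the products of the \<open>\<eta>\<close>'s are the \<open>M\<^sub>n\<^sub>;\<^sub>B\<close> divided by \<open>\<plusminus>L\<^sub>n\<close>. Hence the substitution
  \<open>y\<^sub>a \<mapsto> \<Sum>\<^sub>b x\<^sub>a^(q^b) z\<^sub>b\<close> turns a (semi-)invariant into a family of (semi-)invariant polynomials.
  For \<open>m = m\<^sub>i\<close> it sends \<open>M\<^sub>m\<^sub>;\<^sub>B\<close> to \<open>\<plusminus>L\<^sub>m\<close> times a vector \<open>\<zeta>\<^sub>B\<close>, where Dickson's relations express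
  \<open>x\<^sub>a^(q^k)\<close> for \<open>k \<ge> m\<close> by the lower Frobenius powers; these vectors are unitriangular, so every
  invariant is uniquely \<open>\<Sum> d\<^sub>B \<zeta>\<^sub>B\<close> with semi-invariant polynomials \<open>d\<^sub>B\<close>. Since
  \<open>\<theta>\<^sub>1 \<cdots> \<theta>\<^sub>i = L\<^sub>m\<close> is a product of pairwise coprime linear forms, it remains to show that \<open>d\<^sub>B\<close> is
  divisible by the right power of each of them. Unipotent elements reduce this to the variables
  \<open>x\<^sub>s\<close>, where the diagonal torus determines the exponents of \<open>x\<^sub>s\<close> modulo \<open>q - 1\<close>; for the trivial
  twist a transvection rules out the exponent 0.
\<close>

text \<open>The exponents of the thetas come from one product. If \<open>s_i\<close> is the factor
  in front of \<open>M_(m_i;B)\<close>, the substitution sends this basis element, up to sign, to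
  \<open>s_i L_(m_i)\<close> times \<open>zeta B\<close>; so \<open>s_i L_(m_i)\<close> has to
  divide every possible coefficient \<open>d_B\<close>. For a twist \<open>k\<close> with
  \<open>1 <= k <= q - 2\<close> the product is \<open>L_n^(q-1-k)\<close> at every level: exponents
  of \<open>x_s\<close> in \<open>d_B\<close> are congruent to \<open>-k\<close> modulo
  \<open>q - 1\<close>, hence at least \<open>q - 1 - k\<close>. For \<open>k = 0\<close> it is
  \<open>L_(m_i)^(q-1)\<close> and depends on the level. This is the obstacle: the torus now permits
  exponent 0, and \<open>x_s\<close> need only divide \<open>d_B\<close> when
  \<open>s < m_i\<close>. Let \<open>s\<close> lie in block \<open>t\<close>, counted from 0. The
  part of \<open>f\<close> in the generators before that block admits no transvection that would
  force a factor \<open>x_s\<close>, but it contributes only to \<open>d_B\<close> of level at most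
  \<open>t\<close> and can be split off. In the rest, a term \<open>y_A\<close> with
  \<open>s\<close> in \<open>A\<close> gets \<open>x_s^(q-2)\<close> from the torus and one more
  \<open>x_s\<close> from the substitution for \<open>y_s\<close>; if \<open>s\<close> is not in
  \<open>A\<close>, some \<open>c\<close> in \<open>A\<close> lies in block \<open>t\<close> or
  later, and the transvection makes the exponent a positive multiple of
  \<open>q - 1\<close>.\<close>

abbreviation lookup :: "('b \<Rightarrow>\<^sub>0 'c::zero) \<Rightarrow> 'b \<Rightarrow> 'c" where
  "lookup \<equiv> Poly_Mapping.lookup"

abbreviation keys :: "('b \<Rightarrow>\<^sub>0 'c::zero) \<Rightarrow> 'b set" where
  "keys \<equiv> Poly_Mapping.keys"

section \<open>Wedge products on coefficient functions\<close>

text \<open>An element of an exterior algebra is the function of its coefficients at the increasing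
  products, and \<open>wedge n u\<close> is left multiplication by \<open>\<Sum>\<^sub>k\<^sub><\<^sub>n u\<^sub>k y\<^sub>k\<close>. The map \<open>ext_map n m T G\<close>
  substitutes \<open>y\<^sub>a \<mapsto> \<Sum>\<^sub>k\<^sub><\<^sub>m T\<^sub>a\<^sub>k z\<^sub>k\<close> and multiplies by \<open>G\<close> from the right.\<close>

definition y_wedge :: "nat \<Rightarrow> (nat set \<Rightarrow> 'r::comm_ring_1) \<Rightarrow> nat set \<Rightarrow> 'r" where
  "y_wedge k F A = (if k \<in> A then (-1) ^ card {b \<in> A. b < k} * F (A - {k}) else 0)"

definition wedge :: "nat \<Rightarrow> (nat \<Rightarrow> 'r) \<Rightarrow> (nat set \<Rightarrow> 'r::comm_ring_1) \<Rightarrow> nat set \<Rightarrow> 'r" where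
  "wedge n u F A = (\<Sum>k<n. u k * y_wedge k F A)"

definition ext_unit :: "nat set \<Rightarrow> 'r::comm_ring_1" where
  "ext_unit A = (if A = {} then 1 else 0)"

definition wedges :: "nat \<Rightarrow> (nat \<Rightarrow> nat \<Rightarrow> 'r) \<Rightarrow> nat set \<Rightarrow> (nat set \<Rightarrow> 'r::comm_ring_1) \<Rightarrow> nat set \<Rightarrow> 'r" where
  "wedges n T A G = foldr (\<lambda>a. wedge n (T a)) (sorted_list_of_set A) G"

definition ext_map :: "nat \<Rightarrow> nat \<Rightarrow> (nat \<Rightarrow> nat \<Rightarrow> 'r) \<Rightarrow> (nat set \<Rightarrow> 'r) \<Rightarrow> (nat set \<Rightarrow> 'r::comm_ring_1) \<Rightarrow> nat set \<Rightarrow> 'r" where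
  "ext_map n m T G F C = (\<Sum>A \<in> Pow {..<n}. F A * wedges m T A G C)"

definition unitv :: "nat \<Rightarrow> nat \<Rightarrow> 'r::comm_ring_1" where
  "unitv a k = (if k = a then 1 else 0)"

lemma y_wedge_y_wedge_same: "y_wedge k (y_wedge k F) A = 0"
  by (simp add: y_wedge_def)

lemma y_wedge_anticomm_less:
  assumes "k < l" shows "y_wedge k (y_wedge l F) A = - y_wedge l (y_wedge k F) A"
proof (cases "k \<in> A \<and> l \<in> A")
  case True
  have 1: "{b \<in> A. b < l} = insert k {b \<in> A - {k}. b < l}" using True assms by auto
  have "card {b \<in> A. b < l} = Suc (card {b \<in> A - {k}. b < l})"
    unfolding 1 by (subst card_insert_disjoint) auto
  moreover have "{b \<in> A - {l}. b < k} = {b \<in> A. b < k}" using assms by auto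
  moreover have "A - {k} - {l} = A - {l} - {k}" by auto
  ultimately show ?thesis using True assms
    by (simp add: y_wedge_def ac_simps)
next
  case False
  then show ?thesis by (auto simp: y_wedge_def)
qed

lemma y_wedge_anticomm: "k \<noteq> l \<Longrightarrow> y_wedge k (y_wedge l F) A = - y_wedge l (y_wedge k F) A"
  by (cases "k < l") (auto simp: y_wedge_anticomm_less dest: y_wedge_anticomm_less[of l k F A])

lemma y_wedge_cmult: "y_wedge k (\<lambda>A. c * F A) A = c * y_wedge k F A"
  by (simp add: y_wedge_def algebra_simps)

lemma y_wedge_sum: "y_wedge k (\<lambda>A. \<Sum>i\<in>S. F i A) A = (\<Sum>i\<in>S. y_wedge k (F i) A)"
  by (simp add: y_wedge_def sum_distrib_left)

lemma wedge_cmult: "wedge n u (\<lambda>A. c * F A) A = c * wedge n u F A"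
  by (simp add: wedge_def y_wedge_cmult sum_distrib_left ac_simps)

lemma wedge_sum: "wedge n u (\<lambda>A. \<Sum>i\<in>S. F i A) A = (\<Sum>i\<in>S. wedge n u (F i) A)"
proof -
  have "wedge n u (\<lambda>A. \<Sum>i\<in>S. F i A) A = (\<Sum>k<n. \<Sum>i\<in>S. u k * y_wedge k (F i) A)"
    by (simp add: wedge_def y_wedge_sum sum_distrib_left)
  also have "\<dots> = (\<Sum>i\<in>S. \<Sum>k<n. u k * y_wedge k (F i) A)" by (rule sum.swap)
  finally show ?thesis by (simp add: wedge_def)
qed

lemma wedge_vec_sum: "wedge n (\<lambda>k. \<Sum>i\<in>S. c i * v i k) F A = (\<Sum>i\<in>S. c i * wedge n (v i) F A)"
proof -
  have "wedge n (\<lambda>k. \<Sum>i\<in>S. c i * v i k) F A = (\<Sum>k<n. \<Sum>i\<in>S. c i * (v i k * y_wedge k F A))"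
    by (simp add: wedge_def sum_distrib_right mult.assoc)
  also have "\<dots> = (\<Sum>i\<in>S. \<Sum>k<n. c i * (v i k * y_wedge k F A))" by (rule sum.swap)
  finally show ?thesis by (simp add: wedge_def sum_distrib_left)
qed

lemma wedge_wedge: "wedge n u (wedge n v F) A = (\<Sum>k<n. \<Sum>l<n. u k * v l * y_wedge k (y_wedge l F) A)"
proof -
  have "wedge n u (wedge n v F) A = (\<Sum>k<n. u k * y_wedge k (\<lambda>A. \<Sum>l<n. v l * y_wedge l F A) A)"
    by (simp add: wedge_def[abs_def])
  then show ?thesis by (simp add: y_wedge_sum y_wedge_cmult sum_distrib_left mult.assoc)
qed

text \<open>Anticommutativity only shows that twice this vanishes, which says nothing in
  characteristic 2. The induction on \<open>n\<close> therefore cancels the mixed terms in pairs and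
  uses \<open>y_k y_k = 0\<close> on the diagonal.\<close>

lemma wedge_wedge_same: "wedge n u (wedge n u F) A = 0"
proof -
  have "(\<Sum>k<n. \<Sum>l<n. u k * u l * y_wedge k (y_wedge l F) A) = 0" for n
  proof (induction n)
    case (Suc n)
    have c: "u n * u l * y_wedge n (y_wedge l F) A = - (u l * u n * y_wedge l (y_wedge n F) A)" if "l < n" for l
      using y_wedge_anticomm[of n l F A] that by (simp add: ac_simps)
    have "(\<Sum>l<n. u n * u l * y_wedge n (y_wedge l F) A) = - (\<Sum>l<n. u l * u n * y_wedge l (y_wedge n F) A)"
      by (subst sum_negf[symmetric], rule sum.cong, simp, rule c, simp)
    then show ?case using Suc by (simp add: sum.distrib y_wedge_y_wedge_same)
  qed simp
  then show ?thesis by (simp add: wedge_wedge)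
qed

lemma wedge_anticomm: "wedge n u (wedge n v F) A = - wedge n v (wedge n u F) A"
proof -
  have a: "u k * v l * y_wedge k (y_wedge l F) A = - (v l * u k * y_wedge l (y_wedge k F) A)" for k l
    by (cases "k = l") (auto simp: y_wedge_y_wedge_same ac_simps y_wedge_anticomm[of k l])
  have "wedge n u (wedge n v F) A = (\<Sum>l<n. \<Sum>k<n. u k * v l * y_wedge k (y_wedge l F) A)"
    unfolding wedge_wedge by (rule sum.swap)
  also have "\<dots> = (\<Sum>l<n. \<Sum>k<n. - (v l * u k * y_wedge l (y_wedge k F) A))"
    by (simp only: a)
  finally show ?thesis by (simp add: wedge_wedge sum_negf)
qed

lemma wedge_unitv: "a < n \<Longrightarrow> wedge n (unitv a) F = y_wedge a F"
proof
  fix A assume "a < n"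
  have "wedge n (unitv a) F A = (\<Sum>k<n. if k = a then y_wedge k F A else 0)"
    unfolding wedge_def by (rule sum.cong) (auto simp: unitv_def)
  then show "wedge n (unitv a) F A = y_wedge a F A" using \<open>a < n\<close> by simp
qed

section \<open>Ordered products of vectors\<close>

lemma wedges_empty [simp]: "wedges n T {} G = G"
  by (simp add: wedges_def)

lemma sorted_list_of_set_insert_min:
  assumes "finite A" "\<forall>x\<in>A. a < x"
  shows "sorted_list_of_set (insert a A) = a # sorted_list_of_set A"
proof -
  have "a \<notin> A" using assms by auto
  then have 1: "insort a (sorted_list_of_set A) = sorted_list_of_set (insert a A)"
    using assms by simp
  have "sorted_list_of_set (insert a A) = insort a (sorted_list_of_set A)" using 1 by simp
  also have "\<dots> = a # sorted_list_of_set A"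
    using assms by (intro insort_is_Cons) (auto intro: less_imp_le)
  finally show ?thesis .
qed

lemma wedges_insert_min:
  assumes "finite A" "\<forall>x\<in>A. a < x"
  shows "wedges n T (insert a A) G = wedge n (T a) (wedges n T A G)"
  using sorted_list_of_set_insert_min[OF assms] by (simp add: wedges_def)

text \<open>In \<open>wedges\<close> the factor of smallest index stands outermost, so inductions on
  index sets add a new minimum.\<close>

lemma finite_min_induct [consumes 1, case_names empty insert]:
  assumes "finite (A::nat set)" "P {}"
    "\<And>a A. finite A \<Longrightarrow> \<forall>x\<in>A. a < x \<Longrightarrow> P A \<Longrightarrow> P (insert a A)"
  shows "P A"
  using assms(1) by (rule finite_linorder_min_induct) (use assms(2,3) in auto)

text \<open>The factor \<open>T a\<close> is moved to its sorted place past the factors of smaller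
  index, each costing a sign; if \<open>a\<close> already occurs, a square kills the
  product.\<close>

lemma wedge_wedges:
  assumes "finite A"
  shows "wedge n (T a) (wedges n T A G) C =
    (if a \<in> A then 0 else (-1) ^ card {b \<in> A. b < a} * wedges n T (insert a A) G C)"
  using assms
proof (induction A arbitrary: C rule: finite_min_induct)
  case empty
  show ?case using wedges_insert_min[of "{}" a n T G] by simp
next
  case (insert b A)
  consider "a < b" | "a = b" | "a > b" by linarith
  then show ?case
  proof cases
    case 1
    then have lt: "\<forall>x\<in>insert b A. a < x" using insert by force
    then have 0: "{x \<in> insert b A. x < a} = {}" by force
    have "a \<notin> insert b A" using lt by blast
    moreover have "wedges n T (insert a (insert b A)) G = wedge n (T a) (wedges n T (insert b A) G)"
      using insert(1) lt by (intro wedges_insert_min) auto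
    ultimately show ?thesis unfolding 0 by simp
  next
    case 2
    then show ?thesis using wedges_insert_min[OF insert(1,2), of n T G] by (simp add: wedge_wedge_same)
  next
    case 3
    have "b \<notin> A" using insert by auto
    have *: "wedge n (T a) (wedges n T A G) = (\<lambda>C. (if a \<in> A then 0 else (-1) ^ card {b \<in> A. b < a}) * wedges n T (insert a A) G C)"
      using insert.IH by auto
    have "wedge n (T a) (wedges n T (insert b A) G) C = wedge n (T a) (wedge n (T b) (wedges n T A G)) C"
      using wedges_insert_min[OF insert(1,2), of n T G] by simp
    also have "\<dots> = - wedge n (T b) (wedge n (T a) (wedges n T A G)) C" by (rule wedge_anticomm)
    also have "\<dots> = - ((if a \<in> A then 0 else (-1) ^ card {b \<in> A. b < a}) * wedge n (T b) (wedges n T (insert a A) G) C)"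
      unfolding * wedge_cmult ..
    also have "wedge n (T b) (wedges n T (insert a A) G) = wedges n T (insert b (insert a A)) G"
      by (rule wedges_insert_min[symmetric]) (use insert 3 in auto)
    finally have "wedge n (T a) (wedges n T (insert b A) G) C =
       - ((if a \<in> A then 0 else (-1) ^ card {b \<in> A. b < a}) * wedges n T (insert a (insert b A)) G C)"
      by (simp add: insert_commute)
    moreover have "{x \<in> insert b A. x < a} = insert b {x \<in> A. x < a}" using 3 by auto
    then have "card {x \<in> insert b A. x < a} = Suc (card {x \<in> A. x < a})"
      using \<open>b \<notin> A\<close> insert(1) by simp
    ultimately show ?thesis using 3 by simp
  qed
qed

section \<open>Substitution of linear forms for the exterior generators\<close>

lemma ext_map_ext_unit: "ext_map n m T G ext_unit = G"
proof
  fix C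
  have "ext_map n m T G ext_unit C = (\<Sum>A\<in>Pow {..<n}. if A = {} then G C else 0)"
    unfolding ext_map_def by (rule sum.cong) (auto simp: ext_unit_def)
  then show "ext_map n m T G ext_unit C = G C" by simp
qed

lemma ext_map_add: "ext_map n m T G (\<lambda>A. F A + H A) C = ext_map n m T G F C + ext_map n m T G H C"
  by (simp add: ext_map_def algebra_simps sum.distrib)

lemma ext_map_cmult: "ext_map n m T G (\<lambda>A. c * F A) C = c * ext_map n m T G F C"
  by (simp add: ext_map_def sum_distrib_left ac_simps)

lemma ext_map_sum: "ext_map n m T G (\<lambda>A. \<Sum>i\<in>S. F i A) C = (\<Sum>i\<in>S. ext_map n m T G (F i) C)"
proof -
  have "ext_map n m T G (\<lambda>A. \<Sum>i\<in>S. F i A) C = (\<Sum>A \<in> Pow {..<n}. \<Sum>i\<in>S. F i A * wedges m T A G C)"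
    by (simp add: ext_map_def sum_distrib_right)
  also have "\<dots> = (\<Sum>i\<in>S. \<Sum>A \<in> Pow {..<n}. F i A * wedges m T A G C)" by (rule sum.swap)
  finally show ?thesis by (simp add: ext_map_def)
qed

text \<open>Multiplicativity of the substitution on one generator: sets \<open>A\<close> containing
  \<open>a\<close> correspond to \<open>A - {a}\<close>, and sets that already contain
  \<open>a\<close> may be added to the sum since they give a repeated factor.\<close>

lemma ext_map_y_wedge:
  assumes a: "a < n"
  shows "ext_map n m T G (y_wedge a F) C = wedge m (T a) (ext_map n m T G F) C"
proof -
  have "ext_map n m T G (y_wedge a F) C = (\<Sum>A \<in> {A \<in> Pow {..<n}. a \<in> A}. (-1) ^ card {b \<in> A. b < a} * F (A - {a}) * wedges m T A G C)"
    unfolding ext_map_def y_wedge_def by (rule sum.mono_neutral_cong_right) auto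
  also have "\<dots> = (\<Sum>B \<in> {B \<in> Pow {..<n}. a \<notin> B}. (-1) ^ card {b \<in> B. b < a} * F B * wedges m T (insert a B) G C)"
  proof (rule sum.reindex_bij_witness[where j = "\<lambda>A. A - {a}" and i = "insert a"])
    fix A assume A: "A \<in> {A \<in> Pow {..<n}. a \<in> A}"
    then have "{b \<in> A - {a}. b < a} = {b \<in> A. b < a}" "insert a (A - {a}) = A" by auto
    then show "(-1) ^ card {b \<in> A - {a}. b < a} * F (A - {a}) * wedges m T (insert a (A - {a})) G C
        = (-1) ^ card {b \<in> A. b < a} * F (A - {a}) * wedges m T A G C"
      by simp
  qed (use a in auto)
  also have "\<dots> = (\<Sum>B \<in> Pow {..<n}. F B * wedge m (T a) (wedges m T B G) C)"
  proof (rule sum.mono_neutral_cong_left)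
    show "(-1) ^ card {b \<in> B. b < a} * F B * wedges m T (insert a B) G C = F B * wedge m (T a) (wedges m T B G) C"
      if "B \<in> {B \<in> Pow {..<n}. a \<notin> B}" for B
      using that wedge_wedges[of B m T a G C] by (auto simp: finite_subset ac_simps)
    show "\<forall>B\<in>Pow {..<n} - {B \<in> Pow {..<n}. a \<notin> B}. F B * wedge m (T a) (wedges m T B G) C = 0"
      using wedge_wedges[of _ m T a G C] finite_subset[of _ "{..<n}"] by auto
  qed auto
  also have "\<dots> = wedge m (T a) (ext_map n m T G F) C"
    unfolding ext_map_def wedge_sum wedge_cmult ..
  finally show ?thesis .
qed

lemma ext_map_wedge:
  "ext_map n m T G (wedge n u F) C = wedge m (\<lambda>k. \<Sum>a<n. u a * T a k) (ext_map n m T G F) C"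
proof -
  have "ext_map n m T G (wedge n u F) C = (\<Sum>a<n. u a * ext_map n m T G (y_wedge a F) C)"
    unfolding wedge_def ext_map_sum ext_map_cmult ..
  also have "\<dots> = (\<Sum>a<n. u a * wedge m (T a) (ext_map n m T G F) C)"
    by (simp add: ext_map_y_wedge)
  finally show ?thesis by (simp add: wedge_vec_sum)
qed

lemma ext_map_wedges:
  assumes "finite A"
  shows "ext_map n m S G (wedges n T A ext_unit) = wedges m (\<lambda>a k. \<Sum>b<n. T a b * S b k) A G"
  using assms
proof (induction A rule: finite_min_induct)
  case empty
  then show ?case by (simp add: ext_map_ext_unit)
next
  case (insert a A)
  have "ext_map n m S G (wedges n T (insert a A) ext_unit) = wedge m (\<lambda>k. \<Sum>b<n. T a b * S b k) (ext_map n m S G (wedges n T A ext_unit))"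
    unfolding wedges_insert_min[OF insert(1,2)] by (rule HOL.ext) (rule ext_map_wedge)
  then show ?case using insert by (simp add: wedges_insert_min)
qed

text \<open>Substitutions compose by the matrix product. This identity gives the inversion by the
  adjugate, the equivariance of \<open>Phi\<close> and the comparison of \<open>Phi m\<close> with
  \<open>Phi n\<close>.\<close>

lemma ext_map_comp:
  "ext_map n m S G (ext_map l n T ext_unit F) C = ext_map l m (\<lambda>a k. \<Sum>b<n. T a b * S b k) G F C"
proof -
  have "ext_map n m S G (ext_map l n T ext_unit F) C = (\<Sum>A\<in>Pow {..<l}. F A * ext_map n m S G (wedges n T A ext_unit) C)"
    unfolding ext_map_def[of l n T ext_unit F] ext_map_sum ext_map_cmult ..
  then show ?thesis using finite_subset[of _ "{..<l}"]
    by (auto simp: ext_map_wedges ext_map_def[of l m] intro!: sum.cong)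
qed

lemma wedges_cong:
  assumes "\<And>a k. a \<in> A \<Longrightarrow> k < n \<Longrightarrow> T a k = S a k" "finite A"
  shows "wedges n T A G = wedges n S A G"
  using assms(2,1)
proof (induction A rule: finite_min_induct)
  case (insert a A)
  have "wedges n T A G = wedges n S A G" by (rule insert.IH) (use insert.prems in auto)
  moreover have "wedge n (T a) H = wedge n (S a) H" for H
    using insert.prems by (auto simp: wedge_def fun_eq_iff)
  ultimately show ?case using insert by (simp add: wedges_insert_min)
qed simp

lemma ext_map_cong:
  assumes "\<And>a k. a < n \<Longrightarrow> k < m \<Longrightarrow> T a k = S a k" "\<And>A. A \<subseteq> {..<n} \<Longrightarrow> F A = H A"
  shows "ext_map n m T G F = ext_map n m S G H"
proof
  fix C
  have "wedges m T A G = wedges m S A G" if "A \<subseteq> {..<n}" for A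
    by (rule wedges_cong) (use assms that finite_subset[of _ "{..<n}"] in auto)
  then show "ext_map n m T G F C = ext_map n m S G H C" using assms(2) by (simp add: ext_map_def)
qed

lemma ext_map_unitv_wedges:
  assumes "finite A"
  shows "ext_map n n unitv G (wedges n T A ext_unit) = wedges n T A G"
proof -
  have "(\<Sum>b<n. T a b * unitv b k) = T a k" if "k < n" for a k
  proof -
    have "(\<Sum>b<n. T a b * unitv b k) = (\<Sum>b<n. if b = k then T a b else 0)"
      by (rule sum.cong) (auto simp: unitv_def)
    then show ?thesis using that by simp
  qed
  then show ?thesis unfolding ext_map_wedges[OF assms] by (intro wedges_cong) (use assms in auto)
qed

lemma wedges_deg:
  assumes "finite A" "wedges n T A ext_unit C \<noteq> 0"
  shows "card C = card A \<and> C \<subseteq> {..<n}"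
  using assms
proof (induction A arbitrary: C rule: finite_min_induct)
  case empty
  then show ?case by (auto simp: ext_unit_def split: if_splits)
next
  case (insert a A)
  from insert.prems wedges_insert_min[OF insert(1,2), of n T ext_unit]
  obtain k where k: "k < n" "y_wedge k (wedges n T A ext_unit) C \<noteq> 0"
    unfolding wedge_def by (metis (no_types, lifting) lessThan_iff mult_zero_right sum.neutral)
  then have kC: "k \<in> C" "wedges n T A ext_unit (C - {k}) \<noteq> 0" by (auto simp: y_wedge_def split: if_splits)
  from insert.IH[OF kC(2)] have *: "card (C - {k}) = card A" "C - {k} \<subseteq> {..<n}" by auto
  then have C: "C \<subseteq> {..<n}" using k by auto
  then have "finite C" using finite_subset by blast
  then have "card C = Suc (card (C - {k}))" using kC(1) by (metis card_Suc_Diff1)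
  moreover have "a \<notin> A" using insert(2) by blast
  ultimately show ?case using * C insert(1) by simp
qed

text \<open>The sign sorts \<open>y_A y_(D - A)\<close> into \<open>y_D\<close>: every
  \<open>a\<close> in \<open>A\<close> passes the smaller elements of \<open>D - A\<close>.\<close>

lemma wedges_unitv_at:
  assumes "finite A" "A \<subseteq> D" "A \<subseteq> {..<n}"
  shows "wedges n unitv A G D = (-1) ^ (\<Sum>a\<in>A. card {b \<in> D - A. b < a}) * G (D - A)"
  using assms
proof (induction A arbitrary: D rule: finite_min_induct)
  case (insert a A)
  have aA: "a \<notin> A" using insert(2) by blast
  have "wedges n unitv (insert a A) G D = y_wedge a (wedges n unitv A G) D"
    using wedges_insert_min[OF insert(1,2), of n unitv G] insert.prems by (simp add: wedge_unitv)
  also have "\<dots> = (-1) ^ card {b \<in> D. b < a} * wedges n unitv A G (D - {a})"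
    using insert.prems by (simp add: y_wedge_def)
  also have "wedges n unitv A G (D - {a}) = (-1) ^ (\<Sum>x\<in>A. card {b \<in> D - {a} - A. b < x}) * G (D - {a} - A)"
    by (rule insert.IH) (use insert.prems aA in auto)
  also have "D - {a} - A = D - insert a A" by auto
  also have "{b \<in> D. b < a} = {b \<in> D - insert a A. b < a}" using insert(2) by force
  finally show ?case using aA insert(1) by (simp add: power_add)
qed simp

lemma wedges_unitv:
  assumes "B \<subseteq> {..<n}" "finite C"
  shows "wedges n unitv B ext_unit C = (if C = B then 1 else 0 :: 'r::comm_ring_1)"
proof (cases "B \<subseteq> C")
  case True
  have fB: "finite B" using assms finite_subset by blast
  show ?thesis
  proof (cases "C = B")
    case True
    have "wedges n unitv B ext_unit B = (-1 :: 'r) ^ (\<Sum>a\<in>B. card {b \<in> B - B. b < a}) * ext_unit (B - B)"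
      by (rule wedges_unitv_at[OF fB subset_refl assms(1)])
    then show ?thesis using True by (simp add: ext_unit_def)
  next
    case False
    then have "C - B \<noteq> {}" using True by auto
    then show ?thesis using wedges_unitv_at[OF fB True assms(1), of ext_unit] False by (simp add: ext_unit_def)
  qed
next
  case False
  have fB: "finite B" using assms finite_subset by blast
  have "wedges n unitv B ext_unit C = (0 :: 'r)" if "\<not> B \<subseteq> C" for C :: "nat set"
    using fB assms(1) that
  proof (induction B arbitrary: C rule: finite_min_induct)
    case (insert a A)
    have "wedges n unitv (insert a A) ext_unit C = (y_wedge a (wedges n unitv A ext_unit) C :: 'r)"
      using insert by (simp add: wedges_insert_min wedge_unitv)
    moreover have "wedges n unitv A ext_unit (C - {a}) = (0 :: 'r)" if "a \<in> C"
      by (rule insert.IH) (use insert that in auto)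
    ultimately show ?case by (simp add: y_wedge_def cong: if_cong)
  qed simp
  then show ?thesis using False by auto
qed

lemma ext_map_out: "\<not> C \<subseteq> {..<m} \<Longrightarrow> ext_map n m T ext_unit F C = 0"
proof -
  assume "\<not> C \<subseteq> {..<m}"
  then have "wedges m T A ext_unit C = 0" if "A \<subseteq> {..<n}" for A
    using wedges_deg[of A m T C] finite_subset[OF that] by blast
  then show ?thesis by (simp add: ext_map_def)
qed

lemma ext_map_mono_supp:
  assumes "m \<le> n" "\<And>A. \<not> A \<subseteq> {..<m} \<Longrightarrow> F A = 0"
  shows "ext_map n l T G F C = ext_map m l T G F C"
  unfolding ext_map_def
  by (rule sum.mono_neutral_right) (use assms in auto)

lemma wedges_restrict:
  assumes "finite A" "C \<subseteq> {..<m}" "m \<le> n"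
  shows "wedges n T A ext_unit C = wedges m T A ext_unit C"
  using assms(1,2)
proof (induction A arbitrary: C rule: finite_min_induct)
  case (insert a A)
  have "wedge n (T a) (wedges n T A ext_unit) C = wedge m (T a) (wedges n T A ext_unit) C"
    unfolding wedge_def by (rule sum.mono_neutral_right) (use insert.prems assms(3) in \<open>auto simp: y_wedge_def\<close>)
  also have "\<dots> = wedge m (T a) (wedges m T A ext_unit) C"
    proof -
    have "wedges n T A ext_unit (C - {k}) = wedges m T A ext_unit (C - {k})" for k
      by (rule insert.IH) (use insert.prems in auto)
    then show ?thesis by (simp add: wedge_def y_wedge_def cong: if_cong)
  qed
  finally show ?case using insert by (simp add: wedges_insert_min)
qed simp

section \<open>Minors and generalized Laplace expansion\<close>

lemma pick_eqI: "x \<in> S \<Longrightarrow> card {a \<in> S. a < x} = i \<Longrightarrow> pick S i = x"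
  using pick_card_in_set by blast

lemma pick_insert_min:
  assumes "finite A" "\<forall>x\<in>A. a < x"
  shows "pick (insert a A) 0 = a" "i < card A \<Longrightarrow> pick (insert a A) (Suc i) = pick A i"
proof -
  have "{x \<in> insert a A. x < a} = {}" using assms by force
  then show "pick (insert a A) 0 = a" by (metis card.empty insertI1 pick_eqI)
next
  assume i: "i < card A"
  have p: "pick A i \<in> A" "card {x \<in> A. x < pick A i} = i"
    using i by (auto intro: pick_in_set_le card_pick_le)
  have "a \<notin> A" using assms by blast
  have "{x \<in> insert a A. x < pick A i} = insert a {x \<in> A. x < pick A i}" using p(1) assms by auto
  then have "card {x \<in> insert a A. x < pick A i} = Suc i"
    using p assms(1) \<open>a \<notin> A\<close> by simp
  then show "pick (insert a A) (Suc i) = pick A i" using p(1) by (intro pick_eqI) auto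
qed

text \<open>Removing the \<open>t\<close>-th element shifts the later ones by one; this is the index
  shift of \<open>mat_delete\<close> in a Laplace expansion.\<close>

lemma pick_remove:
  assumes "t < card C" "j < card C - 1"
  shows "pick (C - {pick C t}) j = pick C (if j < t then j else Suc j)"
proof (rule pick_eqI)
  let ?s = "if j < t then j else Suc j"
  have fin: "finite C" using assms(1) card.infinite by fastforce
  have s: "?s < card C" using assms by auto
  have st: "?s \<noteq> t" by auto
  have "pick C ?s \<noteq> pick C t"
    using pick_mono_le[of ?s C t] pick_mono_le[of t C ?s] s st assms(1) by (metis nat_neq_iff)
  then show "pick C ?s \<in> C - {pick C t}" using pick_in_set_le[OF s] by blast
  have c: "card {x \<in> C. x < pick C ?s} = ?s" by (rule card_pick_le[OF s])
  show "card {x \<in> C - {pick C t}. x < pick C ?s} = j"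
  proof (cases "j < t")
    case True
    then have "pick C j < pick C t" using pick_mono_le assms by blast
    then have "{x \<in> C - {pick C t}. x < pick C ?s} = {x \<in> C. x < pick C ?s}" using True by auto
    then show ?thesis using c True by simp
  next
    case False
    then have "pick C t < pick C (Suc j)" using pick_mono_le[of "Suc j" C t] s by auto
    then have "{x \<in> C. x < pick C ?s} = insert (pick C t) {x \<in> C - {pick C t}. x < pick C ?s}"
      using False pick_in_set_le[OF assms(1)] by auto
    then have "card {x \<in> C. x < pick C ?s} = Suc (card {x \<in> C - {pick C t}. x < pick C ?s})"
      using fin by simp
    then show ?thesis using c False by simp
  qed
qed

lemma bij_betw_pick:
  assumes "finite C"
  shows "bij_betw (pick C) {..<card C} C"
proof (rule bij_betw_byWitness[where f' = "\<lambda>k. card {a \<in> C. a < k}"])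
  show "\<forall>a\<in>{..<card C}. card {x \<in> C. x < pick C a} = a" using card_pick_le by auto
  show "\<forall>a'\<in>C. pick C (card {a \<in> C. a < a'}) = a'" using pick_card_in_set by auto
  show "pick C ` {..<card C} \<subseteq> C" using pick_in_set_le by auto
  show "(\<lambda>k. card {a \<in> C. a < k}) ` C \<subseteq> {..<card C}"
    using assms by (auto intro!: psubset_card_mono)
qed

lemma dim_submatrix_subset:
  assumes "M \<in> carrier_mat r c" "A \<subseteq> {..<r}" "C \<subseteq> {..<c}"
  shows "submatrix M A C \<in> carrier_mat (card A) (card C)"
proof -
  have "{i. i < r \<and> i \<in> A} = A" "{i. i < c \<and> i \<in> C} = C" using assms by auto
  then show ?thesis using assms by (auto simp: dim_submatrix intro!: carrier_matI)
qed

lemma submatrix_nth: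
  assumes "M \<in> carrier_mat r c" "A \<subseteq> {..<r}" "C \<subseteq> {..<c}" "i < card A" "j < card C"
  shows "submatrix M A C $$ (i, j) = M $$ (pick A i, pick C j)"
proof -
  have "{i. i < r \<and> i \<in> A} = A" "{i. i < c \<and> i \<in> C} = C" using assms by auto
  then show ?thesis using assms by (intro submatrix_index) auto
qed

text \<open>The outermost factor of \<open>wedges\<close> is the first row of the submatrix, so
  applying it is Laplace expansion along that row.\<close>

lemma wedges_minor:
  assumes "M \<in> carrier_mat r c" "A \<subseteq> {..<r}" "C \<subseteq> {..<c}" "card A = card C"
  shows "wedges c (\<lambda>a k. M $$ (a, k)) A ext_unit C = det (submatrix M A C)"
proof -
  have "finite A" using assms finite_subset by blast
  then show ?thesis using assms(2-4)
  proof (induction A arbitrary: C rule: finite_min_induct)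
    case empty
    then have "C = {}" using finite_subset[of C "{..<c}"] by simp
    moreover have "submatrix M {} {} \<in> carrier_mat 0 0"
      using dim_submatrix_subset[OF assms(1), of "{}" "{}"] by simp
    ultimately show ?case by (simp add: ext_unit_def)
  next
    case (insert a A)
    let ?S = "submatrix M (insert a A) C"
    have aA: "a \<notin> A" using insert(2) by blast
    have fC: "finite C" using insert.prems finite_subset by blast
    have cC: "card C = Suc (card A)" using insert.prems insert(1) aA by simp
    have S: "?S \<in> carrier_mat (card C) (card C)"
      using dim_submatrix_subset[OF assms(1) insert.prems(1,2)] insert.prems(3) by simp
    have del: "mat_delete ?S 0 t = submatrix M A (C - {pick C t})" if t: "t < card C" for t
    proof (rule eq_matI)
      have pt: "pick C t \<in> C" using pick_in_set_le[OF t] .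
      have D: "submatrix M A (C - {pick C t}) \<in> carrier_mat (card A) (card A)"
        using dim_submatrix_subset[OF assms(1), of A "C - {pick C t}"] insert.prems cC pt fC by auto
      then show "dim_row (mat_delete ?S 0 t) = dim_row (submatrix M A (C - {pick C t}))"
        "dim_col (mat_delete ?S 0 t) = dim_col (submatrix M A (C - {pick C t}))"
        using S cC by auto
      fix i j assume "i < dim_row (submatrix M A (C - {pick C t}))" "j < dim_col (submatrix M A (C - {pick C t}))"
      then have i: "i < card A" and j: "j < card A" using D by auto
      let ?s = "if j < t then j else Suc j"
      have "mat_delete ?S 0 t $$ (i, j) = ?S $$ (Suc i, ?s)"
        unfolding mat_delete_def using S i j cC by simp
      also have "\<dots> = M $$ (pick (insert a A) (Suc i), pick C ?s)"
        by (rule submatrix_nth[OF assms(1) insert.prems(1,2)]) (use insert.prems i j cC in auto)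
      also have "pick (insert a A) (Suc i) = pick A i" by (rule pick_insert_min(2)[OF insert(1,2) i])
      also have "pick C ?s = pick (C - {pick C t}) j"
        by (rule pick_remove[symmetric]) (use t j cC in auto)
      also have "M $$ (pick A i, pick (C - {pick C t}) j) = submatrix M A (C - {pick C t}) $$ (i, j)"
        by (rule submatrix_nth[symmetric, OF assms(1)]) (use insert.prems i j cC pt fC in auto)
      finally show "mat_delete ?S 0 t $$ (i, j) = submatrix M A (C - {pick C t}) $$ (i, j)" .
    qed
    let ?T = "\<lambda>a k. M $$ (a, k)"
    have "wedges c ?T (insert a A) ext_unit C = (\<Sum>k<c. M $$ (a, k) * y_wedge k (wedges c ?T A ext_unit) C)"
      using insert by (simp add: wedges_insert_min wedge_def)
    also have "\<dots> = (\<Sum>k\<in>C. M $$ (a, k) * ((-1) ^ card {b \<in> C. b < k} * wedges c ?T A ext_unit (C - {k})))"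
      by (rule sum.mono_neutral_cong_right) (use insert.prems in \<open>auto simp: y_wedge_def\<close>)
    also have "\<dots> = (\<Sum>k\<in>C. M $$ (a, k) * ((-1) ^ card {b \<in> C. b < k} * det (submatrix M A (C - {k}))))"
    proof (rule sum.cong[OF refl])
      fix k assume "k \<in> C"
      then have "wedges c ?T A ext_unit (C - {k}) = det (submatrix M A (C - {k}))"
        by (intro insert.IH) (use insert.prems cC fC in auto)
      then show "M $$ (a, k) * ((-1) ^ card {b \<in> C. b < k} * wedges c ?T A ext_unit (C - {k})) =
        M $$ (a, k) * ((-1) ^ card {b \<in> C. b < k} * det (submatrix M A (C - {k})))" by simp
    qed
    \<comment> \<open>Columns are re-indexed by their position \<open>t\<close> in \<open>C\<close>,
      because the number of elements of \<open>C\<close> below a column, which gives its sign, is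
      that position.\<close>
    also have "\<dots> = (\<Sum>t<card C. M $$ (a, pick C t) * ((-1) ^ card {b \<in> C. b < pick C t} * det (submatrix M A (C - {pick C t}))))"
      by (rule sum.reindex_bij_betw[OF bij_betw_pick[OF fC], symmetric])
    also have "\<dots> = (\<Sum>t<card C. ?S $$ (0, t) * cofactor ?S 0 t)"
    proof (rule sum.cong[OF refl])
      fix t assume "t \<in> {..<card C}"
      then have t: "t < card C" by simp
      have "?S $$ (0, t) = M $$ (pick (insert a A) 0, pick C t)"
        by (rule submatrix_nth[OF assms(1) insert.prems(1,2)]) (use insert.prems t cC in auto)
      then have "?S $$ (0, t) = M $$ (a, pick C t)" unfolding pick_insert_min(1)[OF insert(1,2)] .
      then show "M $$ (a, pick C t) * ((-1) ^ card {b \<in> C. b < pick C t} * det (submatrix M A (C - {pick C t})))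
          = ?S $$ (0, t) * cofactor ?S 0 t"
        unfolding cofactor_def del[OF t] card_pick_le[OF t] by simp
    qed
    also have "\<dots> = det ?S" by (rule laplace_expansion_row[symmetric, OF S]) (use cC in simp)
    finally show ?case .
  qed
qed

text \<open>Both sides are the same minor, read once by rows and once by columns; for different
  cardinalities both vanish by degree.\<close>

lemma wedges_transpose:
  assumes "M \<in> carrier_mat m m" "A \<subseteq> {..<m}" "C \<subseteq> {..<m}"
  shows "wedges m (\<lambda>a k. M $$ (k, a)) A ext_unit C = wedges m (\<lambda>a k. M $$ (a, k)) C ext_unit A"
proof (cases "card A = card C")
  case True
  have "wedges m (\<lambda>a k. M $$ (k, a)) A ext_unit C = wedges m (\<lambda>a k. transpose_mat M $$ (a, k)) A ext_unit C"
    by (rule fun_cong[of _ _ C], rule wedges_cong) (use assms finite_subset[OF assms(2)] in auto)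
  also have "\<dots> = det (submatrix (transpose_mat M) A C)"
    by (rule wedges_minor) (use assms True in auto)
  also have "submatrix (transpose_mat M) A C = transpose_mat (submatrix M C A)"
  proof (rule eq_matI)
    have c: "transpose_mat M \<in> carrier_mat m m" using assms by simp
    note d = dim_submatrix_subset[OF c assms(2,3)] dim_submatrix_subset[OF assms(1,3,2)]
    then show "dim_row (submatrix (transpose_mat M) A C) = dim_row (transpose_mat (submatrix M C A))"
      "dim_col (submatrix (transpose_mat M) A C) = dim_col (transpose_mat (submatrix M C A))" by auto
    fix i j assume "i < dim_row (transpose_mat (submatrix M C A))" "j < dim_col (transpose_mat (submatrix M C A))"
    then have ij: "i < card A" "j < card C" using d by auto
    then have "pick A i < m" "pick C j < m" using pick_in_set_le assms(2,3) by blast+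
    then show "submatrix (transpose_mat M) A C $$ (i, j) = transpose_mat (submatrix M C A) $$ (i, j)"
      using ij d assms by (simp add: submatrix_nth[OF c assms(2,3)] submatrix_nth[OF assms(1,3,2)])
  qed
  also have "det \<dots> = det (submatrix M C A)"
    using dim_submatrix_subset[OF assms(1,3,2)] True by (intro det_transpose) auto
  also have "\<dots> = wedges m (\<lambda>a k. M $$ (a, k)) C ext_unit A"
    by (rule wedges_minor[symmetric]) (use assms True in auto)
  finally show ?thesis .
next
  case False
  have fin: "finite A" "finite C" using assms finite_subset by blast+
  have "wedges m (\<lambda>a k. M $$ (k, a)) A ext_unit C = 0" using wedges_deg[OF fin(1)] False by metis
  moreover have "wedges m (\<lambda>a k. M $$ (a, k)) C ext_unit A = 0" using wedges_deg[OF fin(2)] False by metis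
  ultimately show ?thesis by simp
qed

lemma wedges_wedges:
  assumes "finite A" "finite B"
  shows "wedges n T A (wedges n T B G) C =
    (if A \<inter> B = {} then (-1) ^ (\<Sum>a\<in>A. card {b \<in> B. b < a}) * wedges n T (A \<union> B) G C else 0)"
  using assms(1)
proof (induction A arbitrary: C rule: finite_min_induct)
  case (insert a A)
  have aA: "a \<notin> A" using insert(2) by blast
  define c :: 'a where "c = (if A \<inter> B = {} then (-1) ^ (\<Sum>a\<in>A. card {b \<in> B. b < a}) else 0)"
  have *: "wedges n T A (wedges n T B G) = (\<lambda>C. c * wedges n T (A \<union> B) G C)"
    by (rule HOL.ext) (simp add: c_def insert.IH)
  have "{b \<in> A \<union> B. b < a} = {b \<in> B. b < a}" using insert(2) by auto
  then have 1: "wedge n (T a) (wedges n T (A \<union> B) G) C =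
      (if a \<in> A \<union> B then 0 else (-1) ^ card {b \<in> B. b < a} * wedges n T (insert a (A \<union> B)) G C)"
    using wedge_wedges[of "A \<union> B" n T a G C] insert(1) assms(2) by simp
  have "wedges n T (insert a A) (wedges n T B G) C = wedge n (T a) (wedges n T A (wedges n T B G)) C"
    by (simp add: wedges_insert_min[OF insert(1,2)])
  also have "\<dots> = c * wedge n (T a) (wedges n T (A \<union> B) G) C"
    unfolding * wedge_cmult ..
  finally show ?case unfolding 1 using aA insert(1) by (auto simp: c_def power_add)
qed simp

lemma wedges_full:
  assumes "M \<in> carrier_mat m m"
  shows "wedges m (\<lambda>a k. M $$ (a, k)) {..<m} ext_unit {..<m} = det M"
proof -
  have p: "pick {..<m} i = i" if "i < m" for i
  proof (rule pick_eqI)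
    have "{a \<in> {..<m}. a < i} = {..<i}" using that by auto
    then show "card {a \<in> {..<m}. a < i} = i" by simp
  qed (use that in simp)
  have "submatrix M {..<m} {..<m} = M"
  proof (rule eq_matI)
    fix i j assume "i < dim_row M" "j < dim_col M"
    then show "submatrix M {..<m} {..<m} $$ (i, j) = M $$ (i, j)"
      using assms by (simp add: submatrix_nth[OF assms] p)
  qed (use assms dim_submatrix_subset[OF assms, of "{..<m}" "{..<m}"] in auto)
  then show ?thesis using wedges_minor[OF assms, of "{..<m}" "{..<m}"] by simp
qed

lemma sum_card_below: "finite (A::nat set) \<Longrightarrow> (\<Sum>a\<in>A. card {b \<in> A. b < a}) = card A * (card A - 1) div 2"
proof (induction A rule: finite_linorder_max_induct)
  case (insert x A)
  have xA: "x \<notin> A" using insert by auto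
  have "{b \<in> insert x A. b < x} = A" using insert by auto
  moreover have "{b \<in> insert x A. b < a} = {b \<in> A. b < a}" if "a \<in> A" for a using that insert by auto
  ultimately have "(\<Sum>a\<in>insert x A. card {b \<in> insert x A. b < a}) = card A + card A * (card A - 1) div 2"
    using insert xA by simp
  also have "\<dots> = Suc (card A) * card A div 2" by (cases "card A") auto
  finally show ?case using insert xA by simp
qed simp

text \<open>Below \<open>a\<close> there are \<open>a\<close> numbers, some in \<open>A\<close> and
  some not. Summed over \<open>A\<close>, this turns the inversions of \<open>A\<close> against its
  complement into the sign exponent used in \<open>Mui\<close>.\<close>

lemma sum_card_complement_below:
  assumes "A \<subseteq> {..<m}"
  shows "(\<Sum>a\<in>A. card {b \<in> {..<m} - A. b < a}) = \<Sum>A - card A * (card A - 1) div 2"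
proof -
  have fA: "finite A" using assms finite_subset by blast
  have "(\<Sum>a\<in>A. card {b \<in> {..<m} - A. b < a}) + (\<Sum>a\<in>A. card {b \<in> A. b < a}) = (\<Sum>a\<in>A. a)"
    unfolding sum.distrib[symmetric]
  proof (rule sum.cong[OF refl])
    fix a assume "a \<in> A"
    then have "{..<a} = {b \<in> {..<m} - A. b < a} \<union> {b \<in> A. b < a}" using assms by auto
    then have "card {..<a} = card {b \<in> {..<m} - A. b < a} + card {b \<in> A. b < a}"
      using fA by (subst card_Un_disjoint[symmetric]) auto
    then show "card {b \<in> {..<m} - A. b < a} + card {b \<in> A. b < a} = a" by simp
  qed
  then show ?thesis using sum_card_below[OF fA] by simp
qed

section \<open>The elements \<open>M_(m;B)\<close> for an arbitrary square matrix\<close>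

definition mui_coeff :: "nat \<Rightarrow> 'r::comm_ring_1 mat \<Rightarrow> nat set \<Rightarrow> nat set \<Rightarrow> 'r" where
  "mui_coeff m M B A = (if A \<subseteq> {..<m} \<and> card A = card B
     then (-1) ^ (\<Sum>A - card A * (card A - 1) div 2) * det (submatrix M ({..<m} - B) ({..<m} - A)) else 0)"

definition mui_sign :: "nat set \<Rightarrow> 'r::comm_ring_1" where
  "mui_sign B = (-1) ^ (\<Sum>B - card B * (card B - 1) div 2)"

text \<open>Generalized Laplace expansion: the coefficient at \<open>C\<close> is the top
  coefficient of the wedge of the rows \<open>C\<close> followed by the rows outside
  \<open>B\<close>. A repeated row kills it unless \<open>C\<close> is contained in
  \<open>B\<close>, and a proper subset fails by degree; for \<open>C = B\<close> every row occurs
  once and only the sorting sign is left.\<close>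

lemma ext_map_mui_coeff:
  assumes M: "M \<in> carrier_mat m m" and B: "B \<subseteq> {..<m}" and C: "C \<subseteq> {..<m}"
  shows "ext_map m m (\<lambda>a b. M $$ (b, a)) ext_unit (mui_coeff m M B) C = (if C = B then mui_sign B * det M else 0)"
proof -
  let ?R = "\<lambda>a k. M $$ (a, k)" and ?T = "\<lambda>a k. M $$ (k, a)"
  let ?G = "wedges m ?R ({..<m} - B) ext_unit"
  have fin: "finite A" if "A \<subseteq> {..<m}" for A using that finite_subset by blast
  have cc: "card ({..<m} - A) = m - card A" "card A \<le> m" if "A \<subseteq> {..<m}" for A
    using that card_mono[OF _ that] by (auto simp: card_Diff_subset fin)
  \<comment> \<open>The two minors are wedge coefficients, of the rows \<open>C\<close> at
    \<open>A\<close> and of the rows outside \<open>B\<close> at the complement of \<open>A\<close>;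
    \<open>wedges_unitv_at\<close> supplies the sign of \<open>A\<close> against its
    complement.\<close>
  have term_eq: "mui_coeff m M B A * wedges m ?T A ext_unit C = wedges m ?R C ext_unit A * wedges m unitv A ?G {..<m}"
    if A: "A \<subseteq> {..<m}" for A
  proof (cases "card A = card B")
    case True
    have "det (submatrix M ({..<m} - B) ({..<m} - A)) = ?G ({..<m} - A)"
      by (rule wedges_minor[symmetric, OF M]) (use True cc[OF A] cc[OF B] in auto)
    then show ?thesis
      using A True wedges_unitv_at[OF fin[OF A] A A, of ?G] unfolding mui_coeff_def wedges_transpose[OF M A C]
      by (simp only: sum_card_complement_below[OF A]) simp
  next
    case False
    then have "?G ({..<m} - A) = 0"
      using wedges_deg[of "{..<m} - B" m ?R "{..<m} - A"] cc[OF A] cc[OF B] by force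
    then have "wedges m unitv A ?G {..<m} = 0" using wedges_unitv_at[OF fin[OF A] A A, of ?G] by simp
    then show ?thesis using False by (simp add: mui_coeff_def)
  qed
  have "ext_map m m ?T ext_unit (mui_coeff m M B) C = ext_map m m unitv ?G (wedges m ?R C ext_unit) {..<m}"
    unfolding ext_map_def by (rule sum.cong[OF refl], rule term_eq) simp
  also have "\<dots> = wedges m ?R C ?G {..<m}" by (simp add: ext_map_unitv_wedges fin[OF C])
  also have "\<dots> = (if C \<inter> ({..<m} - B) = {} then (-1) ^ (\<Sum>a\<in>C. card {b \<in> {..<m} - B. b < a}) *
      wedges m ?R (C \<union> ({..<m} - B)) ext_unit {..<m} else 0)"
    by (rule wedges_wedges) (use fin[OF C] in auto)
  finally have main: "ext_map m m ?T ext_unit (mui_coeff m M B) C = \<dots>" .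
  show ?thesis
  proof (cases "C = B")
    case True
    have "B \<union> ({..<m} - B) = {..<m}" using B by auto
    then show ?thesis unfolding main using True sum_card_complement_below[OF B] wedges_full[OF M]
      by (simp add: mui_sign_def)
  next
    case False
    show ?thesis
    proof (cases "card C = card B")
      case True
      then have "\<not> C \<subseteq> B" using False card_subset_eq[OF fin[OF B]] by blast
      then show ?thesis unfolding main using C False by auto
    next
      case False
      have "mui_coeff m M B A * wedges m ?T A ext_unit C = 0" if "A \<subseteq> {..<m}" for A
      proof (cases "card A = card B")
        case True
        then have "wedges m ?T A ext_unit C = 0" using wedges_deg[OF fin[OF that], of m ?T C] False by metis
        then show ?thesis by simp
      qed (simp add: mui_coeff_def)
      then show ?thesis using False by (auto simp: ext_map_def)
    qed
  qed
qed

lemma wedges_scale: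
  "finite A \<Longrightarrow> wedges n (\<lambda>a k. w a * T a k) A ext_unit C = (\<Prod>a\<in>A. w a) * wedges n T A ext_unit C"
proof (induction A arbitrary: C rule: finite_min_induct)
  case (insert a A)
  have aA: "a \<notin> A" using insert(2) by blast
  have IH: "wedges n (\<lambda>a k. w a * T a k) A ext_unit = (\<lambda>C. (\<Prod>a\<in>A. w a) * wedges n T A ext_unit C)"
    using insert.IH by auto
  have "wedge n (\<lambda>k. w a * T a k) H C = w a * wedge n (T a) H C" for H
    by (simp add: wedge_def sum_distrib_left mult.assoc)
  then show ?case using insert aA by (simp add: wedges_insert_min IH wedge_cmult)
qed simp

lemma ext_map_scalar:
  assumes "C \<subseteq> {..<n}"
  shows "ext_map n n (\<lambda>a k. w a * unitv a k) ext_unit F C = (\<Prod>a\<in>C. w a) * F C"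
proof -
  have fC: "finite C" using assms finite_subset by blast
  have "ext_map n n (\<lambda>a k. w a * unitv a k) ext_unit F C = (\<Sum>A\<in>Pow {..<n}. if A = C then (\<Prod>a\<in>C. w a) * F C else 0)"
    unfolding ext_map_def
  proof (rule sum.cong[OF refl])
    fix A assume "A \<in> Pow {..<n}"
    then have A: "A \<subseteq> {..<n}" "finite A" using finite_subset by auto
    show "F A * wedges n (\<lambda>a k. w a * unitv a k) A ext_unit C = (if A = C then (\<Prod>a\<in>C. w a) * F C else 0)"
      by (simp add: wedges_scale[OF A(2)] wedges_unitv[OF A(1) fC])
  qed
  then show ?thesis using assms by simp
qed

text \<open>Composing with the substitution by the adjugate leaves the scalar substitution
  \<open>det M\<close>. It multiplies the coefficient at \<open>C\<close> by
  \<open>det M ^ card C\<close>, which can be cancelled in a domain.\<close>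

lemma ext_map_inj:
  fixes M :: "'r::idom mat"
  assumes M: "M \<in> carrier_mat m m" and det: "det M \<noteq> 0"
    and zero: "\<And>C. C \<subseteq> {..<m} \<Longrightarrow> ext_map m m (\<lambda>a b. M $$ (b, a)) ext_unit F C = 0"
    and C: "C \<subseteq> {..<m}"
  shows "F C = 0"
proof -
  let ?S = "\<lambda>b k. adj_mat M $$ (k, b)"
  have adj: "adj_mat M \<in> carrier_mat m m" "adj_mat M * M = det M \<cdot>\<^sub>m 1\<^sub>m m" using adj_mat[OF M] by auto
  have "ext_map m m ?S ext_unit (ext_map m m (\<lambda>a b. M $$ (b, a)) ext_unit F) C
    = ext_map m m (\<lambda>a k. \<Sum>b<m. M $$ (b, a) * adj_mat M $$ (k, b)) ext_unit F C"
    by (rule ext_map_comp)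
  also have "\<dots> = ext_map m m (\<lambda>a k. det M * unitv a k) ext_unit F C"
  proof (rule fun_cong[of _ _ C], rule ext_map_cong)
    fix a k assume ak: "a < m" "k < m"
    have "(\<Sum>b<m. M $$ (b, a) * adj_mat M $$ (k, b)) = (adj_mat M * M) $$ (k, a)"
      using M adj(1) ak by (auto simp: scalar_prod_def mult.commute lessThan_atLeast0 intro!: sum.cong)
    also have "\<dots> = det M * unitv a k" unfolding adj(2) using ak by (simp add: unitv_def)
    finally show "(\<Sum>b<m. M $$ (b, a) * adj_mat M $$ (k, b)) = det M * unitv a k" .
  qed simp
  also have "\<dots> = det M ^ card C * F C" by (simp add: ext_map_scalar[OF C])
  finally have "det M ^ card C * F C = ext_map m m ?S ext_unit (ext_map m m (\<lambda>a b. M $$ (b, a)) ext_unit F) C" ..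
  also have "\<dots> = (\<Sum>A\<in>Pow {..<m}. 0)" unfolding ext_map_def[of m m ?S] using zero by (intro sum.cong) auto
  finally show ?thesis using det by simp
qed

section \<open>Polynomial substitution\<close>

lemma const_0 [simp]: "const 0 = 0" and const_1 [simp]: "const 1 = 1"
  and const_add: "const (a + b) = const a + const b"
  by (simp_all add: const_def single_add)

lemma const_mult: "const (a * b) = const a * (const b :: 'a::comm_ring_1 mpoly)"
  by (simp add: const_def mult_single)

lemma const_uminus: "const (- a) = - (const a :: 'a::comm_ring_1 mpoly)"
  by (simp add: const_def single_uminus)

lemma const_diff: "const (a - b) = const a - (const b :: 'a::comm_ring_1 mpoly)"
  by (simp add: const_def single_diff)

lemma const_power: "const (a ^ k) = (const a :: 'a::comm_ring_1 mpoly) ^ k"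
  by (induction k) (auto simp: const_mult)

lemma const_eq_0_iff [simp]: "const a = 0 \<longleftrightarrow> a = 0"
  unfolding const_def by (metis lookup_single_eq lookup_zero single_zero)

lemma of_nat_mpoly: "of_nat k = (const (of_nat k) :: 'a::comm_ring_1 mpoly)"
  by (induction k) (auto simp: const_add)

definition mon :: "(nat \<Rightarrow> 'r::comm_ring_1) \<Rightarrow> (nat \<Rightarrow>\<^sub>0 nat) \<Rightarrow> 'r" where
  "mon s e = (\<Prod>i \<in> keys e. s i ^ lookup e i)"

lemma mon_superset:
  "finite K \<Longrightarrow> keys e \<subseteq> K \<Longrightarrow> mon s e = (\<Prod>i \<in> K. s i ^ lookup e i)"
  unfolding mon_def by (rule prod.mono_neutral_left) (auto simp: in_keys_iff)

lemma mon_0 [simp]: "mon s 0 = 1"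
  by (simp add: mon_def)

lemma mon_add: "mon s (e + e') = mon s e * mon s e'"
proof -
  let ?K = "keys e \<union> keys e'"
  have "mon s (e + e') = (\<Prod>i \<in> ?K. s i ^ lookup (e + e') i)"
    by (rule mon_superset) (use keys_add[of e e'] in auto)
  also have "\<dots> = (\<Prod>i \<in> ?K. s i ^ lookup e i) * (\<Prod>i \<in> ?K. s i ^ lookup e' i)"
    by (simp add: lookup_add power_add prod.distrib)
  finally show ?thesis by (simp add: mon_superset[of ?K])
qed

lemma poly_subst_superset:
  assumes "finite E" "keys f \<subseteq> E"
  shows "poly_subst s f = (\<Sum>e\<in>E. const (lookup f e) * mon s e)"
  unfolding poly_subst_def mon_def[symmetric]
  by (rule sum.mono_neutral_left) (use assms in \<open>auto simp: in_keys_iff\<close>)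

lemma poly_subst_0 [simp]: "poly_subst s 0 = 0"
  by (simp add: poly_subst_def)

lemma poly_subst_single [simp]: "poly_subst s (Poly_Mapping.single e a) = const a * mon s e"
  using poly_subst_superset[of "{e}" "Poly_Mapping.single e a" s] by (simp add: lookup_single)

lemma poly_subst_add: "poly_subst s (f + g) = poly_subst s f + poly_subst s g"
proof -
  let ?E = "keys f \<union> keys g"
  have "poly_subst s (f + g) = (\<Sum>e\<in>?E. const (lookup (f + g) e) * mon s e)"
    by (rule poly_subst_superset) (use keys_add[of f g] in auto)
  then show ?thesis
    by (simp add: poly_subst_superset[of ?E] lookup_add const_add algebra_simps sum.distrib)
qed

lemma poly_subst_sum: "poly_subst s (\<Sum>i\<in>A. f i) = (\<Sum>i\<in>A. poly_subst s (f i))"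
  by (induction A rule: infinite_finite_induct) (auto simp: poly_subst_add)

lemma sum_single: "(\<Sum>e\<in>keys f. Poly_Mapping.single e (lookup f e)) = f"
proof (rule poly_mapping_eqI)
  fix k
  have "lookup (\<Sum>e\<in>keys f. Poly_Mapping.single e (lookup f e)) k
    = (\<Sum>e\<in>keys f. if e = k then lookup f e else 0)"
    unfolding lookup_sum by (rule sum.cong) (auto simp: lookup_single when_def)
  also have "\<dots> = lookup f k"
    by (auto simp: in_keys_iff sum.delta)
  finally show "lookup (\<Sum>e\<in>keys f. Poly_Mapping.single e (lookup f e)) k
    = lookup f k" .
qed

lemma poly_subst_mult: "poly_subst s (f * g) = poly_subst s f * poly_subst s g"
proof -
  define S where "S h = (\<Sum>e\<in>keys h. Poly_Mapping.single e (lookup h e))"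
    for h :: "'a mpoly"
  have S: "S h = h" for h unfolding S_def by (rule sum_single)
  have "poly_subst s (S f * S g) = poly_subst s (S f) * poly_subst s (S g)"
    by (simp add: S_def sum_product poly_subst_sum mult_single mon_add const_mult ac_simps)
  then show ?thesis by (simp add: S)
qed

lemma poly_subst_const [simp]: "poly_subst s (const a) = const a"
  by (simp add: const_def)

lemma poly_subst_1 [simp]: "poly_subst s 1 = 1"
  using poly_subst_const[of s 1] by simp

lemma poly_subst_X [simp]: "poly_subst s (X i) = s i"
proof -
  have "mon s (Poly_Mapping.single i 1) = (\<Prod>j\<in>{i}. s j ^ lookup (Poly_Mapping.single i 1) j)"
    by (rule mon_superset) auto
  then show ?thesis by (simp add: X_def)
qed

lemma comm_ring_hom_poly_subst: "comm_ring_hom (poly_subst s)"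
  by unfold_locales (auto simp: poly_subst_add poly_subst_mult)

lemma poly_subst_diff: "poly_subst s (f - g) = poly_subst s f - poly_subst s g"
  using poly_subst_add[of s "f - g" g] by (simp add: algebra_simps)

lemma poly_subst_uminus: "poly_subst s (- f) = - poly_subst s f"
  using poly_subst_diff[of s 0 f] by simp

lemma poly_subst_power: "poly_subst s (f ^ k) = poly_subst s f ^ k"
  by (induction k) (auto simp: poly_subst_mult)

lemma poly_subst_det: "poly_subst s (det M) = det (map_mat (poly_subst s) M)"
  using comm_ring_hom.hom_det[OF comm_ring_hom_poly_subst] by metis

lemma single_conv_X: "Poly_Mapping.single e (a::'a::comm_ring_1) = const a * mon X e"
proof -
  have "X i ^ k = Poly_Mapping.single (Poly_Mapping.single i k) (1::'a)" for i k
    by (induction k) (auto simp: X_def mult_single single_add[symmetric])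
  then have "mon X e = (\<Prod>i\<in>keys e. Poly_Mapping.single (Poly_Mapping.single i (lookup e i)) (1::'a))"
    by (simp add: mon_def)
  also have "\<dots> = Poly_Mapping.single (\<Sum>i\<in>keys e. Poly_Mapping.single i (lookup e i)) 1"
    by (induction rule: finite_induct[OF finite_keys[of e]]) (auto simp: mult_single)
  finally show ?thesis by (simp add: sum_single const_def mult_single)
qed

lemma X_power: "X i ^ k = Poly_Mapping.single (Poly_Mapping.single i k) (1::'a::comm_ring_1)"
  by (induction k) (auto simp: X_def mult_single single_add[symmetric])

lemma mpoly_induct [case_names const X add mult]:
  fixes f :: "'a::comm_ring_1 mpoly"
  assumes "\<And>a. P (const a)" "\<And>i. P (X i)" "\<And>f g. P f \<Longrightarrow> P g \<Longrightarrow> P (f + g)" "\<And>f g. P f \<Longrightarrow> P g \<Longrightarrow> P (f * g)"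
  shows "P f"
proof -
  have 0: "P 0" "P 1" using assms(1)[of 0] assms(1)[of 1] by auto
  have pow: "P (X i ^ k)" for i k by (induction k) (auto simp: 0 intro: assms)
  have "P (\<Prod>i\<in>A. X i ^ k i)" for A :: "nat set" and k
    by (induction A rule: infinite_finite_induct) (auto simp: 0 pow intro: assms)
  then have s: "P (Poly_Mapping.single e a)" for e a
    unfolding single_conv_X mon_def by (intro assms)
  have "P (\<Sum>e\<in>A. Poly_Mapping.single e (g e))" for A g
    by (induction A rule: infinite_finite_induct) (auto simp: 0 s intro: assms)
  then show ?thesis using sum_single[of f] by metis
qed

lemma poly_subst_id [simp]: "poly_subst X f = f"
  by (induction f rule: mpoly_induct) (auto simp: poly_subst_add poly_subst_mult)

lemma poly_subst_comp: "poly_subst s (poly_subst t f) = poly_subst (\<lambda>i. poly_subst s (t i)) f"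
  by (induction f rule: mpoly_induct) (auto simp: poly_subst_add poly_subst_mult)

lemma dvd_poly_subst: "d dvd f \<Longrightarrow> poly_subst s d dvd poly_subst s f"
  by (auto simp: poly_subst_mult elim!: dvdE)

text \<open>Agreement modulo \<open>d\<close> is inherited by sums and products. Used to reduce
  modulo a linear form, and to see that a transvection is trivial modulo a variable.\<close>

lemma dvd_poly_subst_diff:
  assumes "\<And>i. d dvd s i - t i"
  shows "d dvd poly_subst s f - poly_subst t f"
proof (induction f rule: mpoly_induct)
  case (add f g)
  then show ?case using dvd_add[OF add] by (simp add: poly_subst_add algebra_simps)
next
  case (mult f g)
  have "poly_subst s (f * g) - poly_subst t (f * g) =
      (poly_subst s f - poly_subst t f) * poly_subst s g + poly_subst t f * (poly_subst s g - poly_subst t g)"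
    by (simp add: poly_subst_mult algebra_simps)
  then show ?case using mult by simp
qed (use assms in auto)

subsection \<open>Polynomials in the first variables\<close>

definition cutoff :: "nat \<Rightarrow> nat \<Rightarrow> 'a::comm_ring_1 mpoly" where
  "cutoff n i = (if i < n then X i else 0)"

lemma poly_subst_cong:
  assumes "f \<in> sym_alg n" "\<And>i. i < n \<Longrightarrow> s i = t i"
  shows "poly_subst s f = poly_subst t f"
  unfolding poly_subst_def
  using assms by (intro sum.cong arg_cong2[where f = "(*)"] prod.cong refl) (auto simp: sym_alg_def subset_iff)

text \<open>A description as the fixed points of a ring endomorphism: closure under operations and
  determinants, and \<open>sym_alg_cancel\<close>, then follow without looking at exponents.\<close>

lemma sym_alg_iff: "f \<in> sym_alg n \<longleftrightarrow> poly_subst (cutoff n) f = f"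
proof
  assume "f \<in> sym_alg n"
  then have "poly_subst (cutoff n) f = poly_subst X f"
    by (rule poly_subst_cong) (simp add: cutoff_def)
  then show "poly_subst (cutoff n) f = f" by simp
next
  assume f: "poly_subst (cutoff n) f = f"
  have 0: "mon (cutoff n) e = (if keys e \<subseteq> {..<n} then mon X e else 0 :: 'a mpoly)" for e
  proof (cases "keys e \<subseteq> {..<n}")
    case True
    then show ?thesis unfolding mon_def by (auto simp: cutoff_def intro!: prod.cong)
  next
    case False
    then obtain i where i: "i \<in> keys e" "\<not> i < n" by auto
    then have "cutoff n i ^ lookup e i = (0 :: 'a mpoly)"
      by (simp add: cutoff_def in_keys_iff power_0_left)
    then have "mon (cutoff n) e = (0 :: 'a mpoly)" unfolding mon_def
      using i by (intro prod_zero) auto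
    then show ?thesis using False by simp
  qed
  let ?S = "{e \<in> keys f. keys e \<subseteq> {..<n}}"
  have "f = (\<Sum>e \<in> keys f. const (lookup f e) * mon (cutoff n) e)"
    using f poly_subst_superset[of "keys f" f "cutoff n"] by simp
  also have "\<dots> = (\<Sum>e \<in> ?S. Poly_Mapping.single e (lookup f e))"
    by (rule sum.mono_neutral_cong_right) (auto simp: 0 single_conv_X)
  finally have f_eq: "f = (\<Sum>e \<in> ?S. Poly_Mapping.single e (lookup f e))" .
  have "keys (\<Sum>e \<in> ?S. Poly_Mapping.single e (lookup f e))
      \<subseteq> (\<Union>e\<in>?S. keys (Poly_Mapping.single e (lookup f e)))"
    by (rule keys_sum)
  also have "\<dots> \<subseteq> ?S" by auto
  finally have "keys f \<subseteq> ?S" using f_eq by simp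
  then show "f \<in> sym_alg n" by (auto simp: sym_alg_def)
qed

lemma sym_alg_const [simp]: "const (a :: 'a::comm_ring_1) \<in> sym_alg n"
  and sym_alg_0 [simp]: "(0 :: 'a::comm_ring_1 mpoly) \<in> sym_alg n"
  and sym_alg_1 [simp]: "(1 :: 'a::comm_ring_1 mpoly) \<in> sym_alg n"
  and sym_alg_X: "i < n \<Longrightarrow> (X i :: 'a::comm_ring_1 mpoly) \<in> sym_alg n"
  and sym_alg_add: "f \<in> sym_alg n \<Longrightarrow> g \<in> sym_alg n \<Longrightarrow> f + g \<in> sym_alg n"
  and sym_alg_mult: "f \<in> sym_alg n \<Longrightarrow> g \<in> sym_alg n \<Longrightarrow> f * g \<in> sym_alg n"
  and sym_alg_diff: "f \<in> sym_alg n \<Longrightarrow> g \<in> sym_alg n \<Longrightarrow> f - g \<in> sym_alg n"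
  and sym_alg_uminus: "f \<in> sym_alg n \<Longrightarrow> - f \<in> sym_alg n"
  and sym_alg_power: "f \<in> sym_alg n \<Longrightarrow> f ^ k \<in> sym_alg n"
  for f g :: "'a::comm_ring_1 mpoly"
  by (simp_all add: sym_alg_iff poly_subst_add poly_subst_mult poly_subst_diff poly_subst_uminus poly_subst_power)
    (simp_all add: cutoff_def)

lemma sym_alg_det:
  assumes "M \<in> carrier_mat m m" "\<And>i j. i < m \<Longrightarrow> j < m \<Longrightarrow> M $$ (i, j) \<in> sym_alg n"
  shows "det M \<in> sym_alg n"
proof -
  have "map_mat (poly_subst (cutoff n)) M = M"
    using assms by (intro eq_matI) (auto simp: sym_alg_iff)
  then show ?thesis by (simp add: sym_alg_iff poly_subst_det)
qed

lemma sym_alg_cancel: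
  fixes f g :: "'a::idom mpoly"
  assumes "f * g \<in> sym_alg n" "f \<in> sym_alg n" "f \<noteq> 0"
  shows "g \<in> sym_alg n"
  using assms by (auto simp: sym_alg_iff poly_subst_mult)

subsection \<open>Divisibility by powers of a variable and by linear forms\<close>

lemma X_power_dvd_iff:
  fixes f :: "'a::comm_ring_1 mpoly"
  shows "X s ^ k dvd f \<longleftrightarrow> (\<forall>e \<in> keys f. k \<le> lookup e s)"
proof
  assume "X s ^ k dvd f"
  then obtain g where f: "f = X s ^ k * g" by (elim dvdE)
  show "\<forall>e \<in> keys f. k \<le> lookup e s"
  proof
    fix e assume "e \<in> keys f"
    then have "e \<in> {a + b |a b. a \<in> keys (X s ^ k :: 'a mpoly) \<and> b \<in> keys g}"
      unfolding f using keys_mult by blast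
    then show "k \<le> lookup e s" by (auto simp: X_power lookup_add)
  qed
next
  assume a: "\<forall>e \<in> keys f. k \<le> lookup e s"
  have "X s ^ k dvd Poly_Mapping.single e (lookup f e)" if "e \<in> keys f" for e
  proof -
    have "Poly_Mapping.single s k + (e - Poly_Mapping.single s k) = e"
      using a that by (intro poly_mapping_eqI) (auto simp: lookup_add lookup_minus lookup_single when_def)
    then have "Poly_Mapping.single e (lookup f e) =
        X s ^ k * Poly_Mapping.single (e - Poly_Mapping.single s k) (lookup f e)"
      by (simp add: X_power mult_single)
    then show ?thesis by simp
  qed
  then have "X s ^ k dvd (\<Sum>e\<in>keys f. Poly_Mapping.single e (lookup f e))"
    by (rule dvd_sum)
  then show "X s ^ k dvd f" by (simp add: sum_single)
qed

lemma lookup_X: "lookup (X i) e = (if e = Poly_Mapping.single i 1 then 1 else 0 :: 'a::comm_ring_1)"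
  by (auto simp: X_def lookup_single when_def)

lemma lookup_const_mult: "lookup (const c * f) e = c * lookup f e"
  unfolding const_def mult_map_scale_conv_mult[symmetric]
  by (simp add: Poly_Mapping.map.rep_eq when_def)

lemma single_one_inj: "Poly_Mapping.single i (Suc 0) = Poly_Mapping.single j (Suc 0) \<Longrightarrow> i = j"
  by (metis lookup_single_eq lookup_single_not_eq nat.distinct(1))

lemma lin_form_eq_0:
  fixes c :: "nat \<Rightarrow> 'a::comm_ring_1"
  assumes "(\<Sum>t<m. const (c t) * X t) = 0" "t < m"
  shows "c t = 0"
proof -
  have "(0 :: 'a) = lookup (\<Sum>t<m. const (c t) * X t) (Poly_Mapping.single t 1)"
    using assms(1) by simp
  also have "\<dots> = (\<Sum>i<m. if i = t then c t else 0)"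
    unfolding lookup_sum lookup_const_mult lookup_X
    by (rule sum.cong) (auto dest: single_one_inj)
  also have "\<dots> = c t" using assms(2) by simp
  finally show ?thesis by simp
qed

text \<open>Normalized so that the last occurring variable has coefficient 1: over a field each
  nonzero form has exactly one such multiple. Only the values of \<open>c\<close> below
  \<open>s\<close> matter.\<close>

definition lin_form :: "nat \<Rightarrow> (nat \<Rightarrow> 'a) \<Rightarrow> 'a::comm_ring_1 mpoly" where
  "lin_form s c = (\<Sum>t<s. const (c t) * X t) + X s"

definition elim_subst :: "nat \<Rightarrow> (nat \<Rightarrow> 'a) \<Rightarrow> nat \<Rightarrow> 'a::comm_ring_1 mpoly" where
  "elim_subst s c i = (if i = s then - (\<Sum>t<s. const (c t) * X t) else X i)"

text \<open>\<open>elim_subst\<close> solves \<open>lin_form s c = 0\<close> for \<open>X s\<close>,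
  so its kernel is the ideal of the form. Over a domain this makes the form a prime element.\<close>

lemma lin_form_dvd_iff: "lin_form s c dvd f \<longleftrightarrow> poly_subst (elim_subst s c) f = 0"
proof -
  have z: "poly_subst (elim_subst s c) (lin_form s c) = 0"
  proof -
    have "(\<Sum>t<s. const (c t) * elim_subst s c t) = (\<Sum>t<s. const (c t) * X t)"
      by (rule sum.cong) (auto simp: elim_subst_def)
    then show ?thesis
      by (simp add: lin_form_def poly_subst_add poly_subst_sum poly_subst_mult) (simp add: elim_subst_def)
  qed
  have "lin_form s c dvd poly_subst X f - poly_subst (elim_subst s c) f"
    by (rule dvd_poly_subst_diff) (auto simp: elim_subst_def lin_form_def add.commute)
  then have "lin_form s c dvd f - poly_subst (elim_subst s c) f" by simp
  then show ?thesis
    by (metis diff_zero dvd_0_left dvd_poly_subst z)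
qed

lemma lin_form_mult_dvd:
  fixes f g :: "'a::idom mpoly"
  shows "lin_form s c dvd f * g \<Longrightarrow> lin_form s c dvd f \<or> lin_form s c dvd g"
  unfolding lin_form_dvd_iff by (simp add: poly_subst_mult)

lemma lin_form_nonzero: "lin_form s (c :: nat \<Rightarrow> 'a::idom) \<noteq> 0"
proof
  assume "lin_form s c = 0"
  then have "(\<Sum>t<Suc s. const ((c(s := 1)) t) * X t) = 0" by (simp add: lin_form_def)
  from lin_form_eq_0[OF this, of s] show False by simp
qed

text \<open>Eliminating \<open>X s\<close> from a form with another last variable \<open>X t\<close>
  leaves a form with last variable \<open>X t\<close>, which is not zero. Hence
  \<open>s = t\<close>, and the coefficients can be compared.\<close>

lemma lin_form_dvd_lin_form:
  fixes c d :: "nat \<Rightarrow> 'a::idom"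
  assumes "lin_form s c dvd lin_form t d"
  shows "s = t \<and> (\<forall>i<s. c i = d i)"
proof -
  have 0: "poly_subst (elim_subst s c) (lin_form t d) = 0" using assms lin_form_dvd_iff by blast
  consider "s = t" | "s < t" | "t < s" by linarith
  then show ?thesis
  proof cases
    case 1
    have "(\<Sum>i<s. const (d i) * elim_subst s c i) = (\<Sum>i<s. const (d i) * X i)"
      by (rule sum.cong) (auto simp: elim_subst_def)
    with 0 1 have "(\<Sum>i<s. const (d i - c i) * X i) = 0"
      by (simp add: lin_form_def poly_subst_add poly_subst_sum poly_subst_mult const_diff left_diff_distrib sum_subtractf)
        (simp add: elim_subst_def)
    from lin_form_eq_0[OF this] 1 show ?thesis by auto
  next
    case 2
    have "(\<Sum>i<t. const (d i) * elim_subst s c i) = (\<Sum>i<t. const (if i = s then 0 else d i - (if i < s then d s * c i else 0)) * X i)"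
    proof -
      have "(\<Sum>i<t. const (d i) * elim_subst s c i) =
          (\<Sum>i<t. (if i = s then 0 else const (d i) * X i) + (if i = s then const (d s) * - (\<Sum>t<s. const (c t) * X t) else 0))"
        by (rule sum.cong) (auto simp: elim_subst_def)
      also have "\<dots> = (\<Sum>i<t. if i = s then 0 else const (d i) * X i) - const (d s) * (\<Sum>t<s. const (c t) * X t)"
        using 2 by (simp add: sum.distrib)
      also have "(\<Sum>i<s. const (c i) * X i) = (\<Sum>i<t. if i < s then const (c i) * X i else 0)"
        using 2 by (intro sum.mono_neutral_cong_left) auto
      finally show ?thesis
        by (simp add: sum_distrib_left sum_subtractf[symmetric])
          (intro sum.cong, auto simp: const_diff const_mult algebra_simps)
    qed
    with 0 2 have "lin_form t (\<lambda>i. if i = s then 0 else d i - (if i < s then d s * c i else 0)) = 0"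
      by (simp add: lin_form_def poly_subst_add poly_subst_sum poly_subst_mult) (simp add: elim_subst_def)
    then show ?thesis using lin_form_nonzero by blast
  next
    case 3
    have "(\<Sum>i<t. const (d i) * elim_subst s c i) = (\<Sum>i<t. const (d i) * X i)"
      using 3 by (intro sum.cong) (auto simp: elim_subst_def)
    then have "poly_subst (elim_subst s c) (lin_form t d) = lin_form t d"
      using 3 by (simp add: lin_form_def poly_subst_add poly_subst_sum poly_subst_mult) (simp add: elim_subst_def)
    then show ?thesis using 0 lin_form_nonzero by metis
  qed
qed

lemma lin_form_power_dvd_mult:
  fixes f g :: "'a::idom mpoly"
  assumes "lin_form s c ^ k dvd f * g" "\<not> lin_form s c dvd f"
  shows "lin_form s c ^ k dvd g"
  using assms(1)
proof (induction k arbitrary: g)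
  case (Suc k)
  then have "lin_form s c dvd f * g" by (metis dvd_mult_left power_Suc)
  then obtain h where g: "g = lin_form s c * h" using lin_form_mult_dvd assms(2) by blast
  have "lin_form s c * lin_form s c ^ k dvd lin_form s c * (f * h)" using Suc.prems by (simp add: g ac_simps)
  then have "lin_form s c ^ k dvd f * h" using lin_form_nonzero[of s c] by simp
  then have "lin_form s c ^ k dvd h" by (rule Suc.IH)
  then show ?case by (simp add: g mult_dvd_mono)
qed simp

lemma lin_form_dvd_prod:
  fixes f :: "'i \<Rightarrow> 'a::idom mpoly"
  assumes "lin_form s c dvd (\<Prod>i\<in>A. f i)" "finite A"
  shows "\<exists>i\<in>A. lin_form s c dvd f i"
  using assms(2,1)
proof (induction A rule: finite_induct)
  case empty
  then show ?case by (simp add: lin_form_dvd_iff)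
next
  case (insert x F)
  then have "lin_form s c dvd f x * prod f F" by simp
  then show ?case using lin_form_mult_dvd insert.IH by blast
qed

lemma lin_form_dvd_power: "lin_form s c dvd f ^ k \<Longrightarrow> lin_form s c dvd (f :: 'a::idom mpoly)"
  by (simp add: lin_form_dvd_iff poly_subst_power)

text \<open>The forms are primes not dividing one another, so the quotient by the powers already
  found is still divisible by the next power. \<open>distinct\<close> prevents one form from being
  listed under two functions that agree below \<open>s\<close>.\<close>

lemma prod_lin_form_power_dvd:
  fixes d :: "'a::idom mpoly"
  assumes "finite L" "\<And>s c. (s, c) \<in> L \<Longrightarrow> lin_form s c ^ k dvd d"
    and distinct: "\<And>s c c'. (s, c) \<in> L \<Longrightarrow> (s, c') \<in> L \<Longrightarrow> \<forall>i<s. c i = c' i \<Longrightarrow> c = c'"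
  shows "(\<Prod>(s, c)\<in>L. lin_form s c) ^ k dvd d"
  using assms
proof (induction L rule: finite_induct)
  case (insert x L)
  obtain s c where x: "x = (s, c)" by force
  have "(\<Prod>(s, c)\<in>L. lin_form s c) ^ k dvd d" using insert by blast
  then obtain h where d: "d = (\<Prod>(s, c)\<in>L. lin_form s c) ^ k * h" by (elim dvdE)
  have nd: "\<not> lin_form s c dvd (\<Prod>(s, c)\<in>L. lin_form s c) ^ k"
  proof
    assume "lin_form s c dvd (\<Prod>(s, c)\<in>L. lin_form s c) ^ k"
    then have "lin_form s c dvd (\<Prod>(s, c)\<in>L. lin_form s c)" by (rule lin_form_dvd_power)
    from lin_form_dvd_prod[OF this insert(1)] obtain t e where te: "(t, e) \<in> L" "lin_form s c dvd lin_form t e" by auto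
    then have "t = s" "\<forall>i<s. c i = e i" using lin_form_dvd_lin_form by blast+
    then have "e = c" using insert.prems(2)[of s c e] te x by auto
    then show False using te x \<open>t = s\<close> insert(2) by simp
  qed
  have "lin_form s c ^ k dvd h"
    by (rule lin_form_power_dvd_mult[OF _ nd]) (use insert.prems(1)[of s c] x d in simp)
  then show ?case using insert(1,2) x d by (simp add: power_mult_distrib mult.commute mult_dvd_mono)
qed simp

section \<open>Moore determinants over a finite field\<close>

lemma moore_mat_carrier [simp]: "moore_mat q m z \<in> carrier_mat m m"
  by (simp add: moore_mat_def)

lemma moore_mat_dim [simp]: "dim_row (moore_mat q m z) = m" "dim_col (moore_mat q m z) = m"
  by (simp_all add: moore_mat_def)

lemma moore_mat_nth [simp]: "e < m \<Longrightarrow> c < m \<Longrightarrow> moore_mat q m z $$ (e, c) = z c ^ (q ^ e)"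
  by (simp add: moore_mat_def)

lemma Lpoly_cong: "(\<And>i. i < m \<Longrightarrow> z i = w i) \<Longrightarrow> Lpoly q m z = Lpoly q m w"
  unfolding Lpoly_def by (rule arg_cong[of _ _ det]) (auto intro!: eq_matI)

lemma Lpoly_0 [simp]: "Lpoly q 0 z = 1"
  unfolding Lpoly_def by (rule det_dim_zero) simp

text \<open>The cofactors along the last column do not depend on \<open>z m\<close>, so the
  determinant of size \<open>m + 1\<close> is a polynomial in \<open>z m\<close> with exponents
  \<open>q ^ e\<close> only.\<close>

definition moore_cofactor :: "nat \<Rightarrow> nat \<Rightarrow> (nat \<Rightarrow> 'a::comm_ring_1 mpoly) \<Rightarrow> nat \<Rightarrow> 'a mpoly" where
  "moore_cofactor q m z e = cofactor (moore_mat q (Suc m) z) e m"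

lemma moore_cofactor_upd: "e \<le> m \<Longrightarrow> moore_cofactor q m (z(m := w)) e = moore_cofactor q m z e"
  unfolding moore_cofactor_def cofactor_def mat_delete_def
  by (intro arg_cong2[where f = "(*)"] refl arg_cong[of _ _ det] eq_matI) auto

lemma moore_cofactor_last: "moore_cofactor q m z m = Lpoly q m z"
proof -
  have "mat_delete (moore_mat q (Suc m) z) m m = moore_mat q m z"
    unfolding mat_delete_def by (rule eq_matI) auto
  then show ?thesis by (simp add: moore_cofactor_def cofactor_def Lpoly_def mult_2[symmetric])
qed

lemma Lpoly_column: "Lpoly q (Suc m) (z(m := w)) = (\<Sum>e\<le>m. w ^ (q ^ e) * moore_cofactor q m z e)"
proof -
  have "Lpoly q (Suc m) (z(m := w)) =
      (\<Sum>e<Suc m. moore_mat q (Suc m) (z(m := w)) $$ (e, m) * cofactor (moore_mat q (Suc m) (z(m := w))) e m)"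
    unfolding Lpoly_def by (rule laplace_expansion_column) auto
  also have "\<dots> = (\<Sum>e<Suc m. w ^ (q ^ e) * moore_cofactor q m (z(m := w)) e)"
    by (rule sum.cong) (auto simp: moore_cofactor_def)
  finally show ?thesis by (simp add: lessThan_Suc_atMost moore_cofactor_upd)
qed

lemma Lpoly_repeat:
  assumes "t < m"
  shows "Lpoly q (Suc m) (z(m := z t)) = 0"
  unfolding Lpoly_def
  by (rule det_identical_columns[of _ "Suc m" t m]) (use assms in \<open>auto intro!: eq_vecI\<close>)

lemma sym_alg_Lpoly: "m \<le> n \<Longrightarrow> Lpoly q m X \<in> sym_alg n"
  unfolding Lpoly_def by (rule sym_alg_det[of _ m]) (auto intro!: sym_alg_power sym_alg_X)

lemma psum_Suc: "i < length I \<Longrightarrow> psum I (Suc i) = psum I i + I ! i"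
  by (simp add: psum_def take_Suc_conv_app_nth)

text \<open>The monic polynomial whose roots are the combinations of the \<open>z t\<close> over the
  finite field. For \<open>z = X\<close> its coefficients at the powers \<open>q ^ e\<close> are, up
  to sign, the Dickson invariants.\<close>

definition moore_poly :: "nat \<Rightarrow> (nat \<Rightarrow> 'a mpoly) \<Rightarrow> 'a::{finite,field} mpoly poly" where
  "moore_poly m z = (\<Prod>c \<in> {..<m} \<rightarrow>\<^sub>E UNIV. [:\<Sum>t<m. const (c t) * z t, 1:])"

section \<open>Arithmetic over the finite field and factorization of Moore determinants\<close>

locale finite_coeff =
  fixes q p r :: nat and ty :: "'a::{finite,field} itself"
  assumes prime: "prime p" and q: "q = p ^ r" and card: "CARD('a) = q"
begin

lemma q_ge_2: "q \<ge> 2"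
proof -
  have "card {0, 1 :: 'a} \<le> CARD('a)" by (rule card_mono) auto
  then show ?thesis using card by simp
qed

text \<open>Summing all field elements before and after translation by 1 shows that \<open>q\<close>
  is zero in the field.\<close>

lemma CHAR_field: "CHAR('a) = p"
proof -
  have "(\<Sum>x\<in>UNIV. x + 1) = (\<Sum>x\<in>UNIV. x :: 'a)"
    by (rule sum.reindex_bij_witness[of _ "\<lambda>x. x - 1" "\<lambda>x. x + 1"]) auto
  then have "of_nat q = (0 :: 'a)" by (simp add: sum.distrib card)
  then have "CHAR('a) dvd p ^ r" unfolding of_nat_eq_0_iff_char_dvd q .
  moreover have "prime CHAR('a)"
    by (rule prime_CHAR_semidom) (simp add: finite_imp_CHAR_pos)
  ultimately show ?thesis using prime prime_dvd_power primes_dvd_imp_eq by blast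
qed

lemma CHAR_mpoly: "CHAR('a mpoly) = p"
proof (rule CHAR_eqI)
  show "of_nat p = (0 :: 'a mpoly)"
    using CHAR_field by (auto simp: of_nat_mpoly of_nat_eq_0_iff_char_dvd)
  fix k assume "of_nat k = (0 :: 'a mpoly)"
  then show "p dvd k" using CHAR_field by (auto simp: of_nat_mpoly of_nat_eq_0_iff_char_dvd)
qed

lemma frob_sum: "(\<Sum>i\<in>A. f i) ^ (q ^ e) = (\<Sum>i\<in>A. f i ^ (q ^ e) :: 'a mpoly)"
  by (rule freshmans_dream_sum'[where n = "r * e"]) (use prime in \<open>simp_all add: CHAR_mpoly q power_mult\<close>)

lemma unit_power: "a \<noteq> 0 \<Longrightarrow> (a :: 'a) ^ (q - 1) = 1"
proof -
  assume a: "a \<noteq> 0"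
  have "(\<Prod>x\<in>UNIV - {0}. a * x) = (\<Prod>x\<in>UNIV - {0 :: 'a}. x)"
    by (rule prod.reindex_bij_witness[of _ "\<lambda>y. y / a" "\<lambda>y. a * y"]) (use a in auto)
  then have "a ^ card (UNIV - {0 :: 'a}) * (\<Prod>x\<in>UNIV - {0 :: 'a}. x) = 1 * (\<Prod>x\<in>UNIV - {0 :: 'a}. x)"
    by (simp add: prod.distrib)
  moreover have "(\<Prod>x\<in>UNIV - {0 :: 'a}. x) \<noteq> 0" by simp
  ultimately have "a ^ card (UNIV - {0 :: 'a}) = 1" by (metis mult_cancel_right)
  then show ?thesis by (simp add: card_Diff_subset card)
qed

lemma power_q: "(a :: 'a) ^ q = a"
proof (cases "a = 0")
  case False
  have "a ^ q = a * a ^ (q - 1)" using q_ge_2 by (cases q) auto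
  then show ?thesis using unit_power[OF False] by simp
qed (use q_ge_2 in auto)

lemma power_q_e: "(a :: 'a) ^ (q ^ e) = a"
  by (induction e) (auto simp: power_mult power_q mult.commute)

lemma const_frob: "const (a :: 'a) ^ (q ^ e) = const a"
  by (simp add: const_power[symmetric] power_q_e)

lemma lin_frob: "(\<Sum>t\<in>A. const (c t :: 'a) * w t) ^ (q ^ e) = (\<Sum>t\<in>A. const (c t) * w t ^ (q ^ e))"
  by (simp add: frob_sum power_mult_distrib const_frob)

text \<open>If the remainder \<open>R\<close> of \<open>N\<close> modulo \<open>q - 1\<close> were
  positive, \<open>monom 1 R - 1\<close> would be a nonzero polynomial of degree
  \<open>R < q - 1\<close> with all \<open>q - 1\<close> units as roots.\<close>

lemma dvd_of_power_eq_1: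
  assumes "\<And>a :: 'a. a \<noteq> 0 \<Longrightarrow> a ^ N = 1"
  shows "(q - 1) dvd N"
proof (rule ccontr)
  assume "\<not> (q - 1) dvd N"
  then have R: "N mod (q - 1) > 0" by (simp add: dvd_eq_mod_eq_0)
  have lt: "N mod (q - 1) < q - 1" using q_ge_2 by (intro mod_less_divisor) simp
  define R where "R = N mod (q - 1)"
  have "a ^ R = 1" if "a \<noteq> 0" for a :: 'a
  proof -
    have "1 = a ^ ((q - 1) * (N div (q - 1)) + R)" using assms[OF that] by (simp add: R_def)
    then show ?thesis unfolding power_add power_mult unit_power[OF that] by simp
  qed
  then have sub: "UNIV - {0 :: 'a} \<subseteq> {x. poly (monom 1 R - 1) x = 0}" by (auto simp: poly_monom)
  have deg: "degree (monom 1 R - 1 :: 'a poly) \<le> R" by (intro degree_diff_le) (auto simp: degree_monom_le)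
  have "coeff (monom 1 R - 1 :: 'a poly) R = 1" using R by (simp add: R_def)
  then have nz: "monom 1 R - 1 \<noteq> (0 :: 'a poly)" by (metis coeff_0 zero_neq_one)
  have "q - 1 = card (UNIV - {0 :: 'a})" by (simp add: card_Diff_subset card)
  also have "\<dots> \<le> card {x. poly (monom 1 R - 1 :: 'a poly) x = 0}"
    by (rule card_mono[OF _ sub]) (use poly_roots_finite[OF nz] in simp)
  also have "\<dots> \<le> R" using card_poly_roots_bound[OF nz] deg by simp
  finally show False using lt by (simp add: R_def)
qed

lemma card_coeffs: "card ({..<m} \<rightarrow>\<^sub>E (UNIV :: 'a set)) = q ^ m"
  by (simp add: card_PiE card)

lemma Lpoly_linear:
  "Lpoly q (Suc m) (z(m := \<Sum>t\<in>A. const (c t :: 'a) * w t)) = (\<Sum>t\<in>A. const (c t) * Lpoly q (Suc m) (z(m := w t)))"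
proof -
  have "Lpoly q (Suc m) (z(m := \<Sum>t\<in>A. const (c t) * w t)) =
      (\<Sum>e\<le>m. \<Sum>t\<in>A. const (c t) * (w t ^ (q ^ e) * moore_cofactor q m z e))"
    by (simp add: Lpoly_column lin_frob sum_distrib_right mult.assoc)
  also have "\<dots> = (\<Sum>t\<in>A. \<Sum>e\<le>m. const (c t) * (w t ^ (q ^ e) * moore_cofactor q m z e))" by (rule sum.swap)
  finally show ?thesis by (simp add: Lpoly_column sum_distrib_left)
qed

text \<open>Frobenius fixes the coefficients, so a linear relation between the \<open>z t\<close> is
  a relation between the columns of the Moore matrix.\<close>

lemma Lpoly_dependent:
  fixes z :: "nat \<Rightarrow> 'a mpoly"
  assumes "(\<Sum>t<m. const (a t) * z t) = 0" "s < m" "a s \<noteq> 0"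
  shows "Lpoly q m z = 0"
proof -
  define v where "v = vec m (\<lambda>t. const (a t))"
  have "moore_mat q m z *\<^sub>v v = 0\<^sub>v m"
  proof (rule eq_vecI)
    fix e assume "e < dim_vec (0\<^sub>v m :: 'a mpoly vec)"
    then have e: "e < m" by simp
    then have "(moore_mat q m z *\<^sub>v v) $ e = (\<Sum>t<m. const (a t) * z t ^ (q ^ e))"
      by (simp add: v_def scalar_prod_def lessThan_atLeast0 mult.commute)
    also have "\<dots> = (\<Sum>t<m. const (a t) * z t) ^ (q ^ e)" by (simp add: lin_frob)
    also have "\<dots> = 0" using assms(1) q_ge_2 by simp
    finally show "(moore_mat q m z *\<^sub>v v) $ e = 0\<^sub>v m $ e" using e by simp
  qed simp
  moreover have "v \<noteq> 0\<^sub>v m" using assms(2,3) by (auto simp: v_def vec_eq_iff)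
  moreover have "v \<in> carrier_vec m" by (simp add: v_def)
  ultimately show ?thesis unfolding Lpoly_def using det_0_iff_vec_prod_zero[of "moore_mat q m z" m] by auto
qed

lemma moore_poly_degree: "degree (moore_poly m z :: 'a mpoly poly) = q ^ m"
  and moore_poly_monic: "coeff (moore_poly m z :: 'a mpoly poly) (q ^ m) = 1"
proof -
  have lc: "lead_coeff (moore_poly m z :: 'a mpoly poly) = 1"
    unfolding moore_poly_def lead_coeff_prod by simp
  show deg: "degree (moore_poly m z :: 'a mpoly poly) = q ^ m"
    unfolding moore_poly_def by (subst degree_prod_eq_sum_degree) (auto simp: card_coeffs)
  show "coeff (moore_poly m z :: 'a mpoly poly) (q ^ m) = 1" using lc deg by simp
qed

lemma coeff_sum_q_powers:
  assumes "b \<le> m"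
  shows "coeff (\<Sum>e\<le>m. monom (k e) (q ^ e)) (q ^ b) = k b"
proof -
  have "coeff (\<Sum>e\<le>m. monom (k e) (q ^ e)) (q ^ b) = (\<Sum>e\<le>m. if e = b then k e else 0)"
    unfolding coeff_sum by (rule sum.cong) (use q_ge_2 in auto)
  then show ?thesis using assms by simp
qed

text \<open>Both sides have degree at most \<open>q ^ m\<close>, the same coefficient there, and the
  \<open>q ^ m\<close> distinct combinations of the \<open>z t\<close> as roots; the difference
  would have more roots than its degree.\<close>

lemma moore_poly_eq:
  fixes z :: "nat \<Rightarrow> 'a mpoly"
  assumes indep: "\<And>a t. (\<Sum>t<m. const (a t) * z t) = 0 \<Longrightarrow> t < m \<Longrightarrow> a t = 0"
  shows "smult (Lpoly q m z) (moore_poly m z) = (\<Sum>e\<le>m. monom (moore_cofactor q m z e) (q ^ e))"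
proof -
  let ?P = "\<Sum>e\<le>m. monom (moore_cofactor q m z e) (q ^ e)"
  define D where "D = ?P - smult (Lpoly q m z) (moore_poly m z)"
  define \<rho> where "\<rho> c = (\<Sum>t<m. const (- c t) * z t)" for c :: "nat \<Rightarrow> 'a"
  have inj: "inj_on \<rho> ({..<m} \<rightarrow>\<^sub>E UNIV)"
  proof (rule inj_onI)
    fix c d assume cd: "c \<in> {..<m} \<rightarrow>\<^sub>E UNIV" "d \<in> {..<m} \<rightarrow>\<^sub>E (UNIV :: 'a set)" and eq: "\<rho> c = \<rho> d"
    have "(\<Sum>t<m. const (c t - d t) * z t) = \<rho> d - \<rho> c"
      by (simp add: \<rho>_def const_diff const_uminus left_diff_distrib sum_subtractf sum_negf)
    then have "c t - d t = 0" if "t < m" for t using indep[of "\<lambda>t. c t - d t"] eq that by simp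
    then show "c = d" using cd by (intro PiE_ext) auto
  qed
  have poly_P: "poly ?P w = Lpoly q (Suc m) (z(m := w))" for w
    by (simp add: poly_sum poly_monom Lpoly_column mult.commute)
  \<comment> \<open>\<open>?P\<close> at a combination of the \<open>z t\<close> is a Moore
    determinant with dependent columns; the other polynomial contains the corresponding linear
    factor, which is why \<open>\<rho>\<close> carries a minus sign.\<close>
  have root: "poly D (\<rho> c) = 0" if "c \<in> {..<m} \<rightarrow>\<^sub>E UNIV" for c
  proof -
    have "poly ?P (\<rho> c) = 0"
      unfolding poly_P \<rho>_def Lpoly_linear by (intro sum.neutral) (simp add: Lpoly_repeat)
    moreover have "poly (moore_poly m z) (\<rho> c) = 0"
      unfolding moore_poly_def poly_prod
    proof (rule prod_zero)
      show "\<exists>a\<in>{..<m} \<rightarrow>\<^sub>E UNIV. poly [:\<Sum>t<m. const (a t) * z t, 1:] (\<rho> c) = 0"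
        by (rule bexI[OF _ that]) (simp add: \<rho>_def const_uminus sum_negf)
    qed (simp add: finite_PiE)
    ultimately show ?thesis by (simp add: D_def)
  qed
  have "D = 0"
  proof (rule ccontr)
    assume nz: "D \<noteq> 0"
    have "degree ?P \<le> q ^ m"
      by (rule degree_sum_le) (use q_ge_2 in \<open>auto intro!: degree_monom_le[THEN order_trans] power_increasing\<close>)
    then have le: "degree D \<le> q ^ m" unfolding D_def
      by (intro degree_diff_le) (auto intro!: degree_smult_le[THEN order_trans] simp: moore_poly_degree)
    have "coeff D (q ^ m) = 0"
      by (simp add: D_def coeff_sum_q_powers moore_cofactor_last moore_poly_monic)
    then have "degree D \<noteq> q ^ m" using nz leading_coeff_0_iff by metis
    then have lt: "degree D < q ^ m" using le by simp
    have "q ^ m = card (\<rho> ` ({..<m} \<rightarrow>\<^sub>E UNIV))" using card_image[OF inj] card_coeffs by simp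
    also have "\<dots> \<le> card {x. poly D x = 0}"
      by (rule card_mono) (use root poly_roots_finite[OF nz] in auto)
    also have "\<dots> \<le> degree D" by (rule card_poly_roots_bound[OF nz])
    finally show False using lt by simp
  qed
  then show ?thesis by (simp add: D_def)
qed

text \<open>\<open>moore_poly_eq\<close> evaluated at \<open>z m\<close>; for dependent
  \<open>z\<close> both sides are zero.\<close>

lemma Lpoly_Suc:
  fixes z :: "nat \<Rightarrow> 'a mpoly"
  shows "Lpoly q (Suc m) z = Lpoly q m z * (\<Prod>c \<in> {..<m} \<rightarrow>\<^sub>E UNIV. (\<Sum>t<m. const (c t) * z t) + z m)"
proof (cases "\<exists>a t. (\<Sum>t<m. const (a t :: 'a) * z t) = 0 \<and> t < m \<and> a t \<noteq> 0")
  case True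
  then obtain a t where a: "(\<Sum>t<m. const (a t) * z t) = 0" "t < m" "a t \<noteq> (0 :: 'a)" by blast
  have "(\<Sum>t<Suc m. const ((a(m := 0)) t) * z t) = 0" using a(1) by simp
  then have "Lpoly q (Suc m) z = 0" by (rule Lpoly_dependent[of _ _ _ t]) (use a in auto)
  then show ?thesis using Lpoly_dependent[OF a] by simp
next
  case False
  then have "smult (Lpoly q m z) (moore_poly m z) = (\<Sum>e\<le>m. monom (moore_cofactor q m z e) (q ^ e))"
    by (intro moore_poly_eq) blast
  then have "poly (smult (Lpoly q m z) (moore_poly m z)) (z m) = poly (\<Sum>e\<le>m. monom (moore_cofactor q m z e) (q ^ e)) (z m)"
    by simp
  also have "\<dots> = Lpoly q (Suc m) (z(m := z m))"
    by (simp add: poly_sum poly_monom Lpoly_column mult.commute del: fun_upd_triv)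
  finally show ?thesis by (simp add: moore_poly_def poly_prod)
qed

lemma Lpoly_X: "Lpoly q m X = (\<Prod>s<m. \<Prod>c \<in> {..<s} \<rightarrow>\<^sub>E UNIV. lin_form s (c :: nat \<Rightarrow> 'a))"
  by (induction m) (simp_all add: Lpoly_Suc lin_form_def)

lemma Lpoly_X_nonzero: "Lpoly q m X \<noteq> (0 :: 'a mpoly)"
  by (auto simp: Lpoly_X lin_form_nonzero finite_PiE)

lemma Lpoly_power_dvd:
  fixes d :: "'a mpoly"
  assumes "\<And>s c. s < m \<Longrightarrow> lin_form s c ^ k dvd d"
  shows "Lpoly q m X ^ k dvd d"
proof -
  have "(\<Prod>(s, c)\<in>(SIGMA s:{..<m}. {..<s} \<rightarrow>\<^sub>E UNIV). lin_form s c) ^ k dvd d"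
  proof (rule prod_lin_form_power_dvd)
    fix s c c' assume "(s, c) \<in> (SIGMA s:{..<m}. {..<s} \<rightarrow>\<^sub>E (UNIV :: 'a set))"
      "(s, c') \<in> (SIGMA s:{..<m}. {..<s} \<rightarrow>\<^sub>E (UNIV :: 'a set))" "\<forall>i<s. c i = c' i"
    then show "c = c'" by (intro PiE_ext[of c "{..<s}" "\<lambda>_. UNIV"]) auto
  qed (use assms in \<open>auto simp: finite_PiE\<close>)
  then show ?thesis by (simp add: Lpoly_X prod.Sigma finite_PiE)
qed

text \<open>\<open>vpoly\<close> with its last variable replaced by an arbitrary \<open>w\<close>.
  The product hides that it is linear in \<open>w\<close> over the finite field; this comes from
  \<open>Lpoly_vprod\<close>, which writes it as a quotient of Moore determinants.\<close>

definition vprod :: "nat \<Rightarrow> 'a mpoly \<Rightarrow> 'a mpoly" where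
  "vprod m w = (\<Prod>c \<in> {..<m} \<rightarrow>\<^sub>E UNIV. (\<Sum>t<m. const (c t) * X t) + w)"

lemma Lpoly_vprod: "Lpoly q (Suc m) (X(m := w)) = Lpoly q m X * vprod m w"
proof -
  have "Lpoly q m (X(m := w)) = Lpoly q m X" by (rule Lpoly_cong) simp
  moreover have "(\<Sum>t<m. const (c t) * (X(m := w)) t) = (\<Sum>t<m. const (c t) * X t)" for c :: "nat \<Rightarrow> 'a"
    by (rule sum.cong) auto
  ultimately show ?thesis by (simp add: Lpoly_Suc vprod_def)
qed

lemma vprod_linear: "vprod m (\<Sum>t\<in>A. const (c t) * w t) = (\<Sum>t\<in>A. const (c t) * vprod m (w t))"
proof -
  have "Lpoly q m X * vprod m (\<Sum>t\<in>A. const (c t) * w t) = Lpoly q m X * (\<Sum>t\<in>A. const (c t) * vprod m (w t))"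
    by (simp add: Lpoly_vprod[symmetric] Lpoly_linear sum_distrib_left)
      (simp add: Lpoly_vprod mult.left_commute)
  then show ?thesis using Lpoly_X_nonzero[of m] mult_cancel_left by blast
qed

text \<open>A coefficient vector of length \<open>m + j\<close> is a pair of vectors of lengths
  \<open>m\<close> and \<open>j\<close>; the product over the former is
  \<open>vprod m\<close>.\<close>

lemma prod_lin_form_split:
  "(\<Prod>c \<in> {..<m + j} \<rightarrow>\<^sub>E UNIV. lin_form (m + j) (c :: nat \<Rightarrow> 'a)) =
   (\<Prod>d \<in> {..<j} \<rightarrow>\<^sub>E UNIV. vprod m ((\<Sum>t<j. const (d t) * X (m + t)) + X (m + j)))"
proof -
  define f where "f c d = (\<lambda>t \<in> {..<m + j}. if t < m then c t else d (t - m))" for c d :: "nat \<Rightarrow> 'a"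
  have sum_split: "(\<Sum>t<m + j. g t) = (\<Sum>t<m. g t) + (\<Sum>t<j. g (m + t))" for g :: "nat \<Rightarrow> 'a mpoly"
    by (induction j) (auto simp: add.assoc)
  have "(\<Prod>d \<in> {..<j} \<rightarrow>\<^sub>E UNIV. vprod m ((\<Sum>t<j. const (d t) * X (m + t)) + X (m + j))) =
      (\<Prod>(d, c) \<in> ({..<j} \<rightarrow>\<^sub>E UNIV) \<times> ({..<m} \<rightarrow>\<^sub>E UNIV). lin_form (m + j) (f c d))"
    unfolding vprod_def prod.cartesian_product
  proof (rule prod.cong[OF refl], clarify)
    fix d c :: "nat \<Rightarrow> 'a"
    show "(\<Sum>t<m. const (c t) * X t) + ((\<Sum>t<j. const (d t) * X (m + t)) + X (m + j)) = lin_form (m + j) (f c d)"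
      unfolding lin_form_def sum_split by (simp add: f_def add.assoc)
  qed
  also have "\<dots> = (\<Prod>c \<in> {..<m + j} \<rightarrow>\<^sub>E UNIV. lin_form (m + j) c)"
    by (rule prod.reindex_bij_witness[of _ "\<lambda>c. (\<lambda>t\<in>{..<j}. c (m + t), \<lambda>t\<in>{..<m}. c t)" "\<lambda>(d, c). f c d"])
      (auto simp: f_def fun_eq_iff PiE_def extensional_def)
  finally show ?thesis by simp
qed

text \<open>For \<open>j = I ! i\<close> this makes \<open>theta q I i\<close> the quotient of
  consecutive Moore determinants. By linearity of \<open>vprod\<close>, enlarging \<open>j\<close>
  by 1 adds the same factor on both sides.\<close>

lemma Lpoly_add:
  assumes "i < length I" "m = psum I i"
  shows "Lpoly q (m + j) X = Lpoly q m X * Lpoly q j (vpoly I i :: nat \<Rightarrow> 'a mpoly)"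
proof (induction j)
  case (Suc j)
  have v: "vpoly I i t = vprod m (X (m + t))" for t by (simp add: vpoly_def vprod_def assms)
  have lin: "(\<Sum>t<j. const (d t) * vpoly I i t) + vpoly I i j =
      vprod m ((\<Sum>t<j. const (d t) * X (m + t)) + X (m + j))" for d :: "nat \<Rightarrow> 'a"
    using vprod_linear[of m "\<lambda>t. if t < j then d t else 1" "\<lambda>t. X (m + t)" "{..<Suc j}"] by (simp add: v)
  have "Lpoly q (m + Suc j) X = Lpoly q (m + j) X * (\<Prod>c \<in> {..<m + j} \<rightarrow>\<^sub>E UNIV. lin_form (m + j) (c :: nat \<Rightarrow> 'a))"
    by (simp add: Lpoly_Suc lin_form_def)
  also have "\<dots> = Lpoly q m X * (Lpoly q j (vpoly I i) *
      (\<Prod>d \<in> {..<j} \<rightarrow>\<^sub>E UNIV. (\<Sum>t<j. const (d t) * vpoly I i t) + vpoly I i j))"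
    unfolding lin Suc prod_lin_form_split by (simp add: mult.assoc)
  finally show ?case by (simp only: Lpoly_Suc)
qed simp

lemma prod_theta: "i \<le> length I \<Longrightarrow> (\<Prod>t<i. theta q I t) = (Lpoly q (psum I i) X :: 'a mpoly)"
proof (induction i)
  case (Suc i)
  then show ?case using Lpoly_add[of i I "psum I i" "I ! i"] by (simp add: psum_Suc theta_def)
qed (simp add: psum_def)

section \<open>Dickson relations between Frobenius powers\<close>

definition frob_span :: "nat \<Rightarrow> (nat \<Rightarrow> 'a mpoly) \<Rightarrow> bool" where
  "frob_span m u \<longleftrightarrow> (\<exists>t. \<forall>a<m. u a = (\<Sum>b<m. t b * X a ^ (q ^ b)))"

lemma frob_span_sum:
  assumes "\<And>i. i \<in> S \<Longrightarrow> frob_span m (u i)"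
  shows "frob_span m (\<lambda>a. \<Sum>i\<in>S. c i * u i a)"
proof -
  obtain t where t: "\<And>i a. i \<in> S \<Longrightarrow> a < m \<Longrightarrow> u i a = (\<Sum>b<m. t i b * X a ^ (q ^ b))"
    using assms unfolding frob_span_def by metis
  have "(\<Sum>i\<in>S. c i * u i a) = (\<Sum>b<m. (\<Sum>i\<in>S. c i * t i b) * X a ^ (q ^ b))" if "a < m" for a
  proof -
    have "(\<Sum>i\<in>S. c i * u i a) = (\<Sum>i\<in>S. \<Sum>b<m. c i * t i b * X a ^ (q ^ b))"
      using t that by (simp add: sum_distrib_left mult.assoc)
    also have "\<dots> = (\<Sum>b<m. \<Sum>i\<in>S. c i * t i b * X a ^ (q ^ b))" by (rule sum.swap)
    finally show ?thesis by (simp add: sum_distrib_right)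
  qed
  then show ?thesis unfolding frob_span_def by (intro exI[of _ "\<lambda>b. \<Sum>i\<in>S. c i * t i b"]) simp
qed

text \<open>The case \<open>k = m\<close> matters: \<open>moore_poly m X\<close> vanishes at each
  \<open>X a\<close> and is monic, so it can be solved for the top power with the same coefficients
  for all \<open>a\<close>.\<close>

lemma frob_span_base: "k \<le> m \<Longrightarrow> frob_span m (\<lambda>a. X a ^ (q ^ k))"
proof (cases "k < m")
  case True
  then show ?thesis unfolding frob_span_def
    by (intro exI[of _ "\<lambda>b. if b = k then 1 else 0"]) (simp add: if_distrib[of "\<lambda>x. x * _"] cong: if_cong)
next
  case False
  assume "k \<le> m"
  then have k: "k = m" using False by simp
  let ?V = "moore_poly m (X :: nat \<Rightarrow> 'a mpoly)"
  have eq: "smult (Lpoly q m X) ?V = (\<Sum>e\<le>m. monom (moore_cofactor q m X e) (q ^ e))"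
    by (rule moore_poly_eq) (rule lin_form_eq_0)
  have c: "Lpoly q m X * coeff ?V (q ^ e) = moore_cofactor q m X e" if "e \<le> m" for e
    using arg_cong[OF eq, of "\<lambda>P. coeff P (q ^ e)"] that by (simp add: coeff_sum_q_powers)
  have *: "X a ^ (q ^ m) = (\<Sum>b<m. - coeff ?V (q ^ b) * X a ^ (q ^ b))" if a: "a < m" for a
  proof -
    have "Lpoly q m X * (\<Sum>e\<le>m. coeff ?V (q ^ e) * X a ^ (q ^ e)) = (\<Sum>e\<le>m. X a ^ (q ^ e) * moore_cofactor q m X e)"
      unfolding sum_distrib_left by (rule sum.cong) (auto simp: c[symmetric])
    also have "\<dots> = 0" using Lpoly_repeat[OF a, of q X] by (simp add: Lpoly_column)
    finally have "(\<Sum>e\<le>m. coeff ?V (q ^ e) * X a ^ (q ^ e)) = 0" using Lpoly_X_nonzero by simp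
    then have "(\<Sum>e<m. coeff ?V (q ^ e) * X a ^ (q ^ e)) + X a ^ (q ^ m) = 0"
      by (simp add: lessThan_Suc_atMost[symmetric] moore_poly_monic)
    then show ?thesis by (simp add: sum_negf eq_neg_iff_add_eq_0 add.commute)
  qed
  show ?thesis unfolding frob_span_def k
    by (intro exI[of _ "\<lambda>b. - coeff ?V (q ^ b)"] allI impI) (rule *)
qed

text \<open>The Dickson relation, which is monic, expresses higher Frobenius powers by lower ones with
  polynomial coefficients.\<close>

lemma frob_span_power: "frob_span m (\<lambda>a. X a ^ (q ^ k))"
proof (induction k)
  case (Suc k)
  then obtain t :: "nat \<Rightarrow> 'a mpoly" where t: "\<forall>a<m. X a ^ (q ^ k) = (\<Sum>b<m. t b * X a ^ (q ^ b))"
    unfolding frob_span_def by blast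
  have "X a ^ (q ^ Suc k) = (\<Sum>b<m. t b ^ q * X a ^ (q ^ Suc b))" if "a < m" for a
  proof -
    have "X a ^ (q ^ Suc k) = (X a ^ (q ^ k)) ^ q" by (simp add: power_mult[symmetric] mult.commute)
    also have "\<dots> = (\<Sum>b<m. (t b * X a ^ (q ^ b)) ^ q)" using t that frob_sum[of _ _ 1] by simp
    also have "\<dots> = (\<Sum>b<m. t b ^ q * X a ^ (q ^ Suc b))"
      by (simp add: power_mult_distrib power_mult[symmetric] mult.commute)
    finally show ?thesis .
  qed
  moreover have "frob_span m (\<lambda>a. \<Sum>b<m. t b ^ q * X a ^ (q ^ Suc b))"
    by (rule frob_span_sum) (rule frob_span_base, simp)
  ultimately show ?case unfolding frob_span_def by simp
next
  case 0
  show ?case by (rule frob_span_base) simp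
qed

end

section \<open>The action in coordinates\<close>

lemma lookup_ext_smult [simp]: "lookup (ext_smult a f) C = a * lookup f C"
  by (simp add: ext_smult_def Poly_Mapping.map.rep_eq when_def)

lemma lookup_ext_one: "lookup ext_one = ext_unit"
  by (auto simp: ext_one_def ext_unit_def lookup_single when_def fun_eq_iff)

lemma lookup_act_y:
  "lookup (act_y g a) A = (\<Sum>k<dim_row g. if A = {k} then const (g $$ (k, a)) else 0)"
  unfolding act_y_def lookup_sum by (rule sum.cong) (auto simp: lookup_single when_def)

lemma inversions_singleton: "k \<in> C \<Longrightarrow> inversions {k} (C - {k}) = card {b \<in> C. b < k}"
proof -
  have "{(a, b) \<in> {k} \<times> (C - {k}). b < a} = Pair k ` {b \<in> C. b < k}" by auto
  then show ?thesis by (simp add: inversions_def card_image inj_on_def)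
qed

definition act_col :: "'a::comm_ring_1 mat \<Rightarrow> nat \<Rightarrow> nat \<Rightarrow> 'a mpoly" where
  "act_col g a k = const (g $$ (k, a))"

lemma lookup_ext_mult_act_y:
  "lookup (ext_mult (act_y g a) h) C = wedge (dim_row g) (act_col g a) (lookup h) C"
proof -
  let ?K = "(\<lambda>k. {k}) ` {..<dim_row g}"
  have y: "lookup (act_y g a) {k} = const (g $$ (k, a))" if "k < dim_row g" for k
    using that by (simp add: lookup_act_y)
  have keys: "keys (act_y g a) \<subseteq> ?K"
  proof
    fix A assume "A \<in> keys (act_y g a)"
    then have "(\<Sum>k<dim_row g. if A = {k} then const (g $$ (k, a)) else 0) \<noteq> 0"
      by (simp add: in_keys_iff lookup_act_y)
    then obtain k where "k \<in> {..<dim_row g}" "(if A = {k} then const (g $$ (k, a)) else 0) \<noteq> 0"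
      by (rule sum.not_neutral_contains_not_neutral)
    then show "A \<in> ?K" by (auto split: if_splits)
  qed
  let ?t = "\<lambda>A B. if A \<inter> B = {} then Poly_Mapping.single (A \<union> B)
     ((-1) ^ inversions A B * lookup (act_y g a) A * lookup h B) else 0"
  have "ext_mult (act_y g a) h = (\<Sum>A\<in>?K. \<Sum>B\<in>keys h. ?t A B)"
    unfolding ext_mult_def
    by (rule sum.mono_neutral_left) (use keys in \<open>auto simp: in_keys_iff intro!: sum.neutral\<close>)
  also have "\<dots> = (\<Sum>k<dim_row g. \<Sum>B\<in>keys h. ?t {k} B)"
    by (subst sum.reindex) (auto simp: inj_on_def)
  finally have "lookup (ext_mult (act_y g a) h) C =
      (\<Sum>k<dim_row g. \<Sum>B\<in>keys h. lookup (?t {k} B) C)"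
    by (simp add: lookup_sum)
  also have "\<dots> = wedge (dim_row g) (act_col g a) (lookup h) C"
    unfolding wedge_def
  proof (rule sum.cong[OF refl])
    fix k assume "k \<in> {..<dim_row g}"
    then have k: "k < dim_row g" by simp
    have "(\<Sum>B\<in>keys h. lookup (?t {k} B) C) =
        (\<Sum>B\<in>keys h. if k \<in> C \<and> B = C - {k} then
           (-1) ^ card {b \<in> C. b < k} * const (g $$ (k, a)) * lookup h B else 0)"
    proof (rule sum.cong[OF refl])
      fix B
      have "k \<notin> B \<and> insert k B = C \<longleftrightarrow> k \<in> C \<and> B = C - {k}" by auto
      then show "lookup (?t {k} B) C = (if k \<in> C \<and> B = C - {k} then
           (-1) ^ card {b \<in> C. b < k} * const (g $$ (k, a)) * lookup h B else 0)"
        by (auto simp: lookup_single when_def inversions_singleton y[OF k])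
    qed
    also have "\<dots> = act_col g a k * y_wedge k (lookup h) C"
      by (cases "k \<in> C") (auto simp: y_wedge_def act_col_def in_keys_iff sum.delta)
    finally show "(\<Sum>B\<in>keys h. lookup (?t {k} B) C) =
        act_col g a k * y_wedge k (lookup h) C" .
  qed
  finally show ?thesis .
qed

text \<open>Transfers the action to coefficient functions: act on the polynomial coefficients, then
  substitute the columns of \<open>g\<close> for the generators.\<close>

lemma lookup_sym_ext_act:
  assumes "f \<in> sym_ext_alg n" "dim_row g = n"
  shows "lookup (sym_ext_act g f) = ext_map n n (act_col g) ext_unit (\<lambda>A. sym_act g (lookup f A))"
proof
  fix C
  have wedges: "lookup (foldr (\<lambda>a. ext_mult (act_y g a)) xs ext_one)
      = foldr (\<lambda>a. wedge n (act_col g a)) xs ext_unit" for xs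
  proof (induction xs)
    case (Cons a xs)
    have "lookup (ext_mult (act_y g a) h) = wedge n (act_col g a) (lookup h)" for h
      by (rule HOL.ext) (simp add: lookup_ext_mult_act_y assms(2))
    then show ?case using Cons by simp
  qed (simp add: lookup_ext_one)
  have "lookup (sym_ext_act g f) C =
      (\<Sum>A\<in>keys f. sym_act g (lookup f A) * wedges n (act_col g) A ext_unit C)"
    by (simp add: sym_ext_act_def lookup_sum wedges wedges_def)
  also have "\<dots> = ext_map n n (act_col g) ext_unit (\<lambda>A. sym_act g (lookup f A)) C"
    unfolding ext_map_def
    by (rule sum.mono_neutral_left) (use assms(1) in \<open>auto simp: sym_ext_alg_def in_keys_iff sym_act_def\<close>)
  finally show "lookup (sym_ext_act g f) C =
      ext_map n n (act_col g) ext_unit (\<lambda>A. sym_act g (lookup f A)) C" .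
qed

lemma lookup_Mui: "lookup (Mui q m B) = mui_coeff m (moore_mat q m X) B"
proof
  fix C
  have "lookup (Mui q m B) C = (\<Sum>A | A \<subseteq> {..<m} \<and> card A = card B. if A = C then mui_coeff m (moore_mat q m X) B C else 0)"
    unfolding Mui_def lookup_sum by (rule sum.cong) (auto simp: lookup_single when_def mui_coeff_def)
  also have "\<dots> = mui_coeff m (moore_mat q m X) B C"
    by (simp add: sum.delta) (simp add: mui_coeff_def)
  finally show "lookup (Mui q m B) C = mui_coeff m (moore_mat q m X) B C" .
qed

text \<open>Makes 1 the member \<open>B = {}\<close> of the family, with \<open>m = 0\<close> and an
  empty determinant.\<close>

lemma Mui_0: "Mui q 0 {} = (ext_one :: 'a::comm_ring_1 sym_ext)"
proof (rule poly_mapping_eqI)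
  fix C :: "nat set"
  have S: "submatrix (moore_mat q 0 (X :: nat \<Rightarrow> 'a mpoly)) {} {} \<in> carrier_mat 0 0" by (simp add: submatrix_def)
  then show "lookup (Mui q 0 {} :: 'a sym_ext) C = lookup ext_one C"
    by (auto simp: lookup_Mui lookup_ext_one mui_coeff_def ext_unit_def det_dim_zero[OF S])
qed

lemma Mui_in_sym_ext_alg:
  assumes "m \<le> n" "B \<subseteq> {..<m}"
  shows "(Mui q m B :: 'a::comm_ring_1 sym_ext) \<in> sym_ext_alg n"
proof -
  have "mui_coeff m (moore_mat q m X) B A \<in> (sym_alg n :: 'a mpoly set)" for A
  proof (cases "A \<subseteq> {..<m} \<and> card A = card B")
    case True
    have fin: "finite A" "finite B" using True assms finite_subset by blast+
    let ?S = "submatrix (moore_mat q m (X :: nat \<Rightarrow> 'a mpoly)) ({..<m} - B) ({..<m} - A)"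
    have c: "card ({..<m} - A) = card ({..<m} - B)"
      using True assms fin by (simp add: card_Diff_subset)
    have S: "?S \<in> carrier_mat (card ({..<m} - B)) (card ({..<m} - B))"
      using dim_submatrix_subset[OF moore_mat_carrier, of "{..<m} - B" m "{..<m} - A" q X] c by auto
    have "det ?S \<in> sym_alg n"
    proof (rule sym_alg_det[OF S])
      fix i j assume ij: "i < card ({..<m} - B)" "j < card ({..<m} - B)"
      have p: "pick ({..<m} - B) i < m" "pick ({..<m} - A) j < m"
        using pick_in_set_le[OF ij(1)] pick_in_set_le[of j "{..<m} - A"] ij c by auto
      have "?S $$ (i, j) = moore_mat q m X $$ (pick ({..<m} - B) i, pick ({..<m} - A) j)"
        by (rule submatrix_nth[OF moore_mat_carrier]) (use ij c in auto)
      also have "\<dots> = X (pick ({..<m} - A) j) ^ q ^ pick ({..<m} - B) i" using p by simp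
      also have "\<dots> \<in> sym_alg n" using p assms by (intro sym_alg_power sym_alg_X) simp
      finally show "?S $$ (i, j) \<in> sym_alg n" .
    qed
    moreover have "(-1 :: 'a mpoly) ^ k \<in> sym_alg n" for k
      by (intro sym_alg_power sym_alg_uminus) simp
    ultimately show ?thesis unfolding mui_coeff_def by (auto simp del: One_nat_def intro!: sym_alg_mult)
  qed (auto simp: mui_coeff_def)
  moreover have "A \<subseteq> {..<n}" if "mui_coeff m (moore_mat q m X) B A \<noteq> (0 :: 'a mpoly)" for A
    using that assms by (auto simp: mui_coeff_def split: if_splits)
  ultimately show ?thesis by (simp add: sym_ext_alg_def in_keys_iff lookup_Mui)
qed

lemma wedges_hom: "finite A \<Longrightarrow> poly_subst s (wedges n T A ext_unit C) = wedges n (\<lambda>a k. poly_subst s (T a k)) A ext_unit C"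
proof (induction A arbitrary: C rule: finite_min_induct)
  case empty
  then show ?case by (simp add: ext_unit_def)
next
  case (insert a A)
  have "poly_subst s (y_wedge k (wedges n T A ext_unit) C) = y_wedge k (wedges n (\<lambda>a k. poly_subst s (T a k)) A ext_unit) C" for k
    using insert.IH by (simp add: y_wedge_def poly_subst_mult poly_subst_power poly_subst_uminus)
  then show ?case using insert by (simp add: wedges_insert_min wedge_def poly_subst_sum poly_subst_mult)
qed

lemma ext_map_hom: "poly_subst s (ext_map n m T ext_unit F C) = ext_map n m (\<lambda>a k. poly_subst s (T a k)) ext_unit (\<lambda>A. poly_subst s (F A)) C"
  unfolding ext_map_def poly_subst_sum poly_subst_mult
  by (intro sum.cong refl) (use finite_subset[of _ "{..<n}"] in \<open>auto simp: wedges_hom\<close>)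

lemma wedges_truncate:
  assumes "finite A" "\<And>a k. a \<in> A \<Longrightarrow> m \<le> k \<Longrightarrow> k < n \<Longrightarrow> T a k = 0" "m \<le> n"
  shows "wedges n T A G = wedges m T A G"
  using assms(1,2)
proof (induction A rule: finite_min_induct)
  case (insert a A)
  have "wedge n (T a) H = wedge m (T a) H" for H
  proof
    fix C
    show "wedge n (T a) H C = wedge m (T a) H C"
      unfolding wedge_def by (rule sum.mono_neutral_right) (use insert.prems assms(3) in auto)
  qed
  moreover have "wedges n T A G = wedges m T A G" by (rule insert.IH) (use insert.prems in auto)
  ultimately show ?case using insert(1,2) by (simp add: wedges_insert_min)
qed simp

lemma psum_mono: "i \<le> j \<Longrightarrow> psum I i \<le> psum I j"
proof -
  assume "i \<le> j"
  then have "take j I = take i I @ take (j - i) (drop i I)" by (metis le_add_diff_inverse take_add)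
  then show ?thesis by (simp add: psum_def)
qed

section \<open>The parabolic group and the substitution \<open>Phi\<close>\<close>

locale parabolic_setup = finite_coeff q p r ty for q p r :: nat and ty :: "'a::{finite,field} itself" +
  fixes n :: nat and I :: "nat list"
  assumes comp: "is_composition I n"
begin

abbreviation P :: "'a mat set" where "P \<equiv> parabolic I"

lemma psum_length: "psum I (length I) = n"
  using comp by (simp add: psum_def is_composition_def)

lemma psum_le: "i \<le> length I \<Longrightarrow> psum I i \<le> n"
  using psum_mono[of i "length I" I] by (simp add: psum_length)

lemma P_dim: "g \<in> P \<Longrightarrow> g \<in> carrier_mat n n"
  using comp by (auto simp: parabolic_def GL_def is_composition_def)

text \<open>The boundary \<open>i = length I\<close>, where the claim is vacuous, is included so
  that \<open>m = n\<close> is an instance of every later lemma about block boundaries.\<close>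

lemma P_entry: "g \<in> P \<Longrightarrow> i \<le> length I \<Longrightarrow> c < psum I i \<Longrightarrow> psum I i \<le> k \<Longrightarrow> k < n \<Longrightarrow> g $$ (k, c) = 0"
proof -
  assume a: "g \<in> P" "i \<le> length I" "c < psum I i" "psum I i \<le> k" "k < n"
  then have "i \<noteq> length I" using psum_length by auto
  then have "i < length I" using a by simp
  then show ?thesis using a comp by (auto simp: parabolic_def is_composition_def)
qed

lemma P_inverse: "g \<in> P \<Longrightarrow> \<exists>h \<in> carrier_mat n n. h * g = 1\<^sub>m n"
proof -
  assume g: "g \<in> P"
  then obtain h where h: "g * h = 1\<^sub>m n" "h * g = 1\<^sub>m (dim_row h)"
    using P_dim[OF g] by (auto simp: parabolic_def GL_def invertible_mat_def inverts_mat_def)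
  then have "dim_col (g * h) = n" "dim_col (h * g) = dim_row h" by auto
  then have "h \<in> carrier_mat n n" using P_dim[OF g] by auto
  then show ?thesis using h by auto
qed

lemma act_x_eq: "g \<in> P \<Longrightarrow> act_x g j = (\<Sum>k<n. const (g $$ (k, j)) * X k)"
  using P_dim by (auto simp: act_x_def)

text \<open>Substituting with a left inverse matrix \<open>h\<close> of \<open>g\<close> recovers
  \<open>f\<close>.\<close>

lemma sym_act_inj:
  assumes g: "g \<in> P" and f: "f \<in> sym_alg n" and 0: "sym_act g f = 0"
  shows "f = 0"
proof -
  obtain h where h: "h \<in> carrier_mat n n" "h * g = 1\<^sub>m n" using P_inverse[OF g] by blast
  have "poly_subst (act_x h) (act_x g j) = X j" if j: "j < n" for j
  proof -
    have "poly_subst (act_x h) (act_x g j) = (\<Sum>k<n. const (g $$ (k, j)) * (\<Sum>l<n. const (h $$ (l, k)) * X l))"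
      using h by (simp add: act_x_eq[OF g] poly_subst_sum poly_subst_mult) (simp add: act_x_def)
    also have "\<dots> = (\<Sum>k<n. \<Sum>l<n. const (h $$ (l, k) * g $$ (k, j)) * X l)"
      by (simp add: sum_distrib_left const_mult ac_simps)
    also have "\<dots> = (\<Sum>l<n. \<Sum>k<n. const (h $$ (l, k) * g $$ (k, j)) * X l)" by (rule sum.swap)
    also have "\<dots> = (\<Sum>l<n. const ((h * g) $$ (l, j)) * X l)"
    proof (rule sum.cong[OF refl])
      fix l assume "l \<in> {..<n}"
      then have "(h * g) $$ (l, j) = (\<Sum>k<n. h $$ (l, k) * g $$ (k, j))"
        using h(1) P_dim[OF g] j by (simp add: scalar_prod_def lessThan_atLeast0)
      moreover have "const (\<Sum>k\<in>A. u k) = (\<Sum>k\<in>A. const (u k :: 'a))" for A :: "nat set" and u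
        by (induction A rule: infinite_finite_induct) (auto simp: const_add)
      ultimately show "(\<Sum>k<n. const (h $$ (l, k) * g $$ (k, j)) * X l) = const ((h * g) $$ (l, j)) * X l"
        by (simp add: sum_distrib_right)
    qed
    also have "\<dots> = (\<Sum>l<n. if l = j then X l else 0)"
      unfolding h(2) using j by (intro sum.cong) auto
    finally show ?thesis using j by simp
  qed
  then have "poly_subst (act_x h) (sym_act g f) = poly_subst X f"
    unfolding sym_act_def poly_subst_comp by (intro poly_subst_cong[OF f])
  then show ?thesis using 0 by simp
qed

definition xi :: "nat \<Rightarrow> nat \<Rightarrow> 'a mpoly" where
  "xi a b = X a ^ (q ^ b)"

definition Phi :: "nat \<Rightarrow> (nat set \<Rightarrow> 'a mpoly) \<Rightarrow> nat set \<Rightarrow> 'a mpoly" where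
  "Phi m F = ext_map m m xi ext_unit F"

lemma Phi_moore: "Phi m F = ext_map m m (\<lambda>a b. moore_mat q m X $$ (b, a)) ext_unit F"
  unfolding Phi_def by (rule ext_map_cong) (auto simp: xi_def)

lemma Phi_inj:
  assumes "\<And>C. C \<subseteq> {..<m} \<Longrightarrow> Phi m F C = 0" "C \<subseteq> {..<m}"
  shows "F C = 0"
proof (rule ext_map_inj[of "moore_mat q m X" m F])
  show "det (moore_mat q m X) \<noteq> (0 :: 'a mpoly)" using Lpoly_X_nonzero by (simp add: Lpoly_def)
qed (use assms in \<open>auto simp: Phi_moore\<close>)

lemma Phi_add: "Phi m (\<lambda>A. F A + G A) C = Phi m F C + Phi m G C"
  by (simp add: Phi_def ext_map_add)

lemma Phi_cmult: "Phi m (\<lambda>A. c * F A) C = c * Phi m F C"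
  by (simp add: Phi_def ext_map_cmult)

lemma Phi_sum: "Phi m (\<lambda>A. \<Sum>i\<in>S. F i A) C = (\<Sum>i\<in>S. Phi m (F i) C)"
  by (simp add: Phi_def ext_map_sum)

lemma Phi_diff: "Phi m (\<lambda>A. F A - G A) C = Phi m F C - Phi m G C"
  using Phi_add[of m F "\<lambda>A. - 1 * G A" C] Phi_cmult[of m "- 1" G C] by simp

lemma Phi_mui: "B \<subseteq> {..<m} \<Longrightarrow> C \<subseteq> {..<m} \<Longrightarrow>
  Phi m (mui_coeff m (moore_mat q m X) B) C = (if C = B then mui_sign B * Lpoly q m X else 0)"
  unfolding Phi_moore Lpoly_def by (rule ext_map_mui_coeff) simp_all

lemma sym_act_xi:
  assumes "g \<in> P" "i \<le> length I" "m = psum I i" "a < m"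
  shows "sym_act g (xi a b) = (\<Sum>k<m. const (g $$ (k, a)) * xi k b)"
proof -
  have "(\<Sum>k<n. const (g $$ (k, a)) * X k) = (\<Sum>k<m. const (g $$ (k, a)) * X k :: 'a mpoly)"
    by (rule sum.mono_neutral_right) (use assms psum_le P_entry[OF assms(1,2)] in auto)
  then show ?thesis
    by (simp add: sym_act_def xi_def poly_subst_power act_x_eq[OF assms(1)] lin_frob)
qed

text \<open>For fixed \<open>b\<close> the powers \<open>xi a b\<close> transform under
  \<open>g\<close> exactly as the \<open>y_a\<close>, because Frobenius fixes the entries of
  \<open>g\<close>. So \<open>g\<close> passes through the substitution and leaves the new
  generators alone.\<close>

lemma Phi_equivariant:
  assumes "g \<in> P" "i \<le> length I" "m = psum I i"
  shows "Phi m (ext_map m m (act_col g) ext_unit (\<lambda>A. sym_act g (F A))) C = sym_act g (Phi m F C)"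
proof -
  have "Phi m (ext_map m m (act_col g) ext_unit (\<lambda>A. sym_act g (F A))) C =
      ext_map m m (\<lambda>a k. \<Sum>b<m. act_col g a b * xi b k) ext_unit (\<lambda>A. sym_act g (F A)) C"
    unfolding Phi_def by (rule ext_map_comp)
  also have "\<dots> = ext_map m m (\<lambda>a k. sym_act g (xi a k)) ext_unit (\<lambda>A. sym_act g (F A)) C"
    by (rule fun_cong[of _ _ C], rule ext_map_cong) (auto simp: sym_act_xi[OF assms] act_col_def)
  also have "\<dots> = sym_act g (Phi m F C)"
    unfolding Phi_def sym_act_def by (rule ext_map_hom[symmetric])
  finally show ?thesis .
qed

text \<open>Block triangularity preserves the span of the first \<open>m\<close> generators, so for
  elements supported there the action can be computed with \<open>m\<close> in place of
  \<open>n\<close>.\<close>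

lemma act_coeff:
  assumes g: "g \<in> P" and i: "i \<le> length I" "m = psum I i" and f: "f \<in> sym_ext_alg n"
    and supp: "\<And>A. \<not> A \<subseteq> {..<m} \<Longrightarrow> lookup f A = 0"
  shows "lookup (sym_ext_act g f) C =
    ext_map m m (act_col g) ext_unit (\<lambda>A. sym_act g (lookup f A)) C"
proof -
  let ?F = "\<lambda>A. sym_act g (lookup f A)"
  have mn: "m \<le> n" using psum_le i by simp
  have "lookup (sym_ext_act g f) C = ext_map n n (act_col g) ext_unit ?F C"
    using lookup_sym_ext_act[OF f, of g] P_dim[OF g] by auto
  also have "\<dots> = ext_map m n (act_col g) ext_unit ?F C"
    by (rule ext_map_mono_supp[OF mn]) (simp add: supp sym_act_def)
  also have "\<dots> = ext_map m m (act_col g) ext_unit ?F C"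
    unfolding ext_map_def
  proof (rule sum.cong[OF refl])
    fix A assume "A \<in> Pow {..<m}"
    then have A: "A \<subseteq> {..<m}" "finite A" using finite_subset by auto
    have "wedges n (act_col g) A ext_unit = wedges m (act_col g) A (ext_unit :: nat set \<Rightarrow> 'a mpoly)"
      by (rule wedges_truncate[OF A(2) _ mn]) (use A P_entry[OF g i(1)] i in \<open>auto simp: act_col_def\<close>)
    then show "?F A * wedges n (act_col g) A ext_unit C = ?F A * wedges m (act_col g) A ext_unit C" by simp
  qed
  finally show ?thesis .
qed

text \<open>For a block boundary \<open>m\<close>, the character by which \<open>g\<close>
  multiplies the Moore determinant of the first \<open>m\<close> variables.\<close>

definition block_det :: "nat \<Rightarrow> 'a mat \<Rightarrow> 'a" where
  "block_det m g = det (mat m m (\<lambda>(i, j). g $$ (i, j)))"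

lemma det_const: "M \<in> carrier_mat m m \<Longrightarrow> det (map_mat const M) = const (det (M :: 'a mat))"
proof -
  interpret comm_ring_hom "const :: 'a \<Rightarrow> 'a mpoly"
    by unfold_locales (auto simp: const_add const_mult)
  show ?thesis by (rule hom_det)
qed

lemma sym_act_Lpoly:
  assumes "g \<in> P" "i \<le> length I" "m = psum I i"
  shows "sym_act g (Lpoly q m X) = const (block_det m g) * Lpoly q m X"
proof -
  let ?g = "mat m m (\<lambda>(i, j). g $$ (i, j))"
  have "sym_act g (Lpoly q m X) = det (map_mat (sym_act g) (moore_mat q m X))"
    by (simp add: Lpoly_def sym_act_def poly_subst_det)
  also have "map_mat (sym_act g) (moore_mat q m X) = moore_mat q m X * map_mat const ?g"
  proof (rule eq_matI)
    fix e c assume "e < dim_row (moore_mat q m X * map_mat const ?g)" "c < dim_col (moore_mat q m X * map_mat const ?g)"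
    then have ec: "e < m" "c < m" by auto
    then show "map_mat (sym_act g) (moore_mat q m X) $$ (e, c) = (moore_mat q m X * map_mat const ?g) $$ (e, c)"
      using sym_act_xi[OF assms ec(2), of e]
      by (simp add: scalar_prod_def xi_def lessThan_atLeast0 mult.commute)
  qed auto
  also have "det \<dots> = Lpoly q m X * const (block_det m g)"
    by (subst det_mult[of _ m]) (auto simp: Lpoly_def block_det_def det_const[of _ m])
  finally show ?thesis by (simp add: mult.commute)
qed

lemma block_det_n: "g \<in> P \<Longrightarrow> block_det n g = det g"
proof -
  assume "g \<in> P"
  then have "mat n n (\<lambda>(i, j). g $$ (i, j)) = g" using P_dim[of g] by (intro eq_matI) auto
  then show ?thesis by (simp add: block_det_def)
qed

lemma block_det_nonzero: "g \<in> P \<Longrightarrow> i \<le> length I \<Longrightarrow> m = psum I i \<Longrightarrow> block_det m g \<noteq> 0"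
proof
  assume a: "g \<in> P" "i \<le> length I" "m = psum I i" and "block_det m g = 0"
  then have "sym_act g (Lpoly q m X) = 0" using sym_act_Lpoly by simp
  then have "Lpoly q m X = (0 :: 'a mpoly)"
    using sym_act_inj[OF a(1) sym_alg_Lpoly] psum_le a by simp
  then show False using Lpoly_X_nonzero by simp
qed

text \<open>\<open>Phi m\<close> leaves of \<open>Mui q m B\<close> only a signed Moore determinant
  at the index \<open>B\<close>, so both sides have the same image under the injective
  \<open>Phi m\<close>.\<close>

lemma Mui_semi_invariant:
  assumes "g \<in> P" "i \<le> length I" "m = psum I i" "B \<subseteq> {..<m}"
  shows "lookup (sym_ext_act g (Mui q m B)) C = const (block_det m g) * lookup (Mui q m B) C"
proof -
  let ?M = "mui_coeff m (moore_mat q m X) B"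
  define D where "D C = lookup (sym_ext_act g (Mui q m B)) C - const (block_det m g) * ?M C" for C
  have mn: "m \<le> n" using psum_le assms by simp
  have act: "lookup (sym_ext_act g (Mui q m B)) C = ext_map m m (act_col g) ext_unit (\<lambda>A. sym_act g (?M A)) C" for C
    using act_coeff[OF assms(1-3) Mui_in_sym_ext_alg[OF mn assms(4)]] by (simp add: lookup_Mui mui_coeff_def)
  have D: "D = (\<lambda>C. ext_map m m (act_col g) ext_unit (\<lambda>A. sym_act g (?M A)) C - const (block_det m g) * ?M C)"
    by (rule HOL.ext) (simp add: D_def act)
  have "Phi m D C = 0" if "C \<subseteq> {..<m}" for C
    unfolding D Phi_diff Phi_cmult Phi_equivariant[OF assms(1-3)] Phi_mui[OF assms(4) that]
    by (auto simp: sym_act_def poly_subst_mult poly_subst_power poly_subst_uminus mui_sign_def)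
      (simp add: sym_act_Lpoly[OF assms(1-3), unfolded sym_act_def])
  then have "D C = 0" if "C \<subseteq> {..<m}" for C using Phi_inj that by blast
  moreover have "D C = 0" if "\<not> C \<subseteq> {..<m}" for C
    using that by (simp add: D mui_coeff_def ext_map_out[OF that])
  ultimately have "D C = 0" by blast
  then show ?thesis by (simp add: D_def lookup_Mui)
qed

text \<open>As \<open>Phi n\<close> is injective and equivariant, invariance can be tested on its
  polynomial coefficients one at a time.\<close>

lemma semi_invariant_iff:
  assumes f: "f \<in> sym_ext_alg n" and g: "g \<in> P"
  shows "twisted_act k g f = f \<longleftrightarrow>
    (\<forall>C\<subseteq>{..<n}. const (det g ^ k) * sym_act g (Phi n (lookup f) C) = Phi n (lookup f) C)"
proof -
  let ?F = "lookup f"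
  have supp: "?F A = 0" if "\<not> A \<subseteq> {..<n}" for A
    using f that by (auto simp: sym_ext_alg_def in_keys_iff)
  define E where "E = ext_map n n (act_col g) ext_unit (\<lambda>A. sym_act g (?F A))"
  define D where "D C = const (det g ^ k) * E C - ?F C" for C
  have act: "lookup (twisted_act k g f) C = const (det g ^ k) * E C" for C
    unfolding twisted_act_def E_def
    using act_coeff[OF g le_refl psum_length[symmetric] f supp] by simp
  have D0: "D C = 0" if "\<not> C \<subseteq> {..<n}" for C using supp[OF that] by (simp add: D_def E_def ext_map_out[OF that])
  have PD: "Phi n D C = const (det g ^ k) * sym_act g (Phi n ?F C) - Phi n ?F C" for C
    unfolding D_def[abs_def] Phi_diff Phi_cmult E_def Phi_equivariant[OF g le_refl psum_length[symmetric]] ..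
  have "twisted_act k g f = f \<longleftrightarrow> (\<forall>C. D C = 0)"
    by (metis (no_types, lifting) D_def act eq_iff_diff_eq_0 poly_mapping_eqI)
  also have "\<dots> \<longleftrightarrow> (\<forall>C\<subseteq>{..<n}. Phi n D C = 0)"
  proof
    assume "\<forall>C. D C = 0"
    then show "\<forall>C\<subseteq>{..<n}. Phi n D C = 0" by (simp add: Phi_def ext_map_def)
  next
    assume "\<forall>C\<subseteq>{..<n}. Phi n D C = 0"
    then show "\<forall>C. D C = 0" using Phi_inj[of n D] D0 by blast
  qed
  finally show ?thesis by (simp add: PD)
qed

section \<open>Comparison of \<open>Phi m\<close> with \<open>Phi n\<close> for a block boundary
  \<open>m\<close>\<close>

definition frob_coeff :: "nat \<Rightarrow> nat \<Rightarrow> nat \<Rightarrow> 'a mpoly" where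
  "frob_coeff m k = (SOME t. \<forall>a<m. X a ^ (q ^ k) = (\<Sum>b<m. t b * X a ^ (q ^ b)))"

lemma frob_coeff: "a < m \<Longrightarrow> (\<Sum>b<m. frob_coeff m k b * xi a b) = xi a k"
  using someI_ex[OF frob_span_power[of m k, unfolded frob_span_def]]
  unfolding frob_coeff_def[symmetric] xi_def by metis

text \<open>For \<open>m = n\<^sub>1 + \<dots> + n\<^sub>i\<close> the substitution \<open>Phi n\<close>, restricted to \<open>y\<^sub>0, \<dots>, y\<^sub>m\<^sub>-\<^sub>1\<close>, factors
  through \<open>Phi m\<close>, followed by \<open>z\<^sub>b \<mapsto> \<Sum>\<^sub>k zeta_vec m b k z\<^sub>k\<close>.\<close>

definition zeta_vec :: "nat \<Rightarrow> nat \<Rightarrow> nat \<Rightarrow> 'a mpoly" where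
  "zeta_vec m b k = (if k < m then unitv b k else frob_coeff m k b)"

definition zeta_wedge :: "nat \<Rightarrow> nat set \<Rightarrow> nat set \<Rightarrow> 'a mpoly" where
  "zeta_wedge m B = wedges n (zeta_vec m) B ext_unit"

lemma xi_zeta_vec: "a < m \<Longrightarrow> (\<Sum>b<m. xi a b * zeta_vec m b k) = xi a k"
proof (cases "k < m")
  case True
  then have "(\<Sum>b<m. xi a b * zeta_vec m b k) = (\<Sum>b<m. if b = k then xi a b else 0)"
    by (intro sum.cong) (auto simp: zeta_vec_def unitv_def)
  then show ?thesis using True by simp
next
  case False
  assume "a < m"
  then show ?thesis using frob_coeff[of a m k] False by (simp add: zeta_vec_def mult.commute)
qed

lemma Phi_zeta_wedge:
  assumes "m \<le> n" "\<forall>A. \<not> A \<subseteq> {..<m} \<longrightarrow> F A = 0"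
  shows "Phi n F C = (\<Sum>A\<in>Pow {..<m}. Phi m F A * zeta_wedge m A C)"
proof -
  have "Phi n F C = ext_map m n xi ext_unit F C" unfolding Phi_def by (rule ext_map_mono_supp) (use assms in auto)
  also have "\<dots> = ext_map m n (\<lambda>a k. \<Sum>b<m. xi a b * zeta_vec m b k) ext_unit F C"
    by (rule fun_cong[of _ _ C], rule ext_map_cong) (auto simp: xi_zeta_vec)
  also have "\<dots> = ext_map m n (zeta_vec m) ext_unit (ext_map m m xi ext_unit F) C" by (rule ext_map_comp[symmetric])
  also have "\<dots> = (\<Sum>A\<in>Pow {..<m}. Phi m F A * zeta_wedge m A C)" by (simp add: ext_map_def[of m n] Phi_def zeta_wedge_def)
  finally show ?thesis .
qed

text \<open>The first \<open>m\<close> coordinates of \<open>zeta_vec m b\<close> are those of a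
  unit vector; this is the source of unitriangularity.\<close>

lemma zeta_wedge_delta:
  assumes "m \<le> n" "B \<subseteq> {..<m}" "C \<subseteq> {..<m}"
  shows "zeta_wedge m B C = (if C = B then 1 else 0)"
proof -
  have fin: "finite B" "finite C" using assms finite_subset by blast+
  have "zeta_wedge m B C = wedges m (zeta_vec m) B ext_unit C" unfolding zeta_wedge_def by (rule wedges_restrict[OF fin(1) assms(3,1)])
  also have "\<dots> = wedges m unitv B ext_unit C" by (rule fun_cong[of _ _ C], rule wedges_cong[OF _ fin(1)]) (simp add: zeta_vec_def)
  finally show ?thesis by (simp add: wedges_unitv[OF assms(2) fin(2)])
qed

lemma Phi_n_Mui:
  assumes "m \<le> n" "B \<subseteq> {..<m}"
  shows "Phi n (lookup (Mui q m B)) C = mui_sign B * Lpoly q m X * zeta_wedge m B C"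
proof -
  have "Phi n (lookup (Mui q m B)) C = (\<Sum>A\<in>Pow {..<m}. Phi m (mui_coeff m (moore_mat q m X) B) A * zeta_wedge m A C)"
    unfolding lookup_Mui by (rule Phi_zeta_wedge[OF assms(1)]) (auto simp: mui_coeff_def)
  also have "\<dots> = (\<Sum>A\<in>Pow {..<m}. if A = B then mui_sign B * Lpoly q m X * zeta_wedge m B C else 0)"
    by (rule sum.cong) (auto simp: Phi_mui[OF assms(2)])
  finally show ?thesis using assms by simp
qed

text \<open>On \<open>F\<close> in the first \<open>m\<close> generators, the coefficients of
  \<open>Phi n F\<close> at subsets of \<open>{..<m}\<close> are those of \<open>Phi m F\<close>,
  and these determine all the others.\<close>

lemma Phi_vanish:
  assumes "m \<le> n" "\<forall>A. \<not> A \<subseteq> {..<m} \<longrightarrow> F A = 0" "\<And>C. C \<subseteq> {..<m} \<Longrightarrow> Phi n F C = 0"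
  shows "Phi n F C = 0"
proof -
  have "Phi m F A = 0" if A: "A \<subseteq> {..<m}" for A
  proof -
    have "Phi n F A = (\<Sum>B\<in>Pow {..<m}. if A = B then Phi m F B else 0)"
      unfolding Phi_zeta_wedge[OF assms(1,2)] by (rule sum.cong) (auto simp: zeta_wedge_delta assms(1) A)
    then show ?thesis using assms(3)[OF A] A by simp
  qed
  then show ?thesis unfolding Phi_zeta_wedge[OF assms(1,2)] by (auto intro!: sum.neutral)
qed

lemma mui_sign_sq [simp]: "mui_sign B * mui_sign B = (1 :: 'a mpoly)"
  by (simp add: mui_sign_def power_mult_distrib[symmetric])

lemma sym_alg_Phi:
  assumes "\<And>A. F A \<in> sym_alg n"
  shows "Phi n F C \<in> sym_alg n"
proof -
  have cutoff_apply: "cutoff n a = (X a :: 'a mpoly)" if "a < n" for a using that by (simp add: cutoff_def)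
  have "poly_subst (cutoff n) (Phi n F C) = ext_map n n (\<lambda>a k. poly_subst (cutoff n) (xi a k)) ext_unit (\<lambda>A. poly_subst (cutoff n) (F A)) C"
    unfolding Phi_def by (rule ext_map_hom)
  also have "\<dots> = Phi n F C" unfolding Phi_def
    by (rule fun_cong[of _ _ C], rule ext_map_cong)
      (use assms in \<open>auto simp: sym_alg_iff xi_def poly_subst_power cutoff_apply\<close>)
  finally show ?thesis by (simp add: sym_alg_iff)
qed

lemma lookup_sym_alg: "(f :: 'a sym_ext) \<in> sym_ext_alg n \<Longrightarrow> lookup f A \<in> sym_alg n"
  by (cases "A \<in> keys f") (auto simp: sym_ext_alg_def in_keys_iff)

lemma zeta_wedge_sym_alg:
  assumes "m \<le> n" "B \<subseteq> {..<m}"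
  shows "zeta_wedge m B C \<in> sym_alg n"
proof (rule sym_alg_cancel)
  have "mui_sign B * Phi n (lookup (Mui q m B)) C \<in> sym_alg n"
    using sym_alg_Phi[OF lookup_sym_alg[OF Mui_in_sym_ext_alg[OF assms]]]
    by (auto simp: mui_sign_def intro!: sym_alg_mult sym_alg_power sym_alg_uminus)
  then show "Lpoly q m X * zeta_wedge m B C \<in> sym_alg n"
    by (simp add: Phi_n_Mui[OF assms] mult.assoc[symmetric])
qed (use assms sym_alg_Lpoly Lpoly_X_nonzero in auto)

text \<open>Up to sign this is a coefficient of \<open>Phi n\<close> at a Mui element divided by
  \<open>Lpoly q m X\<close>, and numerator and denominator have the same character
  \<open>block_det m\<close>.\<close>

lemma zeta_wedge_invariant:
  assumes "g \<in> P" "i \<le> length I" "m = psum I i" "B \<subseteq> {..<m}"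
  shows "sym_act g (zeta_wedge m B C) = zeta_wedge m B C"
proof -
  let ?M = "lookup (Mui q m B)"
  have mn: "m \<le> n" using psum_le assms by simp
  have f: "Mui q m B \<in> sym_ext_alg n" by (rule Mui_in_sym_ext_alg[OF mn assms(4)])
  have E: "ext_map n n (act_col g) ext_unit (\<lambda>A. sym_act g (?M A)) = (\<lambda>C. const (block_det m g) * ?M C)"
    using lookup_sym_ext_act[OF f, of g] P_dim[OF assms(1)] Mui_semi_invariant[OF assms] by auto
  have "sym_act g (Phi n ?M C) = const (block_det m g) * Phi n ?M C"
    using Phi_equivariant[OF assms(1) le_refl psum_length[symmetric], of ?M C] unfolding E Phi_cmult by simp
  then have "mui_sign B * (const (block_det m g) * Lpoly q m X) * sym_act g (zeta_wedge m B C) =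
      const (block_det m g) * (mui_sign B * Lpoly q m X * zeta_wedge m B C)"
    unfolding Phi_n_Mui[OF mn assms(4)] sym_act_Lpoly[OF assms(1-3), symmetric]
    by (simp add: sym_act_def poly_subst_mult poly_subst_power poly_subst_uminus mui_sign_def)
  then have "(mui_sign B * const (block_det m g) * Lpoly q m X) * sym_act g (zeta_wedge m B C) =
      (mui_sign B * const (block_det m g) * Lpoly q m X) * zeta_wedge m B C" by (simp add: ac_simps)
  moreover have "mui_sign B * const (block_det m g) * Lpoly q m X \<noteq> 0"
    using block_det_nonzero[OF assms(1-3)] Lpoly_X_nonzero by (simp add: mui_sign_def)
  ultimately show ?thesis using mult_cancel_left by blast
qed

end

section \<open>Unitriangular systems\<close>

text \<open>Forward substitution, one level at a time. \<open>Q\<close> records what the solution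
  inherits from the right-hand side: semi-invariance in \<open>expansion\<close>, divisibility by a
  power of a variable in \<open>X_power_dvd_invariant\<close>.\<close>

lemma unitri_solve:
  fixes z :: "'i \<Rightarrow> 'i \<Rightarrow> 'r::comm_ring_1" and lev :: "'i \<Rightarrow> nat"
  assumes fin: "finite J" and diag: "\<And>B. B \<in> J \<Longrightarrow> z B B = 1"
    and off: "\<And>B C. B \<in> J \<Longrightarrow> C \<in> J \<Longrightarrow> C \<noteq> B \<Longrightarrow> \<not> lev B < lev C \<Longrightarrow> z B C = 0"
    and Q: "0 \<in> Q" "\<And>a b. a \<in> Q \<Longrightarrow> b \<in> Q \<Longrightarrow> a - b \<in> Q"
      "\<And>a B C. a \<in> Q \<Longrightarrow> B \<in> J \<Longrightarrow> C \<in> J \<Longrightarrow> a * z B C \<in> Q"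
    and c: "\<And>C. C \<in> J \<Longrightarrow> c C \<in> Q"
  shows "\<exists>d. (\<forall>B. d B \<in> Q) \<and> (\<forall>C\<in>J. c C = (\<Sum>B\<in>J. d B * z B C))"
proof -
  have Qadd: "a + b \<in> Q" if "a \<in> Q" "b \<in> Q" for a b
    using Q(2)[OF that(1) Q(2)[OF Q(1) that(2)]] by simp
  have Qsum: "(\<Sum>i\<in>S. h i) \<in> Q" if "\<And>i. i \<in> S \<Longrightarrow> h i \<in> Q" for S :: "'i set" and h
    using that by (induction S rule: infinite_finite_induct) (auto intro: Q Qadd)
  define N where "N = Suc (Max (insert 0 (lev ` J)))"
  have N: "lev C < N" if "C \<in> J" for C
    unfolding N_def using fin that by (simp add: less_Suc_eq_le)
  \<comment> \<open>\<open>j\<close> counts the levels still to be cleared: \<open>c\<close> already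
    vanishes on all levels below \<open>N - j\<close>.\<close>
  have claim: "\<exists>d. (\<forall>B. d B \<in> Q) \<and> (\<forall>C\<in>J. c C = (\<Sum>B\<in>J. d B * z B C))"
    if "\<And>C. C \<in> J \<Longrightarrow> c C \<in> Q" "\<And>C. C \<in> J \<Longrightarrow> lev C < N - j \<Longrightarrow> c C = 0" for j c
    using that
  proof (induction j arbitrary: c)
    case 0
    then show ?case using N Q(1) by (intro exI[of _ "\<lambda>_. 0"]) simp
  next
    case (Suc j)
    show ?case
    proof (cases "j < N")
      case False
      then show ?thesis using Suc.IH[of c] Suc.prems by simp
    next
      case True
      \<comment> \<open>The lowest level on which \<open>c\<close> may be nonzero. The vectors of
        this level form an identity matrix there and vanish on lower levels, so the values of
        \<open>c\<close> are themselves the correction \<open>e\<close>.\<close>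
      define l where "l = N - Suc j"
      have l: "N - j = Suc l" using True by (simp add: l_def)
      define e where "e B = (if B \<in> J \<and> lev B = l then c B else 0)" for B
      have eQ: "e B \<in> Q" for B using Suc.prems(1) Q(1) by (simp add: e_def)
      define c' where "c' C = c C - (\<Sum>B\<in>J. e B * z B C)" for C
      have "\<exists>d. (\<forall>B. d B \<in> Q) \<and> (\<forall>C\<in>J. c' C = (\<Sum>B\<in>J. d B * z B C))"
      proof (rule Suc.IH)
        fix C assume C: "C \<in> J"
        then show "c' C \<in> Q" unfolding c'_def using Suc.prems(1) eQ by (intro Q Qsum) auto
        assume "lev C < N - j"
        then have lC: "lev C \<le> l" using l by simp
        have "(\<Sum>B\<in>J. e B * z B C) = (\<Sum>B\<in>J. if B = C then e C else 0)"
        proof (rule sum.cong[OF refl])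
          fix B assume B: "B \<in> J"
          show "e B * z B C = (if B = C then e C else 0)"
          proof (cases "B = C \<or> lev B \<noteq> l")
            case True
            then show ?thesis using diag C by (auto simp: e_def)
          next
            case False
            then have "z B C = 0" using off[OF B C] lC by auto
            then show ?thesis using False by simp
          qed
        qed
        also have "\<dots> = c C"
          using C lC fin Suc.prems(2)[OF C] by (cases "lev C = l") (auto simp: e_def l_def)
        finally show "c' C = 0" by (simp add: c'_def)
      qed
      then obtain d where d: "\<And>B. d B \<in> Q" "\<And>C. C \<in> J \<Longrightarrow> c' C = (\<Sum>B\<in>J. d B * z B C)" by blast
      have "c C = (\<Sum>B\<in>J. (d B + e B) * z B C)" if "C \<in> J" for C
        using d(2)[OF that] by (simp add: c'_def distrib_right sum.distrib algebra_simps)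
      then show ?thesis using d(1) eQ Qadd by (intro exI[of _ "\<lambda>B. d B + e B"]) auto
    qed
  qed
  show ?thesis by (rule claim[of c N]) (use c in auto)
qed

lemma unitri_unique:
  fixes z :: "'i \<Rightarrow> 'i \<Rightarrow> 'r::comm_ring_1" and lev :: "'i \<Rightarrow> nat"
  assumes fin: "finite J" and diag: "\<And>B. B \<in> J \<Longrightarrow> z B B = 1"
    and off: "\<And>B C. B \<in> J \<Longrightarrow> C \<in> J \<Longrightarrow> C \<noteq> B \<Longrightarrow> \<not> lev B < lev C \<Longrightarrow> z B C = 0"
    and 0: "\<And>C. C \<in> J \<Longrightarrow> (\<Sum>B\<in>J. d B * z B C) = 0" and B: "B \<in> J"
  shows "d B = 0"
  using B
proof (induction "lev B" arbitrary: B rule: less_induct)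
  case less
  have "(\<Sum>C\<in>J. d C * z C B) = (\<Sum>C\<in>J. if C = B then d B else 0)"
  proof (rule sum.cong[OF refl])
    fix C assume C: "C \<in> J"
    show "d C * z C B = (if C = B then d B else 0)"
    proof (cases "C = B")
      case False
      then show ?thesis using less.hyps[OF _ C] off[OF C less.prems] by (cases "lev C < lev B") auto
    qed (simp add: diag less.prems)
  qed
  then show ?case using 0[OF less.prems] less.prems fin by simp
qed

section \<open>Free modules of invariants\<close>

context parabolic_setup
begin

text \<open>The block, counted from 1, of the largest element of \<open>B\<close>, and 0 for the
  empty set; this encodes the condition \<open>b_j >= m_(i-1)\<close>.\<close>

definition lev :: "nat set \<Rightarrow> nat" where
  "lev B = (LEAST i. B \<subseteq> {..<psum I i})"

definition zeta :: "nat set \<Rightarrow> nat set \<Rightarrow> 'a mpoly" where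
  "zeta B = zeta_wedge (psum I (lev B)) B"

lemma lev_sub: "B \<subseteq> {..<n} \<Longrightarrow> B \<subseteq> {..<psum I (lev B)}"
  unfolding lev_def by (rule LeastI[of _ "length I"]) (simp add: psum_length)

lemma lev_le_length: "B \<subseteq> {..<n} \<Longrightarrow> lev B \<le> length I"
  unfolding lev_def by (rule Least_le) (simp add: psum_length)

lemma lev_le_iff: "B \<subseteq> {..<n} \<Longrightarrow> lev B \<le> t \<longleftrightarrow> B \<subseteq> {..<psum I t}"
proof
  assume "B \<subseteq> {..<n}" "lev B \<le> t"
  then show "B \<subseteq> {..<psum I t}" using lev_sub[of B] psum_mono[of "lev B" t I] by force
qed (simp add: lev_def Least_le)

lemma zeta_diag: "B \<subseteq> {..<n} \<Longrightarrow> zeta B B = 1"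
  unfolding zeta_def using zeta_wedge_delta[OF psum_le[OF lev_le_length] lev_sub lev_sub] by simp

lemma zeta_off: "B \<subseteq> {..<n} \<Longrightarrow> C \<subseteq> {..<n} \<Longrightarrow> C \<noteq> B \<Longrightarrow> \<not> lev B < lev C \<Longrightarrow> zeta B C = 0"
  unfolding zeta_def using zeta_wedge_delta[OF psum_le[OF lev_le_length] lev_sub] lev_le_iff[of C "lev B"] by simp

lemma zeta_sym_alg: "B \<subseteq> {..<n} \<Longrightarrow> zeta B C \<in> sym_alg n"
  unfolding zeta_def by (rule zeta_wedge_sym_alg[OF psum_le[OF lev_le_length] lev_sub])

lemma zeta_invariant: "g \<in> P \<Longrightarrow> B \<subseteq> {..<n} \<Longrightarrow> sym_act g (zeta B C) = zeta B C"
  unfolding zeta_def by (rule zeta_wedge_invariant[OF _ lev_le_length refl lev_sub])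

lemma Phi_Mui: "B \<subseteq> {..<n} \<Longrightarrow>
  Phi n (lookup (Mui q (psum I (lev B)) B)) C = mui_sign B * Lpoly q (psum I (lev B)) X * zeta B C"
  unfolding zeta_def by (rule Phi_n_Mui[OF psum_le[OF lev_le_length] lev_sub])

lemma zeta_unique:
  assumes "\<And>C. C \<subseteq> {..<n} \<Longrightarrow> (\<Sum>B\<in>Pow {..<n}. d B * zeta B C) = 0" "B \<subseteq> {..<n}"
  shows "d B = 0"
  by (rule unitri_unique[where J = "Pow {..<n}" and z = zeta and lev = lev])
    (use assms zeta_diag zeta_off in auto)

lemma zeta_solve:
  assumes "0 \<in> Q" "\<And>a b. a \<in> Q \<Longrightarrow> b \<in> Q \<Longrightarrow> a - b \<in> Q"
    "\<And>a B C. a \<in> Q \<Longrightarrow> B \<subseteq> {..<n} \<Longrightarrow> C \<subseteq> {..<n} \<Longrightarrow> a * zeta B C \<in> Q"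
    "\<And>C. C \<subseteq> {..<n} \<Longrightarrow> c C \<in> Q"
  shows "\<exists>d. (\<forall>B. d B \<in> Q) \<and> (\<forall>C\<subseteq>{..<n}. c C = (\<Sum>B\<in>Pow {..<n}. d B * zeta B C))"
  using unitri_solve[where J = "Pow {..<n}" and z = zeta and lev = lev and Q = Q and c = c] assms zeta_diag zeta_off
  by auto

definition semi_inv :: "nat \<Rightarrow> 'a mpoly set" where
  "semi_inv k = {u \<in> sym_alg n. \<forall>g\<in>P. const (det g ^ k) * sym_act g u = u}"

lemma mui_sign_sym_alg: "(mui_sign B :: 'a mpoly) \<in> sym_alg n"
  unfolding mui_sign_def by (intro sym_alg_power sym_alg_uminus sym_alg_1)

lemma mui_sign_invariant: "sym_act g (mui_sign B) = mui_sign B"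
  by (simp add: sym_act_def mui_sign_def poly_subst_power poly_subst_uminus)

lemma mui_sign_nonzero: "mui_sign B \<noteq> (0 :: 'a mpoly)"
  by (simp add: mui_sign_def)

lemma sym_act_mult: "sym_act g (u * v) = sym_act g u * sym_act g (v :: 'a mpoly)"
  by (simp add: sym_act_def poly_subst_mult)

text \<open>Semi-invariants are closed under differences and under multiplication by the invariants
  \<open>zeta B C\<close>, so the triangular system can be solved inside them.\<close>

lemma expansion:
  assumes f: "f \<in> carrier (inv_module n P k)"
  shows "\<exists>d. (\<forall>B. d B \<in> semi_inv k) \<and>
    (\<forall>C\<subseteq>{..<n}. Phi n (lookup f) C = (\<Sum>B\<in>Pow {..<n}. d B * zeta B C))"
proof (rule zeta_solve)
  show "0 \<in> semi_inv k" by (simp add: semi_inv_def sym_act_def)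
  show "a - b \<in> semi_inv k" if "a \<in> semi_inv k" "b \<in> semi_inv k" for a b
    using that by (auto simp: semi_inv_def sym_act_def poly_subst_diff right_diff_distrib intro: sym_alg_diff)
  show "a * zeta B C \<in> semi_inv k" if "a \<in> semi_inv k" "B \<subseteq> {..<n}" for a B C
    using that by (auto simp: semi_inv_def sym_act_mult zeta_invariant mult.assoc[symmetric] intro: sym_alg_mult zeta_sym_alg)
  show "Phi n (lookup f) C \<in> semi_inv k" if "C \<subseteq> {..<n}" for C
    using f that semi_invariant_iff sym_alg_Phi[OF lookup_sym_alg]
    by (auto simp: inv_module_def semi_inv_def)
qed

section \<open>Invariants as a ring and as a module, and a criterion for freeness\<close>

lemma lookup_twisted_act:
  assumes "f \<in> sym_ext_alg n" "g \<in> P"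
  shows "lookup (twisted_act k g f) C =
    const (det g ^ k) * ext_map n n (act_col g) ext_unit (\<lambda>A. sym_act g (lookup f A)) C"
proof -
  have "dim_row g = n" using P_dim[OF assms(2)] by simp
  then show ?thesis by (simp add: twisted_act_def lookup_sym_ext_act[OF assms(1)])
qed

lemma sym_ext_alg_iff:
  "f \<in> sym_ext_alg n \<longleftrightarrow> (\<forall>A. lookup f A \<in> sym_alg n \<and>
     (\<not> A \<subseteq> {..<n} \<longrightarrow> lookup f A = (0 :: 'a mpoly)))"
  by (auto simp: in_keys_iff lookup_sym_alg) (auto simp: sym_ext_alg_def in_keys_iff)

lemma carrier_inv_module: "f \<in> carrier (inv_module n P k) \<longleftrightarrow>
  f \<in> sym_ext_alg n \<and> (\<forall>g\<in>P. twisted_act k g f = f)"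
  by (simp add: inv_module_def)

lemma carrier_inv_ring: "u \<in> carrier (inv_ring n P) \<longleftrightarrow> u \<in> sym_alg n \<and> (\<forall>g\<in>P. sym_act g u = u)"
  by (simp add: inv_ring_def)

lemma inv_module_0: "0 \<in> carrier (inv_module n P k)"
proof -
  have 0: "(0 :: 'a sym_ext) \<in> sym_ext_alg n" by (simp add: sym_ext_alg_def)
  have "twisted_act k g 0 = 0" if g: "g \<in> P" for g
    by (rule poly_mapping_eqI) (simp add: lookup_twisted_act[OF 0 g] sym_act_def ext_map_def)
  then show ?thesis using 0 carrier_inv_module by blast
qed

lemma inv_module_add:
  assumes "f \<in> carrier (inv_module n P k)" "h \<in> carrier (inv_module n P k)"
  shows "f + h \<in> carrier (inv_module n P k)"
proof -
  have fh: "f \<in> sym_ext_alg n" "h \<in> sym_ext_alg n" using assms carrier_inv_module by blast+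
  then have s: "f + h \<in> sym_ext_alg n"
    by (auto simp: sym_ext_alg_iff lookup_add intro: sym_alg_add)
  have "twisted_act k g (f + h) = f + h" if g: "g \<in> P" for g
  proof (rule poly_mapping_eqI)
    fix C
    have "lookup (twisted_act k g (f + h)) C =
        lookup (twisted_act k g f) C + lookup (twisted_act k g h) C"
      unfolding lookup_twisted_act[OF s g] lookup_twisted_act[OF fh(1) g] lookup_twisted_act[OF fh(2) g]
      by (simp add: lookup_add sym_act_def poly_subst_add ext_map_add distrib_left)
    then show "lookup (twisted_act k g (f + h)) C = lookup (f + h) C"
      using assms g by (simp add: carrier_inv_module lookup_add)
  qed
  then show ?thesis using s carrier_inv_module by blast
qed

lemma inv_module_smult:
  assumes "u \<in> carrier (inv_ring n P)" "f \<in> carrier (inv_module n P k)"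
  shows "ext_smult u f \<in> carrier (inv_module n P k)"
proof -
  have f: "f \<in> sym_ext_alg n" and u: "u \<in> sym_alg n"
    using assms carrier_inv_module carrier_inv_ring by blast+
  then have s: "ext_smult u f \<in> sym_ext_alg n"
    by (auto simp: sym_ext_alg_iff intro: sym_alg_mult)
  have "twisted_act k g (ext_smult u f) = ext_smult u f" if g: "g \<in> P" for g
  proof (rule poly_mapping_eqI)
    fix C
    have "lookup (twisted_act k g (ext_smult u f)) C = u * lookup (twisted_act k g f) C"
      unfolding lookup_twisted_act[OF s g] lookup_twisted_act[OF f g]
      using assms(1) g by (simp add: sym_act_mult carrier_inv_ring ext_map_cmult mult.left_commute)
    then show "lookup (twisted_act k g (ext_smult u f)) C = lookup (ext_smult u f) C"
      using assms(2) g by (simp add: carrier_inv_module)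
  qed
  then show ?thesis using s carrier_inv_module by blast
qed

lemma inv_ring_closed:
  "u \<in> carrier (inv_ring n P) \<Longrightarrow> v \<in> carrier (inv_ring n P) \<Longrightarrow> u * v \<in> carrier (inv_ring n P)"
  "u \<in> carrier (inv_ring n P) \<Longrightarrow> v \<in> carrier (inv_ring n P) \<Longrightarrow> u + v \<in> carrier (inv_ring n P)"
  "u \<in> carrier (inv_ring n P) \<Longrightarrow> - u \<in> carrier (inv_ring n P)"
  "1 \<in> carrier (inv_ring n P)" "0 \<in> carrier (inv_ring n P)"
  by (simp_all add: carrier_inv_ring sym_alg_add sym_alg_mult sym_alg_uminus sym_act_def
      poly_subst_add poly_subst_mult poly_subst_uminus)

lemma inv_ring_simps:
  "mult (inv_ring n P) = (*)" "one (inv_ring n P) = 1" "zero (inv_ring n P) = 0" "add (inv_ring n P) = (+)"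
  and inv_module_simps:
  "zero (inv_module n P k) = 0" "add (inv_module n P k) = (+)" "module.smult (inv_module n P k) = ext_smult"
  by (simp_all add: inv_ring_def inv_module_def)

lemma module_inv: "Module.module (inv_ring n P) (inv_module n P k)"
proof (rule Module.moduleI)
  show "cring (inv_ring n P)"
  proof (rule cringI)
    show "abelian_group (inv_ring n P)"
    proof (rule abelian_groupI)
      fix u assume "u \<in> carrier (inv_ring n P)"
      then show "\<exists>v\<in>carrier (inv_ring n P). v \<oplus>\<^bsub>inv_ring n P\<^esub> u = \<zero>\<^bsub>inv_ring n P\<^esub>"
        by (intro bexI[of _ "- u"]) (auto simp: inv_ring_simps inv_ring_closed)
    qed (auto simp: inv_ring_simps inv_ring_closed ac_simps)
    show "Group.comm_monoid (inv_ring n P)"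
      by (rule comm_monoidI) (auto simp: inv_ring_simps inv_ring_closed ac_simps)
  qed (auto simp: inv_ring_simps distrib_right)
  show "abelian_group (inv_module n P k)"
  proof (rule abelian_groupI)
    fix f assume f: "f \<in> carrier (inv_module n P k)"
    have "ext_smult (- 1) f \<in> carrier (inv_module n P k)"
      by (rule inv_module_smult[OF _ f]) (intro inv_ring_closed)
    moreover have "ext_smult (- 1) f + f = 0" by (rule poly_mapping_eqI) (simp add: lookup_add)
    ultimately show "\<exists>h\<in>carrier (inv_module n P k). h \<oplus>\<^bsub>inv_module n P k\<^esub> f = \<zero>\<^bsub>inv_module n P k\<^esub>"
      by (auto simp: inv_module_simps)
  qed (auto simp: inv_module_simps inv_module_add inv_module_0 ac_simps)
qed (auto simp: inv_module_simps inv_ring_simps inv_module_smult lookup_add algebra_simps intro!: poly_mapping_eqI)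

lemma finsum_inv_module:
  assumes "finite B" "B \<subseteq> carrier (inv_module n P k)" "\<And>b. b \<in> B \<Longrightarrow> c b \<in> carrier (inv_ring n P)"
  shows "(\<Oplus>\<^bsub>inv_module n P k\<^esub>b\<in>B. c b \<odot>\<^bsub>inv_module n P k\<^esub> b) = (\<Sum>b\<in>B. ext_smult (c b) b)"
  using assms
proof (induction B rule: finite_induct)
  interpret Module.module "inv_ring n P" "inv_module n P k" by (rule module_inv)
  case empty
  show ?case by (simp add: inv_module_simps)
next
  interpret Module.module "inv_ring n P" "inv_module n P k" by (rule module_inv)
  case (insert b B)
  have "c a \<odot>\<^bsub>inv_module n P k\<^esub> a \<in> carrier (inv_module n P k)" if "a \<in> insert b B" for a
    using that insert.prems by (auto simp: inv_module_simps intro!: inv_module_smult)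
  then show ?case using insert by (subst finsum_insert) (auto simp: inv_module_simps)
qed

text \<open>In the coordinates given by \<open>zeta\<close>, \<open>basis_elt B\<close> is, up to
  sign, \<open>lead (lev B)\<close> times one vector. Once \<open>lead (lev B)\<close> divides
  \<open>d B\<close>, the quotient is an honest invariant, because both are semi-invariant for the
  same twist.\<close>

theorem free_criterion:
  fixes s :: "nat \<Rightarrow> 'a mpoly"
  defines "lead \<equiv> \<lambda>i. s i * Lpoly q (psum I i) X"
    and "basis_elt \<equiv> \<lambda>B. ext_smult (s (lev B)) (Mui q (psum I (lev B)) B)"
  assumes lead: "\<And>i. i \<le> length I \<Longrightarrow> lead i \<in> semi_inv k" "\<And>i. i \<le> length I \<Longrightarrow> lead i \<noteq> 0"
    and div: "\<And>f d B. f \<in> carrier (inv_module n P k) \<Longrightarrow> \<forall>B. d B \<in> semi_inv k \<Longrightarrow>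
      \<forall>C\<subseteq>{..<n}. Phi n (lookup f) C = (\<Sum>B\<in>Pow {..<n}. d B * zeta B C) \<Longrightarrow>
      B \<subseteq> {..<n} \<Longrightarrow> lead (lev B) dvd d B"
  shows "free_with_basis (inv_ring n P) (inv_module n P k) (2 ^ n) (basis_elt ` Pow {..<n})"
proof -
  let ?J = "Pow {..<n}" and ?M = "inv_module n P k" and ?R = "inv_ring n P"
  have Phi_bb: "Phi n (lookup (basis_elt B)) C = mui_sign B * lead (lev B) * zeta B C" if "B \<subseteq> {..<n}" for B C
  proof -
    have "lookup (basis_elt B) = (\<lambda>A. s (lev B) * lookup (Mui q (psum I (lev B)) B) A)"
      by (rule HOL.ext) (simp add: basis_elt_def)
    then show ?thesis using Phi_Mui[OF that] by (simp add: Phi_cmult lead_def ac_simps)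
  qed
  have bb_carrier: "basis_elt B \<in> carrier ?M" if B: "B \<subseteq> {..<n}" for B
  proof -
    have i: "lev B \<le> length I" by (rule lev_le_length[OF B])
    have M: "(Mui q (psum I (lev B)) B :: 'a sym_ext) \<in> sym_ext_alg n"
      by (rule Mui_in_sym_ext_alg[OF psum_le[OF i] lev_sub[OF B]])
    have "s (lev B) \<in> sym_alg n"
    proof (rule sym_alg_cancel)
      show "Lpoly q (psum I (lev B)) X * s (lev B) \<in> sym_alg n"
        using lead(1)[OF i] by (simp add: semi_inv_def lead_def mult.commute)
    qed (use sym_alg_Lpoly[OF psum_le[OF i]] Lpoly_X_nonzero in auto)
    then have b: "basis_elt B \<in> sym_ext_alg n" using M by (auto simp: sym_ext_alg_iff basis_elt_def intro: sym_alg_mult)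
    have "twisted_act k g (basis_elt B) = basis_elt B" if g: "g \<in> P" for g
      unfolding semi_invariant_iff[OF b g] Phi_bb[OF B]
      using lead(1)[OF i] g B by (auto simp: sym_act_mult mui_sign_invariant zeta_invariant semi_inv_def)
    then show ?thesis using b carrier_inv_module by blast
  qed
  \<comment> \<open>Linear independence over all polynomials, not only over the invariants; it also
    yields the injectivity of \<open>basis_elt\<close>.\<close>
  have zero: "e B = 0" if "\<And>C. C \<subseteq> {..<n} \<Longrightarrow> (\<Sum>B\<in>?J. e B * (mui_sign B * lead (lev B) * zeta B C)) = 0" "B \<subseteq> {..<n}" for e B
  proof -
    have "e B * (mui_sign B * lead (lev B)) = 0"
      by (rule zeta_unique[of "\<lambda>B. e B * (mui_sign B * lead (lev B))", OF _ that(2)]) (use that(1) in \<open>simp add: mult.assoc\<close>)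
    then show ?thesis using lead(2)[OF lev_le_length[OF that(2)]] mui_sign_nonzero by simp
  qed
  have inj: "inj_on basis_elt ?J"
  proof (rule inj_onI, rule ccontr)
    fix A B assume AB: "A \<in> ?J" "B \<in> ?J" "basis_elt A = basis_elt B" "A \<noteq> B"
    define e where "e C = (if C = A then 1 else if C = B then - 1 else (0 :: 'a mpoly))" for C
    have "e A = 0"
    proof (rule zero)
      fix C assume "C \<subseteq> {..<n}"
      have "(\<Sum>B'\<in>?J. e B' * (mui_sign B' * lead (lev B') * zeta B' C)) =
          (\<Sum>B'\<in>{A, B}. e B' * (mui_sign B' * lead (lev B') * zeta B' C))"
        by (rule sum.mono_neutral_right) (use AB in \<open>auto simp: e_def\<close>)
      also have "\<dots> = Phi n (lookup (basis_elt A)) C - Phi n (lookup (basis_elt B)) C"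
        using AB(1,2,4) by (simp add: e_def Phi_bb)
      finally show "(\<Sum>B'\<in>?J. e B' * (mui_sign B' * lead (lev B') * zeta B' C)) = 0" using AB(3) by simp
    qed (use AB in auto)
    then show False by (simp add: e_def)
  qed
  \<comment> \<open>Both sides are supported on subsets of \<open>{..<n}\<close>, where the equation
    can be tested after the injective \<open>Phi n\<close>.\<close>
  have sum_eq: "f = (\<Oplus>\<^bsub>?M\<^esub>b\<in>basis_elt ` ?J. c b \<odot>\<^bsub>?M\<^esub> b) \<longleftrightarrow>
      (\<forall>C\<subseteq>{..<n}. Phi n (lookup f) C = (\<Sum>B\<in>?J. c (basis_elt B) * (mui_sign B * lead (lev B) * zeta B C)))"
    if f: "f \<in> carrier ?M" and c: "c \<in> basis_elt ` ?J \<rightarrow>\<^sub>E carrier ?R" for f c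
  proof -
    let ?s = "\<Sum>B\<in>?J. ext_smult (c (basis_elt B)) (basis_elt B)"
    have "(\<Oplus>\<^bsub>?M\<^esub>b\<in>basis_elt ` ?J. c b \<odot>\<^bsub>?M\<^esub> b) = (\<Sum>b\<in>basis_elt ` ?J. ext_smult (c b) b)"
      by (rule finsum_inv_module) (use bb_carrier c in auto)
    also have "\<dots> = ?s" by (simp add: sum.reindex[OF inj])
    finally have fs: "(\<Oplus>\<^bsub>?M\<^esub>b\<in>basis_elt ` ?J. c b \<odot>\<^bsub>?M\<^esub> b) = ?s" .
    have lk: "lookup ?s = (\<lambda>A. \<Sum>B\<in>?J. c (basis_elt B) * lookup (basis_elt B) A)"
      by (rule HOL.ext) (simp add: lookup_sum)
    have Ps: "Phi n (lookup ?s) C = (\<Sum>B\<in>?J. c (basis_elt B) * (mui_sign B * lead (lev B) * zeta B C))" for C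
      unfolding lk Phi_sum Phi_cmult by (rule sum.cong) (auto simp: Phi_bb)
    define D where "D A = lookup f A - lookup ?s A" for A
    have D0: "D A = 0" if "\<not> A \<subseteq> {..<n}" for A
    proof -
      have "lookup (basis_elt B) A = 0" if "B \<subseteq> {..<n}" for B
        using bb_carrier[OF that] \<open>\<not> A \<subseteq> {..<n}\<close> by (simp add: carrier_inv_module sym_ext_alg_iff)
      then show ?thesis using f that by (simp add: D_def lk carrier_inv_module sym_ext_alg_iff)
    qed
    have "f = ?s \<longleftrightarrow> (\<forall>A. D A = 0)"
      unfolding D_def by (metis (no_types, lifting) eq_iff_diff_eq_0 poly_mapping_eqI)
    also have "\<dots> \<longleftrightarrow> (\<forall>C\<subseteq>{..<n}. Phi n D C = 0)"
    proof
      assume "\<forall>A. D A = 0"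
      then show "\<forall>C\<subseteq>{..<n}. Phi n D C = 0" by (simp add: Phi_def ext_map_def)
    next
      assume "\<forall>C\<subseteq>{..<n}. Phi n D C = 0"
      then show "\<forall>A. D A = 0" using Phi_inj[of n D] D0 by blast
    qed
    also have "\<dots> \<longleftrightarrow> (\<forall>C\<subseteq>{..<n}. Phi n (lookup f) C = Phi n (lookup ?s) C)"
      unfolding D_def[abs_def] Phi_diff by simp
    finally show ?thesis unfolding fs Ps .
  qed
  have ex1: "\<exists>!c. c \<in> basis_elt ` ?J \<rightarrow>\<^sub>E carrier ?R \<and> f = (\<Oplus>\<^bsub>?M\<^esub>b\<in>basis_elt ` ?J. c b \<odot>\<^bsub>?M\<^esub> b)"
    if f: "f \<in> carrier ?M" for f
  proof (rule ex_ex1I)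
    obtain d where d: "\<forall>B. d B \<in> semi_inv k"
      "\<forall>C\<subseteq>{..<n}. Phi n (lookup f) C = (\<Sum>B\<in>?J. d B * zeta B C)"
      using expansion[OF f] by blast
    define u where "u B = (SOME u. d B = lead (lev B) * u)" for B
    have u: "d B = lead (lev B) * u B" if "B \<subseteq> {..<n}" for B
      unfolding u_def by (rule someI_ex) (use div[OF f d that] in \<open>auto simp: dvd_def\<close>)
    have uR: "u B \<in> carrier ?R" if B: "B \<subseteq> {..<n}" for B
      unfolding carrier_inv_ring
    proof (intro conjI ballI)
      note i = lev_le_length[OF B]
      show "u B \<in> sym_alg n"
      proof (rule sym_alg_cancel)
        show "lead (lev B) * u B \<in> sym_alg n" using d(1) unfolding u[OF B, symmetric] by (simp add: semi_inv_def)
      qed (use lead[OF i] in \<open>auto simp: semi_inv_def\<close>)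
      fix g assume g: "g \<in> P"
      have "lead (lev B) * sym_act g (u B) = const (det g ^ k) * sym_act g (lead (lev B)) * sym_act g (u B)"
        using lead(1)[OF i] g by (simp add: semi_inv_def)
      also have "\<dots> = const (det g ^ k) * sym_act g (d B)" by (simp add: u[OF B] sym_act_mult mult.assoc)
      also have "\<dots> = lead (lev B) * u B" using d(1) g unfolding u[OF B, symmetric] by (simp add: semi_inv_def)
      finally show "sym_act g (u B) = u B" using lead(2)[OF i] by simp
    qed
    \<comment> \<open>The sign compensates the \<open>mui_sign B\<close> in the image of
      \<open>basis_elt B\<close>, since its square is 1.\<close>
    define c where "c = (\<lambda>b \<in> basis_elt ` ?J. mui_sign (inv_into ?J basis_elt b) * u (inv_into ?J basis_elt b))"
    have cb: "c (basis_elt B) = mui_sign B * u B" if "B \<subseteq> {..<n}" for B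
      using that inj by (simp add: c_def)
    have cE: "c \<in> basis_elt ` ?J \<rightarrow>\<^sub>E carrier ?R"
    proof (rule PiE_I)
      fix b assume "b \<in> basis_elt ` ?J"
      then obtain B where B: "b = basis_elt B" "B \<subseteq> {..<n}" by auto
      have "mui_sign B \<in> carrier ?R" by (simp add: carrier_inv_ring mui_sign_sym_alg mui_sign_invariant)
      then show "c b \<in> carrier ?R" using B uR by (simp add: cb inv_ring_closed)
    qed (simp add: c_def)
    have "Phi n (lookup f) C = (\<Sum>B\<in>?J. c (basis_elt B) * (mui_sign B * lead (lev B) * zeta B C))" if "C \<subseteq> {..<n}" for C
    proof -
      have "d B * zeta B C = c (basis_elt B) * (mui_sign B * lead (lev B) * zeta B C)" if "B \<subseteq> {..<n}" for B
      proof -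
        have "c (basis_elt B) * (mui_sign B * lead (lev B) * zeta B C) = (mui_sign B * mui_sign B) * (lead (lev B) * u B * zeta B C)"
          unfolding cb[OF that] by (simp only: ac_simps)
        then show ?thesis unfolding u[OF that] by (simp only: mui_sign_sq mult_1_left)
      qed
      then have "(\<Sum>B\<in>?J. d B * zeta B C) = (\<Sum>B\<in>?J. c (basis_elt B) * (mui_sign B * lead (lev B) * zeta B C))"
        by (intro sum.cong) auto
      then show ?thesis using d(2) that by simp
    qed
    then show "\<exists>c. c \<in> basis_elt ` ?J \<rightarrow>\<^sub>E carrier ?R \<and> f = (\<Oplus>\<^bsub>?M\<^esub>b\<in>basis_elt ` ?J. c b \<odot>\<^bsub>?M\<^esub> b)"
      using sum_eq[OF f cE] cE by blast
  next
    fix c c' assume c: "c \<in> basis_elt ` ?J \<rightarrow>\<^sub>E carrier ?R \<and> f = (\<Oplus>\<^bsub>?M\<^esub>b\<in>basis_elt ` ?J. c b \<odot>\<^bsub>?M\<^esub> b)"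
      and c': "c' \<in> basis_elt ` ?J \<rightarrow>\<^sub>E carrier ?R \<and> f = (\<Oplus>\<^bsub>?M\<^esub>b\<in>basis_elt ` ?J. c' b \<odot>\<^bsub>?M\<^esub> b)"
    have "c (basis_elt B) - c' (basis_elt B) = 0" if "B \<subseteq> {..<n}" for B
    proof (rule zero[OF _ that])
      fix C assume C: "C \<subseteq> {..<n}"
      have "(\<Sum>B\<in>?J. c (basis_elt B) * (mui_sign B * lead (lev B) * zeta B C)) = (\<Sum>B\<in>?J. c' (basis_elt B) * (mui_sign B * lead (lev B) * zeta B C))"
        using iffD1[OF sum_eq[OF f conjunct1[OF c]] conjunct2[OF c]]
          iffD1[OF sum_eq[OF f conjunct1[OF c']] conjunct2[OF c']] C by simp
      then show "(\<Sum>B\<in>?J. (c (basis_elt B) - c' (basis_elt B)) * (mui_sign B * lead (lev B) * zeta B C)) = 0"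
        by (simp add: left_diff_distrib sum_subtractf)
    qed
    then show "c = c'" using c c' by (intro PiE_ext[of c "basis_elt ` ?J" "\<lambda>_. carrier ?R"]) auto
  qed
  have "card (basis_elt ` ?J) = 2 ^ n" by (simp add: card_image[OF inj] card_Pow)
  then show ?thesis
    unfolding free_with_basis_def using module_inv bb_carrier ex1 by auto
qed

subsection \<open>Elements of the parabolic subgroup\<close>

text \<open>Only the indices of block \<open>i\<close> contribute to the \<open>i\<close>-th
  diagonal block of the product: earlier ones are killed by the first factor, later ones by the
  second.\<close>

lemma diag_block_mult:
  assumes g: "g \<in> carrier_mat n n" and h: "h \<in> carrier_mat n n" and i: "i < length I"
    and up: "\<And>i c k. i \<le> length I \<Longrightarrow> c < psum I i \<Longrightarrow> psum I i \<le> k \<Longrightarrow> k < n \<Longrightarrow> g $$ (k, c) = 0"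
      "\<And>i c k. i \<le> length I \<Longrightarrow> c < psum I i \<Longrightarrow> psum I i \<le> k \<Longrightarrow> k < n \<Longrightarrow> h $$ (k, c) = 0"
  shows "diag_block I i g * diag_block I i h = diag_block I i (g * h :: 'a mat)"
proof (rule eq_matI)
  let ?m = "psum I i"
  have m: "psum I (Suc i) = ?m + I ! i" "psum I (Suc i) \<le> n" using psum_Suc[OF i] psum_le[of "Suc i"] i by auto
  fix r c assume "r < dim_row (diag_block I i (g * h))" "c < dim_col (diag_block I i (g * h))"
  then have rc: "r < I ! i" "c < I ! i" by (auto simp: diag_block_def)
  have "(diag_block I i g * diag_block I i h) $$ (r, c) = (\<Sum>k<I ! i. g $$ (?m + r, ?m + k) * h $$ (?m + k, ?m + c))"
    using rc by (simp add: diag_block_def scalar_prod_def lessThan_atLeast0)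
  also have "\<dots> = (\<Sum>k\<in>{?m..<?m + I ! i}. g $$ (?m + r, k) * h $$ (k, ?m + c))"
    by (rule sum.reindex_bij_witness[of _ "\<lambda>k. k - ?m" "\<lambda>k. ?m + k"]) auto
  also have "\<dots> = (\<Sum>k<n. g $$ (?m + r, k) * h $$ (k, ?m + c))"
  proof (rule sum.mono_neutral_left)
    show "\<forall>k\<in>{..<n} - {?m..<?m + I ! i}. g $$ (?m + r, k) * h $$ (k, ?m + c) = 0"
    proof
      fix k assume k: "k \<in> {..<n} - {?m..<?m + I ! i}"
      show "g $$ (?m + r, k) * h $$ (k, ?m + c) = 0"
      proof (cases "k < ?m")
        case True
        then show ?thesis using up(1)[of i k "?m + r"] i m rc by simp
      next
        case False
        then show ?thesis using up(2)[of "Suc i" "?m + c" k] i m rc k by simp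
      qed
    qed
  qed (use m in auto)
  also have "\<dots> = (g * h) $$ (?m + r, ?m + c)"
    using g h m rc by (simp add: scalar_prod_def lessThan_atLeast0)
  finally show "(diag_block I i g * diag_block I i h) $$ (r, c) = diag_block I i (g * h) $$ (r, c)"
    using rc by (simp add: diag_block_def)
qed (simp_all add: diag_block_def)

text \<open>A block triangular inverse \<open>h\<close> also supplies the inverses of the diagonal
  blocks.\<close>

lemma parabolicI:
  assumes g: "g \<in> carrier_mat n n" and h: "h \<in> carrier_mat n n"
    and gh: "g * h = 1\<^sub>m n" "h * g = 1\<^sub>m n"
    and up: "\<And>i c k. i \<le> length I \<Longrightarrow> c < psum I i \<Longrightarrow> psum I i \<le> k \<Longrightarrow> k < n \<Longrightarrow> g $$ (k, c) = 0"
      "\<And>i c k. i \<le> length I \<Longrightarrow> c < psum I i \<Longrightarrow> psum I i \<le> k \<Longrightarrow> k < n \<Longrightarrow> h $$ (k, c) = 0"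
  shows "g \<in> P"
proof -
  have "invertible_mat g"
    unfolding invertible_mat_def inverts_mat_def using g h gh by auto
  moreover have "invertible_mat (diag_block I i g)" if i: "i < length I" for i
  proof -
    have one: "diag_block I i (1\<^sub>m n) = (1\<^sub>m (I ! i) :: 'a mat)"
      using psum_Suc[OF i] psum_le[of "Suc i"] i by (intro eq_matI) (auto simp: diag_block_def)
    have "diag_block I i g * diag_block I i h = 1\<^sub>m (I ! i)" "diag_block I i h * diag_block I i g = 1\<^sub>m (I ! i)"
      using diag_block_mult[OF g h i up] diag_block_mult[OF h g i up(2,1)] by (simp_all add: gh one)
    then show ?thesis unfolding invertible_mat_def inverts_mat_def by (auto simp: diag_block_def)
  qed
  moreover have "sum_list I = n" using comp by (simp add: is_composition_def)
  ultimately show ?thesis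
    using g up(1)[OF less_imp_le] by (simp add: parabolic_def GL_def)
qed

text \<open>One family for all group elements used below: torus elements, transvections, and the
  unipotent elements that send \<open>X s\<close> to a linear form.\<close>

definition col_mat :: "nat \<Rightarrow> (nat \<Rightarrow> 'a) \<Rightarrow> 'a mat" where
  "col_mat c u = mat n n (\<lambda>(r, j). if j = c then u r else if r = j then 1 else 0)"

lemma col_mat_mult:
  assumes "c < n"
  shows "col_mat c u * col_mat c v = col_mat c (\<lambda>r. u r * v c + (if r = c then 0 else v r))"
proof (rule eq_matI)
  fix r j assume "r < dim_row (col_mat c (\<lambda>r. u r * v c + (if r = c then 0 else v r)))"
    "j < dim_col (col_mat c (\<lambda>r. u r * v c + (if r = c then 0 else v r)))"
  then have rj: "r < n" "j < n" by (auto simp: col_mat_def)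
  have "(col_mat c u * col_mat c v) $$ (r, j) = (\<Sum>k<n. (if k = c then u r else if r = k then 1 else 0) *
      (if j = c then v k else if k = j then 1 else 0))"
    using rj by (simp add: col_mat_def scalar_prod_def lessThan_atLeast0)
  also have "\<dots> = (\<Sum>k<n. (if k = c then u r * (if j = c then v c else if c = j then 1 else 0) else 0) +
      (if k = r then (if r = c then 0 else if j = c then v r else if r = j then 1 else 0) else 0))"
    by (rule sum.cong) auto
  also have "\<dots> = (if j = c then u r * v c + (if r = c then 0 else v r) else if r = j then 1 else 0)"
    using rj assms by (auto simp: sum.distrib)
  finally show "(col_mat c u * col_mat c v) $$ (r, j) = col_mat c (\<lambda>r. u r * v c + (if r = c then 0 else v r)) $$ (r, j)"
    using rj by (simp add: col_mat_def)
qed (auto simp: col_mat_def)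

lemma col_mat_in_P:
  assumes c: "c < n" "u c \<noteq> 0"
    and up: "\<And>i k. i \<le> length I \<Longrightarrow> c < psum I i \<Longrightarrow> psum I i \<le> k \<Longrightarrow> k < n \<Longrightarrow> u k = 0"
  shows "col_mat c u \<in> P"
proof (rule parabolicI)
  \<comment> \<open>The column obtained by solving \<open>col_mat_mult\<close> for the identity
    matrix.\<close>
  let ?v = "\<lambda>r. if r = c then 1 / u c else - u r / u c"
  have one: "col_mat c (\<lambda>r. if r = c then 1 else 0) = 1\<^sub>m n" by (rule eq_matI) (auto simp: col_mat_def)
  have "(\<lambda>r. u r * ?v c + (if r = c then 0 else ?v r)) = (\<lambda>r. if r = c then 1 else 0)"
    "(\<lambda>r. ?v r * u c + (if r = c then 0 else u r)) = (\<lambda>r. if r = c then 1 else 0)"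
    using c by auto
  then show "col_mat c u * col_mat c ?v = 1\<^sub>m n" "col_mat c ?v * col_mat c u = 1\<^sub>m n"
    unfolding col_mat_mult[OF c(1)] using one by simp_all
qed (use up in \<open>auto simp: col_mat_def\<close>)

lemma act_x_col_mat:
  "j < n \<Longrightarrow> act_x (col_mat c u) j = (if j = c then (\<Sum>k<n. const (u k) * X k) else X j)"
proof -
  assume j: "j < n"
  have "act_x (col_mat c u) j = (\<Sum>k<n. if j = c then const (u k) * X k else if k = j then X k else 0)"
    unfolding act_x_def by (rule sum.cong) (use j in \<open>auto simp: col_mat_def\<close>)
  then show ?thesis using j by simp
qed

lemma det_col_mat:
  assumes "c < n" "\<And>r. c < r \<Longrightarrow> u r = 0"
  shows "det (col_mat c u) = u c"
proof -
  have "det (col_mat c u) = prod_list (diag_mat (col_mat c u))"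
    by (rule det_upper_triangular[of _ n]) (use assms in \<open>auto simp: col_mat_def upper_triangular_def\<close>)
  also have "\<dots> = (\<Prod>i<n. col_mat c u $$ (i, i))"
    by (simp add: diag_mat_def prod.list_conv_set_nth lessThan_atLeast0 col_mat_def)
  also have "\<dots> = (\<Prod>i<n. if i = c then u c else 1)"
    by (rule prod.cong) (auto simp: col_mat_def)
  finally show ?thesis using assms(1) by simp
qed

section \<open>Torus weights and divisibility by linear forms\<close>

definition torus :: "nat \<Rightarrow> 'a \<Rightarrow> 'a mat" where
  "torus s a = col_mat s (\<lambda>r. if r = s then a else 0)"

lemma torus_in_P: "s < n \<Longrightarrow> a \<noteq> 0 \<Longrightarrow> torus s a \<in> P"
  unfolding torus_def by (rule col_mat_in_P) auto

lemma det_torus: "s < n \<Longrightarrow> det (torus s a) = a"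
  unfolding torus_def by (subst det_col_mat) auto

lemma lookup_torus:
  assumes "f \<in> sym_alg n" "s < n"
  shows "lookup (sym_act (torus s a) f) e = a ^ lookup e s * lookup f e"
proof -
  define t where "t i = (if i = s then const a else 1) * (X i :: 'a mpoly)" for i
  have lin: "(\<Sum>k<n. const (if k = s then a else 0) * X k) = const a * (X s :: 'a mpoly)"
  proof -
    have "(\<Sum>k<n. const (if k = s then a else 0) * X k) = (\<Sum>k<n. if k = s then const a * (X s :: 'a mpoly) else 0)"
      by (rule sum.cong) auto
    then show ?thesis using assms(2) by simp
  qed
  have "sym_act (torus s a) f = poly_subst t f"
    unfolding sym_act_def
    by (rule poly_subst_cong[OF assms(1)]) (auto simp: torus_def act_x_col_mat t_def lin)
  also have "\<dots> = (\<Sum>e\<in>keys f. const (lookup f e) * mon t e)"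
    by (rule poly_subst_superset) auto
  also have "\<dots> = (\<Sum>e\<in>keys f. Poly_Mapping.single e (a ^ lookup e s * lookup f e))"
  proof (rule sum.cong[OF refl])
    fix e
    have "mon t e = (\<Prod>i\<in>keys e. (if i = s then const a ^ lookup e s else 1)) * mon X e"
      unfolding mon_def t_def power_mult_distrib prod.distrib
      by (intro arg_cong2[where f = "(*)"] prod.cong refl) auto
    also have "(\<Prod>i\<in>keys e. (if i = s then const a ^ lookup e s else 1 :: 'a mpoly)) = const (a ^ lookup e s)"
      by (auto simp: const_power in_keys_iff prod.delta)
    finally show "const (lookup f e) * mon t e =
        Poly_Mapping.single e (a ^ lookup e s * lookup f e)"
      by (simp add: single_conv_X const_mult ac_simps)
  qed
  finally have sub: "sym_act (torus s a) f =
    (\<Sum>e\<in>keys f. Poly_Mapping.single e (a ^ lookup e s * lookup f e))" .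
  have "lookup (sym_act (torus s a) f) e =
      (\<Sum>e'\<in>keys f. if e' = e then a ^ lookup e s * lookup f e else 0)"
    unfolding sub lookup_sum by (auto simp: lookup_single when_def intro!: sum.cong)
  then show ?thesis by (auto simp: in_keys_iff sum.delta)
qed

text \<open>The torus multiplies the monomial \<open>e\<close> by \<open>a ^ lookup e s\<close>, so
  \<open>a ^ (j + lookup e s) = 1\<close> for every unit \<open>a\<close>. Here \<open>j\<close> is
  the weight coming from the twist or from a factor \<open>y_s\<close>.\<close>

lemma torus_weight:
  assumes "f \<in> sym_alg n" "s < n"
    and inv: "\<And>a. a \<noteq> 0 \<Longrightarrow> const (a ^ j) * sym_act (torus s a) f = f"
    and e: "e \<in> keys f"
  shows "(q - 1) dvd (j + lookup e s)"
proof (rule dvd_of_power_eq_1)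
  fix a :: 'a assume "a \<noteq> 0"
  have "a ^ j * (a ^ lookup e s * lookup f e) = lookup f e"
    using arg_cong[OF inv[OF \<open>a \<noteq> 0\<close>], of "\<lambda>u. lookup u e"]
    by (simp add: lookup_const_mult lookup_torus[OF assms(1,2)])
  then have "a ^ (j + lookup e s) * lookup f e = 1 * lookup f e"
    by (simp add: power_add mult.assoc)
  then show "a ^ (j + lookup e s) = 1" using e by (simp add: in_keys_iff)
qed

text \<open>The unipotent element whose column \<open>s\<close> consists of the values of
  \<open>c\<close> and a 1 sends \<open>X s\<close> to \<open>lin_form s c\<close>. Its determinant
  is 1, so it fixes \<open>d\<close> whatever the twist.\<close>

lemma lin_form_power_dvd_semi_inv:
  assumes "d \<in> semi_inv k" "X s ^ j dvd d" "s < n"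
  shows "lin_form s c ^ j dvd d"
proof -
  define u where "u r = (if r < s then c r else if r = s then 1 else 0)" for r
  have g: "col_mat s u \<in> P" by (rule col_mat_in_P) (use assms(3) in \<open>auto simp: u_def\<close>)
  have "(\<Sum>k<n. const (u k) * X k) = (\<Sum>k<Suc s. const (u k) * X k :: 'a mpoly)"
    by (rule sum.mono_neutral_right) (use assms(3) in \<open>auto simp: u_def\<close>)
  also have "\<dots> = lin_form s c" by (simp add: lin_form_def u_def)
  finally have "sym_act (col_mat s u) (X s) = lin_form s c"
    by (simp add: sym_act_def act_x_col_mat assms(3))
  moreover have "sym_act (col_mat s u) d = d"
    using assms(1) g det_col_mat[OF assms(3), of u] by (auto simp: semi_inv_def u_def)
  ultimately show ?thesis
    using dvd_poly_subst[OF assms(2), of "act_x (col_mat s u)"] by (simp add: sym_act_def poly_subst_power)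
qed

lemma X_power_dvd_semi_inv:
  assumes d: "d \<in> semi_inv k" and k: "1 \<le> k" "k \<le> q - 2" and s: "s < n"
  shows "X s ^ (q - 1 - k) dvd d"
  unfolding X_power_dvd_iff
proof
  fix e assume e: "e \<in> keys d"
  have "(q - 1) dvd (k + lookup e s)"
  proof (rule torus_weight[OF _ s _ e])
    show "const (a ^ k) * sym_act (torus s a) d = d" if "a \<noteq> 0" for a
      using d torus_in_P[OF s that] det_torus[OF s, of a] by (fastforce simp: semi_inv_def)
  qed (use d in \<open>auto simp: semi_inv_def\<close>)
  \<comment> \<open>\<open>1 <= k\<close> enters here: it makes this multiple of
    \<open>q - 1\<close> positive.\<close>
  then have "q - 1 \<le> k + lookup e s" using k by (intro dvd_imp_le) auto
  then show "q - 1 - k \<le> lookup e s" by simp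
qed

lemma invariant_coeff:
  assumes f: "f \<in> carrier (inv_module n P 0)" and g: "g \<in> P"
  shows "ext_map n n (act_col g) ext_unit (\<lambda>A. sym_act g (lookup f A)) C = lookup f C"
  using lookup_twisted_act[of f g 0 C] f g by (simp add: carrier_inv_module)

text \<open>The factor \<open>y_s\<close> of \<open>y_A\<close> is scaled by \<open>a\<close> as
  well, which adds 1 to the weight when \<open>s\<close> is in \<open>A\<close>.\<close>

lemma torus_weight_coeff:
  assumes f: "f \<in> carrier (inv_module n P 0)" and s: "s < n" and A: "A \<subseteq> {..<n}"
    and e: "e \<in> keys (lookup f A)"
  shows "(q - 1) dvd ((if s \<in> A then 1 else 0) + lookup e s)"
proof (rule torus_weight[OF _ s _ e])
  show "lookup f A \<in> sym_alg n" using f by (simp add: carrier_inv_module lookup_sym_alg)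
  fix a :: 'a assume "a \<noteq> 0"
  let ?g = "torus s a" and ?w = "\<lambda>b. if b = s then const a else 1 :: 'a mpoly"
  have "lookup f A = ext_map n n (act_col ?g) ext_unit (\<lambda>A. sym_act ?g (lookup f A)) A"
    by (rule invariant_coeff[OF f torus_in_P[OF s \<open>a \<noteq> 0\<close>], symmetric])
  also have "\<dots> = ext_map n n (\<lambda>b k. ?w b * unitv b k) ext_unit (\<lambda>A. sym_act ?g (lookup f A)) A"
    by (rule fun_cong[of _ _ A], rule ext_map_cong) (auto simp: act_col_def torus_def col_mat_def unitv_def)
  also have "\<dots> = (\<Prod>b\<in>A. ?w b) * sym_act ?g (lookup f A)" by (rule ext_map_scalar[OF A])
  also have "(\<Prod>b\<in>A. ?w b) = const (a ^ (if s \<in> A then 1 else 0))"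
    using finite_subset[OF A] by (simp add: prod.delta)
  finally show "const (a ^ (if s \<in> A then 1 else 0)) * sym_act ?g (lookup f A) = lookup f A" ..
qed

text \<open>\<open>T\<close> is the substitution \<open>y_c -> y_c + y_s\<close>. A product
  \<open>y_A\<close> contributes to the index \<open>D\<close> either as itself or with its factor
  \<open>y_c\<close> replaced by \<open>y_s\<close>; the sign moves that factor to its new
  place.\<close>

lemma wedges_transvection:
  assumes sc: "s < n" "c < n" "s \<noteq> c" and D: "D \<subseteq> {..<n}" "s \<in> D" "c \<notin> D" and A: "A \<subseteq> {..<n}"
    and T: "\<And>a k. a < n \<Longrightarrow> a \<noteq> c \<Longrightarrow> k < n \<Longrightarrow> T a k = unitv a k" "\<And>k. k < n \<Longrightarrow> T c k = unitv c k + unitv s k"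
  shows "wedges n T A ext_unit D = (if A = D then 1 else if A = insert c (D - {s})
    then (-1) ^ card {b \<in> D - {s}. b < c} * (-1) ^ card {b \<in> D. b < s} else (0 :: 'r::comm_ring_1))"
proof -
  have fin: "finite A" "finite D" using A D finite_subset by blast+
  have unit: "wedges n T B ext_unit = wedges n unitv B ext_unit" if "c \<notin> B" "B \<subseteq> {..<n}" for B
  proof (rule wedges_cong)
    show "T a k = unitv a k" if "a \<in> B" "k < n" for a k
      using T(1)[of a k] that \<open>c \<notin> B\<close> \<open>B \<subseteq> {..<n}\<close> by auto
  qed (use that finite_subset[OF that(2)] in simp)
  show ?thesis
  proof (cases "c \<in> A")
    case False
    then show ?thesis using unit[OF False A] A fin by (auto simp: wedges_unitv)
  next
    case True
    let ?B = "A - {c}" and ?G = "wedges n unitv (A - {c}) ext_unit :: nat set \<Rightarrow> 'r"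
    have B: "?B \<subseteq> {..<n}" "finite ?B" "insert c ?B = A" using A fin True by auto
    have "wedge n (T c) ?G D = (-1) ^ card {b \<in> ?B. b < c} * wedges n T A ext_unit D"
      using wedge_wedges[OF B(2), of n T c ext_unit D] unit[OF _ B(1)] B(3) by simp
    then have "wedges n T A ext_unit D = (-1) ^ card {b \<in> ?B. b < c} * wedge n (T c) ?G D"
      by (simp add: mult.assoc[symmetric] power_mult_distrib[symmetric])
    also have "wedge n (T c) ?G D = wedge n (\<lambda>k. unitv c k + unitv s k) ?G D"
      unfolding wedge_def by (rule sum.cong) (auto simp: T(2))
    also have "\<dots> = wedge n (unitv c) ?G D + wedge n (unitv s) ?G D"
      by (simp add: wedge_def distrib_right sum.distrib)
    also have "\<dots> = (-1) ^ card {b \<in> D. b < s} * ?G (D - {s})"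
      using sc D by (simp add: wedge_unitv y_wedge_def)
    also have "?G (D - {s}) = (if D - {s} = ?B then 1 else 0)"
      by (rule wedges_unitv[OF B(1)]) (use fin in simp)
    finally have wedges: "wedges n T A ext_unit D = (-1) ^ card {b \<in> ?B. b < c} *
      ((-1) ^ card {b \<in> D. b < s} * (if D - {s} = ?B then 1 else 0))" .
    have iff: "D - {s} = ?B \<longleftrightarrow> A = insert c (D - {s})" using True D by auto
    have "A \<noteq> D" using True D by auto
    show ?thesis
    proof (cases "D - {s} = ?B")
      case eq: True
      have "A = insert c (D - {s})" using eq iff by blast
      then show ?thesis using \<open>A \<noteq> D\<close> unfolding wedges eq[symmetric] by simp
    next
      case False
      then show ?thesis using \<open>A \<noteq> D\<close> iff unfolding wedges by simp
    qed
  qed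
qed

text \<open>The transvection \<open>x\<^sub>c \<mapsto> x\<^sub>c + x\<^sub>s\<close> is trivial modulo \<open>x\<^sub>s\<close> on polynomials, but not on the \<open>y\<close>'s.\<close>

lemma X_dvd_coeff:
  assumes f: "f \<in> carrier (inv_module n P 0)" and sc: "s < n" "c < n" "s \<noteq> c"
    and A: "A \<subseteq> {..<n}" "c \<in> A" "s \<notin> A"
    and block: "\<And>i. i \<le> length I \<Longrightarrow> c < psum I i \<Longrightarrow> s < psum I i"
  shows "X s dvd lookup f A"
proof -
  define u :: "nat \<Rightarrow> 'a" where "u r = (if r = c \<or> r = s then 1 else 0)" for r
  let ?g = "col_mat c u" and ?F = "lookup f"
  have g: "?g \<in> P" by (rule col_mat_in_P) (use sc block in \<open>force simp: u_def\<close>)+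
  \<comment> \<open>\<open>D\<close> is \<open>A\<close> with \<open>c\<close> exchanged for
    \<open>s\<close>, so the coefficient at \<open>D\<close> after the transvection involves
    \<open>f\<close> only at \<open>D\<close> and \<open>A\<close>.\<close>
  define D where "D = insert s (A - {c})"
  have D: "D \<subseteq> {..<n}" "s \<in> D" "c \<notin> D" and A_eq: "A = insert c (D - {s})"
    using A sc by (auto simp: D_def)
  define \<epsilon> :: "'a mpoly" where "\<epsilon> = (-1) ^ card {b \<in> D - {s}. b < c} * (-1) ^ card {b \<in> D. b < s}"
  have eps: "\<epsilon> * \<epsilon> = 1" by (simp add: \<epsilon>_def power_mult_distrib[symmetric] mult.assoc[symmetric] power_add[symmetric] mult.left_commute)
  have T: "a < n \<Longrightarrow> a \<noteq> c \<Longrightarrow> k < n \<Longrightarrow> act_col ?g a k = unitv a k" "k < n \<Longrightarrow> act_col ?g c k = unitv c k + unitv s k" for a k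
    using sc by (auto simp: act_col_def col_mat_def unitv_def u_def)
  have "?F D = ext_map n n (act_col ?g) ext_unit (\<lambda>A. sym_act ?g (?F A)) D" using invariant_coeff[OF f g] by simp
  also have "\<dots> = (\<Sum>B\<in>Pow {..<n}. (if B = D then sym_act ?g (?F D) else 0) + (if B = A then \<epsilon> * sym_act ?g (?F A) else 0))"
    unfolding ext_map_def
  proof (rule sum.cong[OF refl])
    fix B assume "B \<in> Pow {..<n}"
    then have B: "B \<subseteq> {..<n}" by simp
    have wedges: "wedges n (act_col ?g) B ext_unit D = (if B = D then 1 else if B = A then \<epsilon> else 0)"
      unfolding A_eq \<epsilon>_def by (rule wedges_transvection[OF sc D B]) (use T in auto)
    have "A \<noteq> D" using A D by auto
    then show "sym_act ?g (?F B) * wedges n (act_col ?g) B ext_unit D =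
        (if B = D then sym_act ?g (?F D) else 0) + (if B = A then \<epsilon> * sym_act ?g (?F A) else 0)"
      unfolding wedges by simp
  qed
  also have "\<dots> = sym_act ?g (?F D) + \<epsilon> * sym_act ?g (?F A)" using A D by (simp add: sum.distrib)
  finally have eq: "\<epsilon> * sym_act ?g (?F A) = ?F D - sym_act ?g (?F D)"
    by (metis add_diff_cancel_left')
  have sa: "?F B \<in> sym_alg n" for B using f by (simp add: carrier_inv_module lookup_sym_alg)
  have triv: "X s dvd h - sym_act ?g h" if h: "h \<in> sym_alg n" for h
  proof -
    have lin: "(\<Sum>k<n. const (u k) * X k) = X c + X s"
    proof -
      have "(\<Sum>k<n. const (u k) * X k) = (\<Sum>k\<in>{c, s}. const (u k) * X k :: 'a mpoly)"
        by (rule sum.mono_neutral_right) (use sc in \<open>auto simp: u_def\<close>)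
      then show ?thesis using sc by (simp add: u_def)
    qed
    have "sym_act ?g h = poly_subst (\<lambda>j. if j = c then X c + X s else X j) h"
      unfolding sym_act_def by (rule poly_subst_cong[OF h]) (simp add: act_x_col_mat lin)
    moreover have "X s dvd poly_subst X h - poly_subst (\<lambda>j. if j = c then X c + X s else X j) h"
      by (rule dvd_poly_subst_diff) auto
    ultimately show ?thesis by simp
  qed
  \<comment> \<open>The difference in \<open>eq\<close> is divisible by \<open>X s\<close> since the
    transvection is trivial modulo \<open>X s\<close>; the second sign cancels the first.\<close>
  have "X s dvd \<epsilon> * (\<epsilon> * sym_act ?g (?F A))" unfolding eq using triv[OF sa[of D]] by simp
  then have "X s dvd sym_act ?g (?F A)" by (simp add: mult.assoc[symmetric] eps)
  then show ?thesis using triv[OF sa[of A]] by (metis diff_add_cancel dvd_add)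
qed

text \<open>One factor of the product is \<open>xi s\<close>, whose entries are all positive powers
  of \<open>X s\<close>.\<close>

lemma X_dvd_wedges_xi:
  assumes "finite A" "s \<in> A"
  shows "X s dvd wedges n xi A ext_unit C"
proof -
  have fin: "finite (A - {s})" using assms by simp
  have "wedge n (xi s) (wedges n xi (A - {s}) ext_unit) C = (-1) ^ card {b \<in> A - {s}. b < s} * wedges n xi A ext_unit C"
    using wedge_wedges[OF fin, of n xi s ext_unit C] assms(2) by (simp add: insert_absorb)
  then have "wedges n xi A ext_unit C = (-1) ^ card {b \<in> A - {s}. b < s} * wedge n (xi s) (wedges n xi (A - {s}) ext_unit) C"
    by (simp add: mult.assoc[symmetric] power_mult_distrib[symmetric])
  moreover have "X s dvd wedge n (xi s) (wedges n xi (A - {s}) ext_unit) C"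
    unfolding wedge_def xi_def using q_ge_2 by (intro dvd_sum dvd_mult2 dvd_power) simp
  ultimately show ?thesis by simp
qed

lemma Lpoly_dvd: "i \<le> length I \<Longrightarrow> Lpoly q (psum I i) X dvd (Lpoly q n X :: 'a mpoly)"
  using prod_theta[of i I] prod_theta[of "length I" I] psum_length
    prod_dvd_prod_subset[of "{..<length I}" "{..<i}" "theta q I :: nat \<Rightarrow> 'a mpoly"] by auto

text \<open>The triangular system is solved on the subsets of \<open>{..<psum I t}\<close> alone.
  \<open>Phi_vanish\<close> shows that the solution is also right at all other indices, and
  uniqueness identifies it with \<open>d\<close>.\<close>

lemma low_part:
  assumes t: "t \<le> length I" and F: "\<And>A. \<not> A \<subseteq> {..<psum I t} \<Longrightarrow> F A = 0"
    and d: "\<And>C. C \<subseteq> {..<n} \<Longrightarrow> Phi n F C = (\<Sum>B\<in>Pow {..<n}. d B * zeta B C)"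
    and B: "B \<subseteq> {..<n}" "\<not> B \<subseteq> {..<psum I t}"
  shows "d B = 0"
proof -
  let ?m = "psum I t" and ?L = "Lpoly q n X :: 'a mpoly"
  let ?J = "Pow {..<?m}"
  have mn: "?m \<le> n" by (rule psum_le[OF t])
  then have Jn: "B \<subseteq> {..<n}" if "B \<in> ?J" for B using that by fastforce
  have "\<exists>d. (\<forall>B. d B \<in> UNIV) \<and> (\<forall>C\<in>?J. Phi n F C = (\<Sum>B\<in>?J. d B * zeta B C))"
    by (rule unitri_solve[where lev = lev]) (use Jn zeta_diag zeta_off in auto)
  then obtain d' where d': "\<And>C. C \<in> ?J \<Longrightarrow> Phi n F C = (\<Sum>B\<in>?J. d' B * zeta B C)" by blast
  have levt: "lev B \<le> t" "psum I (lev B) \<le> ?m" if "B \<in> ?J" for B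
    using lev_le_iff[OF Jn[OF that], of t] that psum_mono[of "lev B" t I] by auto
  define u where "u B = (SOME u. ?L = Lpoly q (psum I (lev B)) X * u)" for B
  have u: "?L = Lpoly q (psum I (lev B)) X * u B" if "B \<in> ?J" for B
    unfolding u_def by (rule someI_ex) (use Lpoly_dvd[of "lev B"] levt[OF that] t in \<open>auto simp: dvd_def\<close>)
  define M where "M B = lookup (Mui q (psum I (lev B)) B :: 'a sym_ext)" for B
  \<comment> \<open>\<open>Phi_vanish\<close> needs an element of the exterior algebra, but
    \<open>zeta B\<close> is the image of one only after multiplication by a Moore determinant; the
    common multiple \<open>?L\<close> clears these denominators.\<close>
  define F' where "F' A = ?L * F A - (\<Sum>B\<in>?J. (d' B * mui_sign B * u B) * M B A)" for A
  have PF: "Phi n F' C = ?L * (Phi n F C - (\<Sum>B\<in>?J. d' B * zeta B C))" for C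
  proof -
    have t: "(d' B * mui_sign B * u B) * Phi n (M B) C = ?L * (d' B * zeta B C)" if "B \<in> ?J" for B
    proof -
      have "(d' B * mui_sign B * u B) * Phi n (M B) C = (mui_sign B * mui_sign B) * (Lpoly q (psum I (lev B)) X * u B) * (d' B * zeta B C)"
        unfolding M_def Phi_Mui[OF Jn[OF that]] by (simp only: ac_simps)
      then show ?thesis by (simp add: u[OF that, symmetric])
    qed
    have "(\<Sum>B\<in>?J. (d' B * mui_sign B * u B) * Phi n (M B) C) = (\<Sum>B\<in>?J. ?L * (d' B * zeta B C))"
      by (rule sum.cong[OF refl t])
    then show ?thesis
      unfolding F'_def[abs_def] Phi_diff Phi_sum Phi_cmult right_diff_distrib sum_distrib_left by simp
  qed
  have "Phi n F' C = 0" for C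
  proof (rule Phi_vanish[OF mn])
    show "\<forall>A. \<not> A \<subseteq> {..<?m} \<longrightarrow> F' A = 0"
    proof (intro allI impI)
      fix A assume A: "\<not> A \<subseteq> {..<?m}"
      have "M B A = 0" if "B \<in> ?J" for B
      proof -
        have "\<not> A \<subseteq> {..<psum I (lev B)}" using A levt(2)[OF that] by fastforce
        then show ?thesis by (simp add: M_def lookup_Mui mui_coeff_def)
      qed
      then show "F' A = 0" using F[OF A] by (simp add: F'_def)
    qed
    fix C assume "C \<subseteq> {..<?m}"
    then show "Phi n F' C = 0" using d'[of C] by (simp add: PF)
  qed
  then have eq: "Phi n F C = (\<Sum>B\<in>?J. d' B * zeta B C)" for C
    using Lpoly_X_nonzero[of n] by (simp add: PF)
  have "d B - (if B \<in> ?J then d' B else 0) = 0"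
  proof (rule zeta_unique[OF _ B(1)])
    fix C assume C: "C \<subseteq> {..<n}"
    have "(\<Sum>B\<in>Pow {..<n}. (if B \<in> ?J then d' B else 0) * zeta B C) = (\<Sum>B\<in>?J. d' B * zeta B C)"
      by (rule sum.mono_neutral_cong_right) (use Jn in auto)
    then show "(\<Sum>B\<in>Pow {..<n}. (d B - (if B \<in> ?J then d' B else 0)) * zeta B C) = 0"
      using d[OF C] eq[of C] by (simp add: left_diff_distrib sum_subtractf)
  qed
  then show ?thesis using B by simp
qed

lemma power_pred: "(u :: 'a mpoly) ^ (q - 2) * u = u ^ (q - 1)"
proof -
  have "q - 1 = Suc (q - 2)" using q_ge_2 by simp
  then show ?thesis by (simp add: mult.commute)
qed

text \<open>With \<open>s\<close> in block \<open>t\<close>, \<open>f\<close> is split at the start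
  of that block. The low part does not affect \<open>d B\<close>, whose level exceeds
  \<open>t\<close>; each term of the high part is divisible by the full power, and the triangular
  system carries this over to the coefficients.\<close>

lemma X_power_dvd_invariant:
  assumes f: "f \<in> carrier (inv_module n P 0)"
    and d: "\<forall>C\<subseteq>{..<n}. Phi n (lookup f) C = (\<Sum>B\<in>Pow {..<n}. d B * zeta B C)"
    and B: "B \<subseteq> {..<n}" and s: "s < psum I (lev B)"
  shows "X s ^ (q - 1) dvd d B"
proof -
  let ?F = "lookup f" and ?Q = "{u. X s ^ (q - 1) dvd u}"
  \<comment> \<open>The block of \<open>s\<close>, counted from 0:
    \<open>psum I t \<le> s < psum I (Suc t)\<close>.\<close>
  define t where "t = (LEAST i. s < psum I i) - 1"
  have L: "s < psum I (LEAST i. s < psum I i)" "(LEAST i. s < psum I i) \<le> lev B"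
    using s by (auto intro: LeastI Least_le)
  have "(LEAST i. s < psum I i) \<noteq> 0"
  proof
    assume "(LEAST i. s < psum I i) = 0"
    then have "s < psum I 0" using L(1) by simp
    then show False by (simp add: psum_def)
  qed
  then have t: "s < psum I (Suc t)" "t < lev B" "t < (LEAST i. s < psum I i)" using L by (auto simp: t_def)
  have ts: "psum I t \<le> s" using not_less_Least[OF t(3)] by simp
  have tl: "t < length I" using t(2) lev_le_length[OF B] by simp
  have sn: "s < n" using t(1) psum_le[of "Suc t"] tl by simp
  have Bt: "\<not> B \<subseteq> {..<psum I t}" using lev_le_iff[OF B, of t] t(2) by simp
  define low where "low A = (if A \<subseteq> {..<psum I t} then ?F A else 0)" for A
  define high where "high A = ?F A - low A" for A
  have hi_dvd: "X s ^ (q - 1) dvd high A * wedges n xi A ext_unit C" if A: "A \<subseteq> {..<n}" for A C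
  proof (cases "A \<subseteq> {..<psum I t}")
    case False
    then have hA: "high A = ?F A" by (simp add: high_def low_def)
    show ?thesis
    proof (cases "s \<in> A")
      case True
      \<comment> \<open>The weight \<open>1 + lookup e s\<close> is a positive multiple of
        \<open>q - 1\<close>, which leaves one factor \<open>X s\<close> missing; the substitution
        for \<open>y_s\<close> contributes it.\<close>
      have "X s ^ (q - 2) dvd ?F A"
        unfolding X_power_dvd_iff
      proof
        fix e assume "e \<in> keys (?F A)"
        then have "(q - 1) dvd (1 + lookup e s)" using torus_weight_coeff[OF f sn A] True by force
        then have "q - 1 \<le> 1 + lookup e s" by (rule dvd_imp_le) simp
        then show "q - 2 \<le> lookup e s" by simp
      qed
      then have "X s ^ (q - 2) * X s dvd ?F A * wedges n xi A ext_unit C"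
        using X_dvd_wedges_xi[OF finite_subset[OF A] True] by (intro mult_dvd_mono) auto
      then show ?thesis by (simp only: hA power_pred)
    next
      case sA: False
      \<comment> \<open>\<open>c\<close> lies in the block of \<open>s\<close> or a later one, so
        the transvection \<open>x_c -> x_c + x_s\<close> belongs to the group and rules out the
        exponent 0.\<close>
      obtain c where "c \<in> A" "c \<notin> {..<psum I t}" using False by blast
      then have c: "c \<in> A" "psum I t \<le> c" by auto
      have "s < psum I i" if "i \<le> length I" "c < psum I i" for i
      proof -
        have "\<not> i \<le> t" using psum_mono[of i t I] that(2) c(2) by auto
        then show ?thesis using psum_mono[of "Suc t" i I] t(1) by simp
      qed
      then have "X s dvd ?F A"
        using c sA A by (intro X_dvd_coeff[OF f sn, of c]) auto
      then have X1: "X s ^ 1 dvd ?F A" by simp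
      have "X s ^ (q - 1) dvd ?F A"
        unfolding X_power_dvd_iff
      proof
        fix e assume e: "e \<in> keys (?F A)"
        then have "(q - 1) dvd lookup e s" using torus_weight_coeff[OF f sn A e] sA by simp
        moreover have "1 \<le> lookup e s" using X1 e unfolding X_power_dvd_iff by blast
        ultimately show "q - 1 \<le> lookup e s" by (intro dvd_imp_le) auto
      qed
      then show ?thesis by (simp add: hA)
    qed
  qed (simp add: high_def low_def)
  have "\<exists>d. (\<forall>B. d B \<in> ?Q) \<and> (\<forall>C\<subseteq>{..<n}. Phi n high C = (\<Sum>B\<in>Pow {..<n}. d B * zeta B C))"
  proof (rule zeta_solve)
    show "Phi n high C \<in> ?Q" for C unfolding Phi_def ext_map_def using hi_dvd by (auto intro: dvd_sum)
  qed auto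
  then obtain d1 where d1: "\<And>B. X s ^ (q - 1) dvd d1 B"
    "\<And>C. C \<subseteq> {..<n} \<Longrightarrow> Phi n high C = (\<Sum>B\<in>Pow {..<n}. d1 B * zeta B C)" by auto
  have "d B - d1 B = 0"
  proof (rule low_part[of t low "\<lambda>B. d B - d1 B", OF _ _ _ B Bt])
    fix C assume C: "C \<subseteq> {..<n}"
    have "Phi n low C = Phi n ?F C - Phi n high C" unfolding high_def[abs_def] Phi_diff by simp
    then show "Phi n low C = (\<Sum>B\<in>Pow {..<n}. (d B - d1 B) * zeta B C)"
      using d C d1(2)[OF C] by (simp add: left_diff_distrib sum_subtractf)
  qed (use tl in \<open>auto simp: low_def\<close>)
  then show ?thesis using d1(1)[of B] by simp
qed

section \<open>The two bases\<close>

lemma Lpoly_semi_inv: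
  assumes "i \<le> length I" "g \<in> P"
  shows "sym_act g (Lpoly q (psum I i) X ^ (q - 1)) = (Lpoly q (psum I i) X ^ (q - 1) :: 'a mpoly)"
  using unit_power[OF block_det_nonzero[OF assms(2,1) refl]] sym_act_Lpoly[OF assms(2,1) refl]
  by (simp add: sym_act_def poly_subst_power power_mult_distrib const_power[symmetric])

text \<open>Translates all subsets of \<open>{..<n}\<close> into the index set of the theorem: level
  \<open>Suc i\<close> means that \<open>B\<close> lies below \<open>psum I (Suc i)\<close> but its
  maximum does not lie below \<open>psum I i\<close>. The empty set, of level 0, gives the extra
  element.\<close>

lemma basis_image:
  assumes "\<And>B. basis_elt B = h (lev B) B"
  shows "basis_elt ` Pow {..<n} = insert (h 0 {})
    {h (Suc i) B |i B. i < length I \<and> B \<noteq> {} \<and> B \<subseteq> {..<psum I (Suc i)} \<and> psum I i \<le> Max B}"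
    (is "_ = insert _ ?S")
proof
  have lev0: "lev {} = 0" by (simp add: lev_def)
  show "basis_elt ` Pow {..<n} \<subseteq> insert (h 0 {}) ?S"
  proof
    fix b assume "b \<in> basis_elt ` Pow {..<n}"
    then obtain B where B: "b = basis_elt B" "B \<subseteq> {..<n}" by auto
    show "b \<in> insert (h 0 {}) ?S"
    proof (cases "B = {}")
      case True
      then show ?thesis using B lev0 by (simp add: assms)
    next
      case False
      have "lev B \<noteq> 0" using lev_sub[OF B(2)] False by (auto simp: psum_def)
      then obtain i where i: "lev B = Suc i" by (cases "lev B") auto
      have fB: "finite B" using B finite_subset by blast
      have "\<not> B \<subseteq> {..<psum I i}" using lev_le_iff[OF B(2), of i] i by simp
      then obtain x where "x \<in> B" "x \<notin> {..<psum I i}" by blast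
      then have "x \<in> B" "psum I i \<le> x" by auto
      then have "psum I i \<le> Max B" using Max_ge[OF fB] le_trans by blast
      moreover have "i < length I" "B \<subseteq> {..<psum I (Suc i)}"
        using i lev_le_length[OF B(2)] lev_sub[OF B(2)] by simp_all
      ultimately have "h (Suc i) B \<in> ?S" using False by blast
      then show ?thesis using B i by (simp add: assms)
    qed
  qed
  have "h 0 {} \<in> basis_elt ` Pow {..<n}" using lev0 assms[of "{}"] by (intro image_eqI[of _ _ "{}"]) auto
  moreover have "h (Suc i) B \<in> basis_elt ` Pow {..<n}"
    if i: "i < length I" "B \<noteq> {}" "B \<subseteq> {..<psum I (Suc i)}" "psum I i \<le> Max B" for i B
  proof -
    have B: "B \<subseteq> {..<n}" using i psum_le[of "Suc i"] by fastforce
    have "\<not> B \<subseteq> {..<psum I i}"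
      using Max_in[OF finite_subset[OF B finite_lessThan] i(2)] i(4) by auto
    then have "lev B = Suc i" using lev_le_iff[OF B, of i] lev_le_iff[OF B, of "Suc i"] i(3) by simp
    then show ?thesis using B assms[of B] by (intro image_eqI[of _ _ B]) auto
  qed
  ultimately show "insert (h 0 {}) ?S \<subseteq> basis_elt ` Pow {..<n}" by blast
qed

theorem free_untwisted:
  "free_with_basis (inv_ring n P) (inv_module n P 0) (2 ^ n)
     (insert ext_one {ext_smult (\<Prod>t<Suc i. theta q I t ^ (q - 2)) (Mui q (psum I (Suc i)) B) |i B.
        i < length I \<and> B \<noteq> {} \<and> B \<subseteq> {..<psum I (Suc i)} \<and> psum I i \<le> Max B})"
proof -
  let ?s = "\<lambda>i. \<Prod>t<i. theta q I t ^ (q - 2) :: 'a mpoly"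
  let ?h = "\<lambda>i B. ext_smult (?s i) (Mui q (psum I i) B)"
  \<comment> \<open>The first \<open>i\<close> thetas multiply to
    \<open>Lpoly q (psum I i) X\<close>, so exponents \<open>q - 2\<close> become
    \<open>q - 1\<close> once the Moore determinant from \<open>Phi\<close> is added.\<close>
  have D: "?s i * Lpoly q (psum I i) X = Lpoly q (psum I i) X ^ (q - 1)" if "i \<le> length I" for i
    by (simp add: prod_power_distrib[symmetric] prod_theta[OF that] power_pred)
  have "free_with_basis (inv_ring n P) (inv_module n P 0) (2 ^ n) ((\<lambda>B. ?h (lev B) B) ` Pow {..<n})"
  proof (rule free_criterion)
    fix i assume i: "i \<le> length I"
    show "?s i * Lpoly q (psum I i) X \<in> semi_inv 0"
      unfolding D[OF i] using Lpoly_semi_inv[OF i] psum_le[OF i]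
      by (auto simp: semi_inv_def intro: sym_alg_power sym_alg_Lpoly)
    show "?s i * Lpoly q (psum I i) X \<noteq> 0" unfolding D[OF i] using Lpoly_X_nonzero by simp
  next
    fix f and d :: "nat set \<Rightarrow> 'a mpoly" and B
    assume f: "f \<in> carrier (inv_module n P 0)" and d: "\<forall>B. d B \<in> semi_inv 0"
      "\<forall>C\<subseteq>{..<n}. Phi n (lookup f) C = (\<Sum>B\<in>Pow {..<n}. d B * zeta B C)"
      and B: "B \<subseteq> {..<n}"
    note i = lev_le_length[OF B]
    show "?s (lev B) * Lpoly q (psum I (lev B)) X dvd d B"
      unfolding D[OF i]
    proof (rule Lpoly_power_dvd)
      fix s c assume s: "s < psum I (lev B)"
      show "lin_form s c ^ (q - 1) dvd d B"
        using X_power_dvd_invariant[OF f d(2) B s] d(1) s psum_le[OF i]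
        by (intro lin_form_power_dvd_semi_inv[of _ 0]) auto
    qed
  qed
  moreover have "?h 0 {} = ext_one" by (rule poly_mapping_eqI) (simp add: psum_def Mui_0)
  ultimately show ?thesis unfolding basis_image[of "\<lambda>B. ?h (lev B) B" ?h, OF refl] by simp
qed

theorem free_twisted:
  assumes k: "1 \<le> k" "k \<le> q - 2"
  shows "free_with_basis (inv_ring n P) (inv_module n P k) (2 ^ n)
     (insert (ext_smult ((\<Prod>t<length I. theta q I t) ^ (q - 1 - k)) ext_one)
       {ext_smult ((\<Prod>t<Suc i. theta q I t ^ (q - 2 - k)) * (\<Prod>t = Suc i..<length I. theta q I t ^ (q - 1 - k)))
          (Mui q (psum I (Suc i)) B) |i B.
        i < length I \<and> B \<noteq> {} \<and> B \<subseteq> {..<psum I (Suc i)} \<and> psum I i \<le> Max B})"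
proof -
  let ?s = "\<lambda>i. (\<Prod>t<i. theta q I t ^ (q - 2 - k)) * (\<Prod>t = i..<length I. theta q I t ^ (q - 1 - k)) :: 'a mpoly"
  let ?h = "\<lambda>i B. ext_smult (?s i) (Mui q (psum I i) B)"
  \<comment> \<open>The Moore determinant raises the first \<open>i\<close> exponents from
    \<open>q - 2 - k\<close> to \<open>q - 1 - k\<close>, which the remaining thetas already have;
    so the result is the same for every level.\<close>
  have D: "?s i * Lpoly q (psum I i) X = Lpoly q n X ^ (q - 1 - k)" if i: "i \<le> length I" for i
  proof -
    have pw: "u ^ (q - 2 - k) * u = u ^ (q - 1 - k)" for u :: "'a mpoly"
    proof -
      have "q - 1 - k = Suc (q - 2 - k)" using k by simp
      then show ?thesis by (simp add: mult.commute)
    qed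
    have "?s i * Lpoly q (psum I i) X =
        ((\<Prod>t<i. theta q I t) ^ (q - 2 - k) * (\<Prod>t<i. theta q I t)) * (\<Prod>t = i..<length I. theta q I t ^ (q - 1 - k))"
      unfolding prod_theta[OF i, symmetric] prod_power_distrib[symmetric] by (simp only: ac_simps)
    also have "\<dots> = (\<Prod>t<i. theta q I t ^ (q - 1 - k)) * (\<Prod>t = i..<length I. theta q I t ^ (q - 1 - k))"
      unfolding pw by (simp add: prod_power_distrib)
    also have "\<dots> = (\<Prod>t<length I. theta q I t ^ (q - 1 - k))"
      using prod.atLeastLessThan_concat[of 0 i "length I" "\<lambda>t. theta q I t ^ (q - 1 - k) :: 'a mpoly"] i
      by (simp add: lessThan_atLeast0)
    also have "\<dots> = Lpoly q n X ^ (q - 1 - k)"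
      using prod_theta[of "length I" I] by (simp add: prod_power_distrib[symmetric] psum_length)
    finally show ?thesis .
  qed
  have "free_with_basis (inv_ring n P) (inv_module n P k) (2 ^ n) ((\<lambda>B. ?h (lev B) B) ` Pow {..<n})"
  proof (rule free_criterion)
    fix i assume i: "i \<le> length I"
    show "?s i * Lpoly q (psum I i) X \<noteq> 0" unfolding D[OF i] using Lpoly_X_nonzero by simp
    have "const (det g ^ k) * sym_act g (Lpoly q n X ^ (q - 1 - k)) = Lpoly q n X ^ (q - 1 - k)" if g: "g \<in> P" for g
    proof -
      have L: "sym_act g (Lpoly q n X) = const (det g) * Lpoly q n X"
        using sym_act_Lpoly[OF g le_refl psum_length[symmetric]] block_det_n[OF g] by simp
      have "det g \<noteq> 0" using block_det_nonzero[OF g le_refl psum_length[symmetric]] block_det_n[OF g] by simp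
      then have "det g ^ k * det g ^ (q - 1 - k) = 1"
        using k unit_power[of "det g"] by (simp add: power_add[symmetric])
      moreover have "sym_act g (Lpoly q n X ^ (q - 1 - k)) = const (det g ^ (q - 1 - k)) * Lpoly q n X ^ (q - 1 - k)"
        using L by (simp add: sym_act_def poly_subst_power power_mult_distrib const_power)
      ultimately show ?thesis by (simp add: mult.assoc[symmetric] const_mult[symmetric])
    qed
    then show "?s i * Lpoly q (psum I i) X \<in> semi_inv k"
      unfolding D[OF i] by (auto simp: semi_inv_def intro: sym_alg_power sym_alg_Lpoly)
  next
    fix f and d :: "nat set \<Rightarrow> 'a mpoly" and B
    assume d: "\<forall>B. d B \<in> semi_inv k" and B: "B \<subseteq> {..<n}"
    show "?s (lev B) * Lpoly q (psum I (lev B)) X dvd d B"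
      unfolding D[OF lev_le_length[OF B]]
    proof (rule Lpoly_power_dvd)
      fix s c assume s: "s < n"
      show "lin_form s c ^ (q - 1 - k) dvd d B"
        using d X_power_dvd_semi_inv[OF _ k s] s by (intro lin_form_power_dvd_semi_inv[of _ k]) auto
    qed
  qed
  moreover have "?h 0 {} = ext_smult ((\<Prod>t<length I. theta q I t) ^ (q - 1 - k)) ext_one"
    by (simp add: psum_def Mui_0 prod_power_distrib lessThan_atLeast0)
  ultimately show ?thesis unfolding basis_image[of "\<lambda>B. ?h (lev B) B" ?h, OF refl] by simp
qed

end

theorem theorem3p1:
  fixes p r q n :: nat and I :: "nat list"
  assumes "prime p" and "r \<ge> 1" and "q = p ^ r"
    and "CARD('a::{finite,field}) = q"
    and "n \<ge> 1" and "is_composition I n"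
  shows "free_with_basis (inv_ring n (parabolic I :: 'a mat set)) (inv_module n (parabolic I) 0) (2 ^ n)
           (insert ext_one
             {ext_smult (\<Prod>t<Suc i. theta q I t ^ (q - 2)) (Mui q (psum I (Suc i)) B) | i B.
                i < length I \<and> B \<noteq> {} \<and> B \<subseteq> {..<psum I (Suc i)} \<and> psum I i \<le> Max B})
    \<and> (\<forall>k. 1 \<le> k \<and> k \<le> q - 2 \<longrightarrow>
         free_with_basis (inv_ring n (parabolic I :: 'a mat set)) (inv_module n (parabolic I) k) (2 ^ n)
           (insert (ext_smult ((\<Prod>t<length I. theta q I t) ^ (q - 1 - k)) ext_one)
             {ext_smult ((\<Prod>t<Suc i. theta q I t ^ (q - 2 - k)) *
                         (\<Prod>t = Suc i..<length I. theta q I t ^ (q - 1 - k)))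
                (Mui q (psum I (Suc i)) B) | i B.
                i < length I \<and> B \<noteq> {} \<and> B \<subseteq> {..<psum I (Suc i)} \<and> psum I i \<le> Max B}))"
proof -
  interpret parabolic_setup q p r "TYPE('a)" n I
    by unfold_locales (use assms in auto)
  show ?thesis using free_untwisted free_twisted by blast
qed

end
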